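(* Let $T$ and $\tilde T$ be two Sturm–Liouville problems on the same tree as described in the context, with the same matching coefficients $a_{kj},a^1_{kj},a^0_{kj}$ but possibly different potentials $q,\tilde q$ and boundary coefficients $h=(h_0,\dots,h_p)$, $\tilde h=(\tilde h_0,\dots,\tilde h_p)$. If the Weyl vectors coincide, $M_k(\lambda)\equiv\tilde M_k(\lambda)$ for all $k=1,\dots,p$, then $q_j=\tilde q_j$ a.e. on $[0,1]$ for all $j=1,\dots,r$ and $h=\tilde h$. Thus the Weyl vector $M=[M_k]_{k=1}^p$ uniquely determines the potential $q$ on $T$ and the boundary coefficients $h$.
   Context: Tree setup. $T$ is a compact connected tree with vertices $v_0,\dots,v_r$ and edges $e_1,\dots,e_r$, each of length $1$. The root $v_0$ is a boundary vertex (a vertex belonging to exactly one edge). The boundary vertices are $v_0,v_1,\dots,v_p$; every edge is $e_j=[v_{j_k},v_j]$ with $j_k<j$, where $v_{j_k}$ (initial point) lies on the simple path from $v_0$ to $v_j$ (end point); in particular $e_{p+1}=[v_0,v_{p+1}]$, and $e_1,\dots,e_p$ are the boundary edges ending at $v_1,\dots,v_p$. Each edge $e_j$ is parametrized by $x\in[0,1]$ with $x=0$ at its end point $v_j$ and $x=1$ at its initial point. For an internal vertex $v_k$ ($k=p+1,\dots,r$), $R(v_k)$ is the set of edges $e_j=[v_k,v_j]$ emanating from $v_k$. A function on $T$ is $Y=[y_j]_{j=1}^r$ with $y_j$ defined on $e_j$. Equation. $q=[q_j]_{j=1}^r$ with $q_j\in L^1(0,1)$ complex-valued (the potential). Consider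 $-y_j''+q_j(x)y_j=\lambda y_j$, $x\in[0,1]$, $j=1,\dots,r$, with $y_j,y_j'$ absolutely continuous, and matching conditions at each internal vertex $v_k$, $k=p+1,\dots,r$: $y_k(0)=a_{kj}y_j(1)$ for all $e_j\in R(v_k)$, and $y_k'(0)=\sum_{e_j\in R(v_k)}(a^1_{kj}y_j'(1)+a^0_{kj}y_j(1))$, where $a_{kj},a^1_{kj},a^0_{kj}\in\mathbb C$, $a_{kj}a^1_{kj}\neq0$, and the regularity condition $\sum_{e_j\in R(v_k)}a^1_{kj}/a_{kj}\neq-1$ holds for every internal $v_k$. Boundary forms. For $j=1,\dots,p$: $U_{j0}(Y)=y_j'(0)+h_jy_j(0)$, $U_{j1}(Y)=y_j(0)$; at the root: $U_{00}(Y)=y_{p+1}'(1)+h_0y_{p+1}(1)$, $U_{01}(Y)=y_{p+1}(1)$; here $h_0,\dots,h_p\in\mathbb C$. Weyl functions. For $k=1,\dots,p$, the Weyl solution $\Psi_k=[\psi_{kj}]_{j=1}^r$ is the solution of the equation satisfying the matching conditions and $U_{j0}(\Psi_k)=\delta_{jk}$, $j=0,\dots,p$. Writing each component as a combination of the fundamental solutions on the edge reduces this to a linear algebraic system whose determinant $\Delta(\lambda)$ (the characteristic function of the problem $B$: equation, matching conditions, and $U_{j0}(Y)=0$, $j=0,\dots,p$) is entire; $\Psi_k$ exists for $\lambda$ outside the zeros of $\Delta$. The Weyl function is $M_k(\lambda):=U_{k1}(\Psi_k)=\psi_{kk}(0,\lambda)$, a meromorphic function; $M(\lambda)=[M_k(\lambda)]_{k=1}^p$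 is the Weyl vector. *)

theory Defs
  imports "HOL-Analysis.Analysis"
begin

text \<open>Tree: vertices v_0..v_r, edges e_1..e_r, edge e_j = [v_(init j), v_j].
  Boundary vertices v_0,...,v_p; internal vertices v_(p+1),...,v_r; e_(p+1) = [v_0, v_(p+1)].\<close>

definition tree_ok :: "nat \<Rightarrow> nat \<Rightarrow> (nat \<Rightarrow> nat) \<Rightarrow> bool" where
  "tree_ok p r init \<longleftrightarrow>
     p < r \<and>
     (\<forall>j\<in>{1..r}. init j = 0 \<or> (p < init j \<and> init j \<le> r)) \<and>
     (\<forall>j\<in>{1..r}. init j = 0 \<longleftrightarrow> j = p + 1) \<and>
     (\<forall>j\<in>{p+1..r}. init j < j) \<and>
     (\<forall>k\<in>{p+1..r}. \<exists>j\<in>{1..r}. init j = k)"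

definition R_edges :: "nat \<Rightarrow> (nat \<Rightarrow> nat) \<Rightarrow> nat \<Rightarrow> nat set" where
  "R_edges r init k = {j \<in> {1..r}. init j = k}"

definition matching_coeffs_ok ::
  "nat \<Rightarrow> nat \<Rightarrow> (nat \<Rightarrow> nat) \<Rightarrow> (nat \<Rightarrow> nat \<Rightarrow> complex) \<Rightarrow> (nat \<Rightarrow> nat \<Rightarrow> complex) \<Rightarrow> bool" where
  "matching_coeffs_ok p r init a a1 \<longleftrightarrow>
     (\<forall>k\<in>{p+1..r}. (\<forall>j\<in>R_edges r init k. a k j * a1 k j \<noteq> 0) \<and>
                    (\<Sum>j\<in>R_edges r init k. a1 k j / a k j) \<noteq> -1)"

definition abs_cont_on :: "real \<Rightarrow> real \<Rightarrow> (real \<Rightarrow> complex) \<Rightarrow> bool" where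
  "abs_cont_on a b f \<longleftrightarrow>
     (\<forall>\<epsilon>>0. \<exists>\<delta>>0. \<forall>S :: (real \<times> real) set.
        finite S \<longrightarrow>
        (\<forall>(u,v)\<in>S. a \<le> u \<and> u \<le> v \<and> v \<le> b) \<longrightarrow>
        (\<forall>(u,v)\<in>S. \<forall>(u',v')\<in>S. (u,v) \<noteq> (u',v') \<longrightarrow> {u<..<v} \<inter> {u'<..<v'} = {}) \<longrightarrow>
        (\<Sum>(u,v)\<in>S. v - u) < \<delta> \<longrightarrow>
        (\<Sum>(u,v)\<in>S. norm (f v - f u)) < \<epsilon>)"

definition sl_solution ::
  "nat \<Rightarrow> (nat \<Rightarrow> real \<Rightarrow> complex) \<Rightarrow> complex \<Rightarrow> (nat \<Rightarrow> real \<Rightarrow> complex) \<Rightarrow> (nat \<Rightarrow> real \<Rightarrow> complex) \<Rightarrow> bool" where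
  "sl_solution r q lam Y Y' \<longleftrightarrow>
     (\<forall>j\<in>{1..r}. abs_cont_on 0 1 (Y j) \<and> abs_cont_on 0 1 (Y' j) \<and>
        (AE x in lborel. x \<in> {0..1} \<longrightarrow>
           (Y j has_vector_derivative Y' j x) (at x within {0..1}) \<and>
           (\<exists>d. (Y' j has_vector_derivative d) (at x within {0..1}) \<and>
                - d + q j x * Y j x = lam * Y j x)))"

definition matching ::
  "nat \<Rightarrow> nat \<Rightarrow> (nat \<Rightarrow> nat) \<Rightarrow> (nat \<Rightarrow> nat \<Rightarrow> complex) \<Rightarrow> (nat \<Rightarrow> nat \<Rightarrow> complex) \<Rightarrow>
   (nat \<Rightarrow> nat \<Rightarrow> complex) \<Rightarrow> (nat \<Rightarrow> real \<Rightarrow> complex) \<Rightarrow> (nat \<Rightarrow> real \<Rightarrow> complex) \<Rightarrow> bool" where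
  "matching p r init a a1 a0 Y Y' \<longleftrightarrow>
     (\<forall>k\<in>{p+1..r}.
        (\<forall>j\<in>R_edges r init k. Y k 0 = a k j * Y j 1) \<and>
        Y' k 0 = (\<Sum>j\<in>R_edges r init k. a1 k j * Y' j 1 + a0 k j * Y j 1))"

text \<open>Weyl solution Psi_k: U_j0(Psi_k) = delta_jk, j = 0..p (k in 1..p, so U_00 = 0).\<close>
definition weyl_solution ::
  "nat \<Rightarrow> nat \<Rightarrow> (nat \<Rightarrow> nat) \<Rightarrow> (nat \<Rightarrow> nat \<Rightarrow> complex) \<Rightarrow> (nat \<Rightarrow> nat \<Rightarrow> complex) \<Rightarrow>
   (nat \<Rightarrow> nat \<Rightarrow> complex) \<Rightarrow> (nat \<Rightarrow> real \<Rightarrow> complex) \<Rightarrow> (nat \<Rightarrow> complex) \<Rightarrow>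
   nat \<Rightarrow> complex \<Rightarrow> (nat \<Rightarrow> real \<Rightarrow> complex) \<Rightarrow> (nat \<Rightarrow> real \<Rightarrow> complex) \<Rightarrow> bool" where
  "weyl_solution p r init a a1 a0 q h k lam Y Y' \<longleftrightarrow>
     sl_solution r q lam Y Y' \<and> matching p r init a a1 a0 Y Y' \<and>
     Y' (p+1) 1 + h 0 * Y (p+1) 1 = (if k = 0 then 1 else 0) \<and>
     (\<forall>j\<in>{1..p}. Y' j 0 + h j * Y j 0 = (if j = k then 1 else 0))"

definition weyl_regular ::
  "nat \<Rightarrow> nat \<Rightarrow> (nat \<Rightarrow> nat) \<Rightarrow> (nat \<Rightarrow> nat \<Rightarrow> complex) \<Rightarrow> (nat \<Rightarrow> nat \<Rightarrow> complex) \<Rightarrow>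
   (nat \<Rightarrow> nat \<Rightarrow> complex) \<Rightarrow> (nat \<Rightarrow> real \<Rightarrow> complex) \<Rightarrow> (nat \<Rightarrow> complex) \<Rightarrow>
   nat \<Rightarrow> complex \<Rightarrow> bool" where
  "weyl_regular p r init a a1 a0 q h k lam \<longleftrightarrow>
     (\<exists>Y Y'. weyl_solution p r init a a1 a0 q h k lam Y Y') \<and>
     (\<forall>Y Y' Z Z'. weyl_solution p r init a a1 a0 q h k lam Y Y' \<longrightarrow>
                  weyl_solution p r init a a1 a0 q h k lam Z Z' \<longrightarrow>
                  (\<forall>j\<in>{1..r}. \<forall>x\<in>{0..1}. Y j x = Z j x))"

text \<open>Weyl function M_k(lambda) = psi_kk(0, lambda) (meaningful at regular points).\<close>
definition weyl_fun ::
  "nat \<Rightarrow> nat \<Rightarrow> (nat \<Rightarrow> nat) \<Rightarrow> (nat \<Rightarrow> nat \<Rightarrow> complex) \<Rightarrow> (nat \<Rightarrow> nat \<Rightarrow> complex) \<Rightarrow>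
   (nat \<Rightarrow> nat \<Rightarrow> complex) \<Rightarrow> (nat \<Rightarrow> real \<Rightarrow> complex) \<Rightarrow> (nat \<Rightarrow> complex) \<Rightarrow>
   nat \<Rightarrow> complex \<Rightarrow> complex" where
  "weyl_fun p r init a a1 a0 q h k lam =
     (THE m. \<exists>Y Y'. weyl_solution p r init a a1 a0 q h k lam Y Y' \<and> Y k 0 = m)"

end

theory Submission
  imports Defs "HOL-Complex_Analysis.Complex_Analysis" "HOL-Real_Asymp.Real_Asymp"
begin

text \<open>
  Put \<open>lam = - s\<^sup>2\<close> and let \<open>s\<close> tend to infinity in the sector \<open>\<bar>Im s\<bar> \<le> Re s\<close>. The regularity
  condition on the matching coefficients makes every solution that satisfies the homogeneous conditions
  below an edge grow like \<open>exp (s x)\<close>, and every solution that satisfies the conditions in the rest of the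
  tree decay like \<open>exp (- s x)\<close>. Hence for large \<open>s\<close> the Weyl solutions exist, are unique, and are on the
  edges leading to the root fixed up to a factor by the rest of the tree.

  On one edge the Weyl function determines the potential by Bennewitz's proof of the Borg-Marchenko
  theorem: with \<open>\<phi>, S\<close> the solutions with \<open>\<phi> = 1, \<phi>' = - h\<close> and \<open>S = 0, S' = 1\<close> at \<open>0\<close>, equality of the Weyl
  functions turns the cross product \<open>S \<phi>~ - S~ \<phi>\<close> of the two problems into \<open>\<psi> \<phi>~ - \<psi>~ \<phi>\<close> with decaying Weyl
  solutions \<open>\<psi>, \<psi>~\<close>. It is an entire function of \<open>lam\<close> of order at most \<open>1/2\<close> tending to \<open>0\<close> in a half
  plane, so it vanishes by Phragmen-Lindelof and Liouville, which forces \<open>\<phi> = \<phi>~\<close>.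

  The boundary edges are recovered from the given Weyl functions. Once all edges below an internal vertex
  are known, the data at that vertex give the Weyl function of the edge above it, and so on up to the root.
\<close>

section \<open>Absolutely continuous functions and indefinite integrals\<close>

text \<open>The potentials are only integrable, so the equation holds merely almost everywhere. It
  is rewritten in integrated form, which needs both halves of Lebesgue's fundamental theorem of
  calculus for the epsilon-delta notion of absolute continuity. Only large \<open>s\<close> in the
  sector are used. There both problems have unique Weyl solutions, so neither the characteristic
  function nor meromorphic continuation enters; entire functions arise only from solutions with
  fixed initial data. The sector is \<open>Re lam <= 0\<close>, so decay is known up to and on the
  imaginary axis. Order \<open>1/2\<close> lies below the critical order 1 of the opposite half
  plane, hence boundedness carries over to it. A Weyl solution is \<open>S + M * phi\<close>. With
  equal \<open>M\<close> the product \<open>M * phi * phi~\<close> cancels, which is why the cross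
  product decays. Its vanishing means \<open>S / phi = S~ / phi~\<close>, and by the Wronskian the
  derivatives of these quotients are \<open>1 / phi^2\<close> and \<open>1 / phi~^2\<close>. An
  internal edge has no boundary form at its lower end. The one-edge theorem is applied there with
  boundary coefficient 0, the ratio \<open>Y / Y'\<close> at \<open>x = 0\<close> acting as Weyl
  function.\<close>

abbreviation L1 :: "(real \<Rightarrow> complex) \<Rightarrow> bool" where
  "L1 f \<equiv> f absolutely_integrable_on {0..1}"

definition nonoverlapping :: "real \<Rightarrow> real \<Rightarrow> (real \<times> real) set \<Rightarrow> bool" where
  "nonoverlapping a b S \<longleftrightarrow> finite S \<and> (\<forall>(u,v)\<in>S. a \<le> u \<and> u \<le> v \<and> v \<le> b) \<and>
     (\<forall>(u,v)\<in>S. \<forall>(u',v')\<in>S. (u,v) \<noteq> (u',v') \<longrightarrow> {u<..<v} \<inter> {u'<..<v'} = {})"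

lemma abs_cont_on_iff:
  "abs_cont_on a b F \<longleftrightarrow> (\<forall>e>0. \<exists>\<delta>>0. \<forall>S. nonoverlapping a b S \<longrightarrow>
     (\<Sum>(u,v)\<in>S. v - u) < \<delta> \<longrightarrow> (\<Sum>(u,v)\<in>S. norm (F v - F u)) < e)"
  unfolding abs_cont_on_def nonoverlapping_def by (simp only: imp_conjL)

text \<open>The exceptional set is covered by an open set of small measure, on which absolute continuity
  controls the increments; elsewhere the gauge comes from differentiability.\<close>

lemma abs_cont_has_integral:
  assumes "a \<le> b" and AC: "abs_cont_on a b F" and N: "negligible N"
    and der: "\<And>x. x \<in> {a..b} - N \<Longrightarrow> (F has_vector_derivative f x) (at x within {a..b})"
  shows "(f has_integral F b - F a) {a..b}"
proof -
  \<comment> \<open>Zeroing the integrand on \<open>N\<close> leaves tags in \<open>N\<close> with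
    nothing but the increments of \<open>F\<close>, which absolute continuity controls.\<close>
  define g where "g = (\<lambda>x. if x \<in> N then 0 else f x)"
  have "(g has_integral F b - F a) (cbox a b)"
    unfolding has_integral
  proof (intro allI impI)
    fix e :: real assume "e > 0"
    \<comment> \<open>The \<open>+ 1\<close> covers \<open>a = b\<close> and makes the bound below
      strict.\<close>
    define e1 where "e1 = e / (2 * (b - a + 1))"
    have e1: "e1 > 0" "e1 * (b - a) < e/2"
      using \<open>e > 0\<close> \<open>a \<le> b\<close> by (auto simp: e1_def field_simps)
    have "e/2 > 0" using \<open>e > 0\<close> by simp
    with AC obtain \<delta> where \<delta>: "\<delta> > 0" and AC\<delta>: "\<And>S. \<lbrakk>nonoverlapping a b S; (\<Sum>(u,v)\<in>S. v - u) < \<delta>\<rbrakk>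
        \<Longrightarrow> (\<Sum>(u,v)\<in>S. norm (F v - F u)) < e/2"
      unfolding abs_cont_on_iff by blast
    obtain U where U: "open U" "N \<subseteq> U" "U \<in> lmeasurable" "measure lebesgue U < \<delta>"
    proof -
      have N0: "N \<in> null_sets lebesgue" using N by (simp add: negligible_iff_null_sets)
      then obtain T where T: "open T" "N \<subseteq> T" "T - N \<in> lmeasurable" "emeasure lebesgue (T - N) < ennreal \<delta>"
        using sets_lebesgue_outer_open[of N \<delta>] \<delta> by blast
      have Teq: "T = N \<union> (T - N)" using T by blast
      have "T \<in> lmeasurable"
        using fmeasurable.Un[OF negligible_imp_measurable[OF N] T(3)] Teq by simp
      moreover have "measure lebesgue T = measure lebesgue (T - N)"
        by (simp add: measure_Diff_null_set N0 \<open>T \<in> lmeasurable\<close> fmeasurableD)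
      moreover have "measure lebesgue (T - N) < \<delta>"
        using T by (simp add: emeasure_eq_measure2 ennreal_less_iff)
      ultimately show ?thesis using T that by simp
    qed
    have "\<exists>d>0. \<forall>y\<in>{a..b}. \<bar>y - x\<bar> < d \<longrightarrow> norm (F y - F x - (y - x) *\<^sub>R f x) \<le> e1 * \<bar>y - x\<bar>"
      if "x \<in> {a..b} - N" for x
      using der[OF that] e1(1)
      unfolding has_vector_derivative_def has_derivative_within_alt by auto
    then obtain d where d: "\<And>x. x \<in> {a..b} - N \<Longrightarrow> d x > 0"
      "\<And>x y. \<lbrakk>x \<in> {a..b} - N; y \<in> {a..b}; \<bar>y - x\<bar> < d x\<rbrakk> \<Longrightarrow> norm (F y - F x - (y - x) *\<^sub>R f x) \<le> e1 * \<bar>y - x\<bar>"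
      by metis
    define \<gamma> where "\<gamma> = (\<lambda>x. if x \<in> N then U else if x \<in> {a..b} then ball x (d x) else ball x 1)"
    have "gauge \<gamma>"
      using U d(1) by (auto simp: gauge_def \<gamma>_def)
    moreover have "norm ((\<Sum>(x,K)\<in>p. measure lborel K *\<^sub>R g x) - (F b - F a)) < e"
      if p: "p tagged_division_of cbox a b" and fine: "\<gamma> fine p" for p
    proof -
      note pD = tagged_division_ofD[OF p]
      have pab: "p tagged_division_of {a..b}" using p by simp
      have K: "\<exists>u v. K = {u..v} \<and> a \<le> u \<and> u \<le> x \<and> x \<le> v \<and> v \<le> b" if xK: "(x,K) \<in> p" for x K
      proof -
        obtain u v where uv: "K = cbox u v" using pD(4)[OF xK] by blast
        then have "u \<le> x" "x \<le> v" "u \<in> {a..b}" "v \<in> {a..b}"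
          using pD(2,3)[OF xK] by (auto simp: subset_iff)
        then show ?thesis using uv by (intro exI[of _ u] exI[of _ v]) auto
      qed
      have split: "(\<Sum>(x,K)\<in>p. measure lborel K *\<^sub>R g x) - (F b - F a) =
            (\<Sum>(x,K)\<in>p. measure lborel K *\<^sub>R g x - (F (Sup K) - F (Inf K)))"
        using additive_tagged_division_1[OF \<open>a \<le> b\<close> pab, of F]
        by (simp add: sum_subtractf case_prod_unfold)
      let ?T = "\<lambda>(x,K). measure lborel K *\<^sub>R g x - (F (Sup K) - F (Inf K))"
      \<comment> \<open>Degenerate intervals are split off into \<open>p3\<close>: members of
        \<open>p2\<close> have disjoint nonempty interiors, so passing to the interval or to its
        pair of endpoints is injective there.\<close>
      define p1 where "p1 = {xK \<in> p. fst xK \<notin> N}"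
      define p2 where "p2 = {xK \<in> p. fst xK \<in> N \<and> interior (snd xK) \<noteq> {}}"
      define p3 where "p3 = {xK \<in> p. fst xK \<in> N \<and> interior (snd xK) = {}}"
      have fin: "finite p" by fact
      have pU: "p = p1 \<union> (p2 \<union> p3)" "p1 \<inter> (p2 \<union> p3) = {}" "p2 \<inter> p3 = {}"
        by (auto simp: p1_def p2_def p3_def)
      have fin': "finite p1" "finite p2" "finite p3"
        using fin by (auto simp: p1_def p2_def p3_def)
      have "norm (sum ?T p) \<le> norm (sum ?T p1) + (norm (sum ?T p2) + norm (sum ?T p3))"
        unfolding pU(1) using fin' pU
        by (simp add: sum.union_disjoint) (meson add_left_mono norm_triangle_ineq order_trans)
      moreover have "norm (sum ?T p1) \<le> e1 * (b - a)"
      proof -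
        have "norm (?T xK) \<le> e1 * measure lborel (snd xK)" if "xK \<in> p1" for xK
        proof -
          obtain x L where xK: "xK = (x,L)" by force
          with that have xL: "(x,L) \<in> p" "x \<notin> N" by (auto simp: p1_def)
          obtain u v where uv: "L = {u..v}" "a \<le> u" "u \<le> x" "x \<le> v" "v \<le> b"
            using K[OF xL(1)] by blast
          have "L \<subseteq> \<gamma> x"
            using fine xL by (auto simp: fine_def)
          then have "L \<subseteq> ball x (d x)"
            using xL uv by (simp add: \<gamma>_def)
          then have "u \<in> ball x (d x)" "v \<in> ball x (d x)"
            using uv by (simp_all add: subset_iff)
          then have "\<bar>u - x\<bar> < d x" "\<bar>v - x\<bar> < d x"
            by (auto simp: dist_real_def abs_minus_commute)
          then have "norm (F u - F x - (u - x) *\<^sub>R f x) \<le> e1 * \<bar>u - x\<bar>"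
            "norm (F v - F x - (v - x) *\<^sub>R f x) \<le> e1 * \<bar>v - x\<bar>"
            using d(2)[of x u] d(2)[of x v] xL uv by auto
          moreover have "?T xK = (F u - F x - (u - x) *\<^sub>R f x) - (F v - F x - (v - x) *\<^sub>R f x)"
            using uv xL by (simp add: xK g_def content_real algebra_simps)
          ultimately have "norm (?T xK) \<le> e1 * \<bar>u - x\<bar> + e1 * \<bar>v - x\<bar>"
            by (simp only:) (rule norm_triangle_le_diff, linarith)
          also have "\<dots> = e1 * measure lborel (snd xK)"
            using uv by (simp add: xK content_real algebra_simps)
          finally show ?thesis .
        qed
        then have "norm (sum ?T p1) \<le> (\<Sum>xK\<in>p1. e1 * measure lborel (snd xK))"
          by (rule sum_norm_le)
        also have "\<dots> \<le> (\<Sum>xK\<in>p. e1 * measure lborel (snd xK))"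
          using fin e1 by (intro sum_mono2) (auto simp: p1_def)
        also have "\<dots> = e1 * (b - a)"
          using additive_content_tagged_division[OF p] \<open>a \<le> b\<close>
          by (simp add: sum_distrib_left[symmetric] case_prod_unfold content_real)
        finally show ?thesis .
      qed
      moreover have "sum ?T p3 = 0"
      proof (rule sum.neutral, clarify)
        fix x L assume "(x,L) \<in> p3"
        then have xL: "(x,L) \<in> p" "x \<in> N" "interior L = {}" by (auto simp: p3_def)
        obtain u v where uv: "L = {u..v}" "a \<le> u" "u \<le> x" "x \<le> v" "v \<le> b"
          using K[OF xL(1)] by blast
        with xL have "u = v" by (simp add: interior_atLeastAtMost_real)
        then show "measure lborel L *\<^sub>R g x - (F (Sup L) - F (Inf L)) = 0"
          using uv by simp
      qed
      moreover have "norm (sum ?T p2) < e/2"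
      proof -
        let ?h = "\<lambda>xK::real \<times> real set. (Inf (snd xK), Sup (snd xK))"
        have p2p: "(x,L) \<in> p" if "(x,L) \<in> p2" for x L using that by (auto simp: p2_def)
        have inj: "inj_on snd p2"
        proof (rule inj_onI)
          fix s t assume st: "s \<in> p2" "t \<in> p2" "snd s = snd t"
          show "s = t"
          proof (rule ccontr)
            assume "s \<noteq> t"
            then have "interior (snd s) \<inter> interior (snd t) = {}"
              using pD(5)[of "fst s" "snd s" "fst t" "snd t"] p2p st(1,2) by (metis prod.collapse)
            with st show False by (simp add: p2_def)
          qed
        qed
        have inj_h: "inj_on ?h p2"
        proof (rule inj_onI)
          fix s t assume st: "s \<in> p2" "t \<in> p2" "?h s = ?h t"
          then have "snd s = snd t"
            using K[of "fst s" "snd s"] K[of "fst t" "snd t"] by (auto simp: p2_def)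
          with inj st show "s = t" by (auto simp: inj_on_def)
        qed
        have tp: "p2 tagged_partial_division_of cbox a b"
          by (rule tagged_partial_division_subset[of p]) (use p in \<open>auto simp: p2_def tagged_division_of_def\<close>)
        have div: "snd ` p2 division_of \<Union>(snd ` p2)"
          by (rule partial_division_of_tagged_division[OF tp])
        have len: "(\<Sum>(u,v)\<in>?h ` p2. v - u) = (\<Sum>L\<in>snd ` p2. measure lborel L)"
        proof -
          have "(\<Sum>(u,v)\<in>?h ` p2. v - u) = (\<Sum>xK\<in>p2. Sup (snd xK) - Inf (snd xK))"
            by (simp add: sum.reindex[OF inj_h])
          also have "\<dots> = (\<Sum>xK\<in>p2. measure lborel (snd xK))"
          proof (rule sum.cong[OF refl])
            fix xK assume "xK \<in> p2"
            then show "Sup (snd xK) - Inf (snd xK) = measure lborel (snd xK)"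
              using K[of "fst xK" "snd xK"] by (auto simp: p2_def content_real)
          qed
          finally show ?thesis by (simp add: sum.reindex[OF inj])
        qed
        also have "\<dots> = measure lebesgue (\<Union>(snd ` p2))"
        proof (subst content_division[OF div, symmetric], rule sum.cong[OF refl])
          fix L assume "L \<in> snd ` p2"
          then obtain u v where "L = cbox u v" using division_ofD(4)[OF div] by blast
          then show "measure lborel L = measure lebesgue L" by simp
        qed
        also have "\<dots> \<le> measure lebesgue U"
        proof (rule measure_mono_fmeasurable)
          show "\<Union>(snd ` p2) \<subseteq> U"
          proof -
            have "L \<subseteq> U" if "(x,L) \<in> p" "x \<in> N" for x L
            proof -
              have "L \<subseteq> \<gamma> x" using fine that by (auto simp: fine_def)
              then show ?thesis using that by (simp add: \<gamma>_def)
            qed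
            then show ?thesis by (force simp: p2_def)
          qed
          show "\<Union>(snd ` p2) \<in> sets lebesgue"
            using lmeasurable_division[OF div] by blast
        qed (use U in auto)
        also have "\<dots> < \<delta>" by fact
        finally have small: "(\<Sum>(u,v)\<in>?h ` p2. v - u) < \<delta>" .
        have "(\<Sum>(u,v)\<in>?h ` p2. norm (F v - F u)) < e/2"
        proof (rule AC\<delta>[OF _ small], unfold nonoverlapping_def, intro conjI)
          show "finite (?h ` p2)" using fin' by simp
          show "\<forall>(u,v)\<in>?h ` p2. a \<le> u \<and> u \<le> v \<and> v \<le> b"
            using K by (fastforce simp: p2_def)
          show "\<forall>(u,v)\<in>?h ` p2. \<forall>(u',v')\<in>?h ` p2. (u,v) \<noteq> (u',v') \<longrightarrow> {u<..<v} \<inter> {u'<..<v'} = {}"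
          proof -
            have "{Inf L<..<Sup L} \<inter> {Inf L'<..<Sup L'} = {}"
              if *: "(x,L) \<in> p2" "(x',L') \<in> p2" "(Inf L, Sup L) \<noteq> (Inf L', Sup L')" for x L x' L'
            proof -
            have "interior L \<inter> interior L' = {}"
              using *
              pD(5)[OF p2p p2p, of x L x' L'] by auto
            moreover obtain u v where "L = {u..v}" "u \<le> v"
              using K[OF p2p[OF *(1)]] by fastforce
            moreover obtain u' v' where "L' = {u'..v'}" "u' \<le> v'"
              using K[OF p2p[OF *(2)]] by fastforce
            ultimately show ?thesis by simp
            qed
            note disj = this
            show ?thesis
            proof (unfold case_prod_beta, intro ballI impI)
              fix w w' assume w: "w \<in> ?h ` p2" "w' \<in> ?h ` p2" "(fst w, snd w) \<noteq> (fst w', snd w')"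
              from w(1) obtain x L where "(x,L) \<in> p2" "w = (Inf L, Sup L)" by force
              moreover from w(2) obtain x' L' where "(x',L') \<in> p2" "w' = (Inf L', Sup L')" by force
              ultimately show "{fst w<..<snd w} \<inter> {fst w'<..<snd w'} = {}"
                using disj[of x L x' L'] w(3) by simp
            qed
          qed
        qed
        moreover have "norm (sum ?T p2) \<le> (\<Sum>xK\<in>p2. norm (F (Sup (snd xK)) - F (Inf (snd xK))))"
          by (rule sum_norm_le) (auto simp: p2_def g_def norm_minus_commute)
        ultimately show ?thesis by (simp add: sum.reindex[OF inj_h])
      qed
      ultimately show ?thesis unfolding split using e1 by simp
    qed
    ultimately show "\<exists>\<gamma>. gauge \<gamma> \<and> (\<forall>\<D>. \<D> tagged_division_of cbox a b \<and> \<gamma> fine \<D> \<longrightarrow>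
          norm ((\<Sum>(x,K)\<in>\<D>. measure lborel K *\<^sub>R g x) - (F b - F a)) < e)"
      by (intro exI[of _ \<gamma>]) simp
  qed
  then show ?thesis
    unfolding box_real by (rule has_integral_spike[OF N, rotated]) (simp add: g_def)
qed

text \<open>Vitali cover of the bad points by intervals violating the Henstock lemma bound.\<close>

lemma lebesgue_differentiation:
  fixes f :: "real \<Rightarrow> 'a::euclidean_space"
  assumes f: "f integrable_on {a..b}"
  shows "\<exists>N. negligible N \<and> (\<forall>x\<in>{a..b} - N.
     ((\<lambda>y. integral {a..y} f) has_vector_derivative f x) (at x within {a..b}))"
proof -
  define F where "F = (\<lambda>y. integral {a..y} f)"
  define D where "D = (\<lambda>x y. norm (F y - F x - (y - x) *\<^sub>R f x))"
  \<comment> \<open>Points where the linear approximation fails by more than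
    \<open>1 / (n + 1)\<close> of the distance at arbitrarily small scales. Outside all
    \<open>E n\<close> the derivative exists.\<close>
  define E where "E = (\<lambda>n::nat. {x \<in> {a..b}. \<forall>d>0. \<exists>y\<in>{a..b}. y \<noteq> x \<and> \<bar>y - x\<bar> < d \<and>
      \<bar>y - x\<bar> < (real n + 1) * D x y})"
  have Fdiff: "integral {u..v} f = F v - F u" if "a \<le> u" "u \<le> v" "v \<le> b" for u v
  proof -
    have "f integrable_on {a..v}"
      using f that by (auto intro: integrable_subinterval_real)
    then show ?thesis
      using Henstock_Kurzweil_Integration.integral_combine[of a u v f] that by (simp add: F_def algebra_simps)
  qed
  have "negligible (E n)" for n
    unfolding negligible_outer_le
  proof (intro allI impI)
    fix e :: real assume "e > 0"
    define e1 where "e1 = e / (real n + 1)"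
    have e1: "e1 > 0" "(real n + 1) * e1 = e" using \<open>e > 0\<close> by (auto simp: e1_def)
    obtain \<gamma> where \<gamma>: "gauge \<gamma>" and Hen: "\<And>p. \<lbrakk>p tagged_partial_division_of (cbox a b); \<gamma> fine p\<rbrakk> \<Longrightarrow>
             sum (\<lambda>(x,k). norm(measure lborel k *\<^sub>R f x - integral k f)) p < e1"
      using Henstock_lemma[of f a b e1] f e1(1) by auto
    \<comment> \<open>The Vitali balls are the intervals between a tag \<open>x\<close> and a bad
      neighbour \<open>y\<close>, kept inside the gauge; indexing by the pair remembers which
      endpoint is the tag.\<close>
    define K where "K = {(x,y). x \<in> {a..b} \<and> y \<in> {a..b} \<and> x \<noteq> y \<and> {min x y..max x y} \<subseteq> \<gamma> x \<and>
        \<bar>y - x\<bar> < (real n + 1) * D x y}"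
    define c where "c = (\<lambda>(x::real,y). (x + y)/2)"
    define r where "r = (\<lambda>(x::real,y). \<bar>y - x\<bar>/2)"
    have cb: "cball (c (x,y)) (r (x,y)) = {min x y..max x y}" for x y
      by (auto simp: cball_eq_atLeastAtMost c_def r_def min_def max_def field_simps)
    have rpos: "0 < r i" if "i \<in> K" for i
      using that by (auto simp: K_def r_def)
    have vit: "\<exists>i. i \<in> K \<and> x \<in> cball (c i) (r i) \<and> r i < d" if "x \<in> E n" "0 < d" for x d
    proof -
      obtain d1 where d1: "d1 > 0" "ball x d1 \<subseteq> \<gamma> x"
        using \<gamma> unfolding gauge_def open_contains_ball by meson
      have "0 < min d d1" using that d1 by auto
      with that(1) obtain y where y: "y \<in> {a..b}" "y \<noteq> x" "\<bar>y - x\<bar> < min d d1" "\<bar>y - x\<bar> < (real n + 1) * D x y"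
        unfolding E_def by blast
      have "{min x y..max x y} \<subseteq> ball x d1"
        using y by (auto simp: dist_real_def min_def max_def split: if_splits)
      then have "(x,y) \<in> K" using y d1 that by (auto simp: K_def E_def)
      moreover have "x \<in> cball (c (x,y)) (r (x,y))" by (simp add: cb)
      moreover have "r (x,y) < d" using y that by (simp add: r_def)
      ultimately show ?thesis by blast
    qed
    obtain C where C: "countable C" "C \<subseteq> K"
      "pairwise (\<lambda>i j. disjnt (cball (c i) (r i)) (cball (c j) (r j))) C"
      "negligible (E n - (\<Union>i\<in>C. cball (c i) (r i)))"
      by (rule Vitali_covering_theorem_cballs[of K r "E n" c, OF rpos vit])
    \<comment> \<open>Each chosen interval is shorter than \<open>n + 1\<close> times its Henstock
      error, and these errors sum to at most \<open>e1\<close>. Finite subfamilies suffice because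
      the bound passes to the countable union.\<close>
    have bound: "measure lebesgue (\<Union>i\<in>I. cball (c i) (r i)) \<le> e" if I: "I \<subseteq> C" "finite I" for I
    proof -
      let ?k = "\<lambda>i. cball (c i) (r i)"
      define p where "p = (\<lambda>i. (fst i, ?k i)) ` I"
      have IK: "i \<in> K" if "i \<in> I" for i using that I C by blast
      have disj: "?k i \<inter> ?k j = {}" if "i \<in> I" "j \<in> I" "i \<noteq> j" for i j
        using that I C(3) by (auto simp: pairwise_def disjnt_def)
      have ne: "?k i \<noteq> {}" if "i \<in> I" for i
        using rpos[OF IK[OF that]] by simp
      have inj: "inj_on (\<lambda>i. (fst i, ?k i)) I"
      proof (rule inj_onI)
        fix i j assume "i \<in> I" "j \<in> I" "(fst i, ?k i) = (fst j, ?k j)"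
        then show "i = j" using disj[of i j] ne[of i] by auto
      qed
      have tp: "p tagged_partial_division_of cbox a b"
        unfolding tagged_partial_division_of_def
      proof (intro conjI allI impI)
        show "finite p" using I by (simp add: p_def)
        show "x \<in> k" if "(x,k) \<in> p" for x k
          using that cb by (auto simp: p_def)
        show "k \<subseteq> cbox a b" if xk: "(x,k) \<in> p" for x k
        proof -
          obtain y where "(x,y) \<in> I" "k = ?k (x,y)" using xk by (auto simp: p_def)
          then show ?thesis using IK[of "(x,y)"] by (auto simp: K_def cb)
        qed
        show "\<exists>u v. k = cbox u v" if "(x,k) \<in> p" for x k
          using that unfolding p_def cball_eq_atLeastAtMost box_real by auto
        fix x1 k1 x2 k2
        assume *: "(x1,k1) \<in> p \<and> (x2,k2) \<in> p \<and> (x1,k1) \<noteq> (x2,k2)"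
        then obtain i j where ij: "i \<in> I" "j \<in> I" "i \<noteq> j" "k1 = ?k i" "k2 = ?k j"
          by (auto simp: p_def)
        then have "k1 \<inter> k2 = {}" using disj by auto
        then show "interior k1 \<inter> interior k2 = {}"
          using interior_subset[of k1] interior_subset[of k2] by blast
      qed
      have fine: "\<gamma> fine p"
      proof -
        have "?k i \<subseteq> \<gamma> (fst i)" if "i \<in> I" for i
          using IK[OF that] by (cases i) (simp add: K_def cb)
        then show ?thesis by (auto simp: fine_def p_def)
      qed
      have "measure lebesgue (\<Union>i\<in>I. ?k i) \<le> (\<Sum>i\<in>I. measure lebesgue (?k i))"
        using I by (intro measure_UNION_le) auto
      also have "\<dots> \<le> (\<Sum>i\<in>I. (real n + 1) * norm (measure lborel (?k i) *\<^sub>R f (fst i) - integral (?k i) f))"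
      proof (rule sum_mono)
        fix i assume "i \<in> I"
        then obtain x y where i: "i = (x,y)" "(x,y) \<in> K" using IK[of i] by (cases i) auto
        then have xy: "x \<in> {a..b}" "y \<in> {a..b}" "x \<noteq> y" "\<bar>y - x\<bar> < (real n + 1) * D x y"
          by (auto simp: K_def)
        have "norm (measure lborel (?k i) *\<^sub>R f (fst i) - integral (?k i) f) = D x y"
        proof (cases "x \<le> y")
          case True
          then show ?thesis using xy Fdiff[of x y]
            by (simp add: i cb min_def max_def content_real D_def norm_minus_commute)
        next
          case False
          then have "measure lborel (?k i) *\<^sub>R f (fst i) - integral (?k i) f = F y - F x - (y - x) *\<^sub>R f x"
            using xy Fdiff[of y x] by (simp add: i cb min_def max_def content_real algebra_simps)
          then show ?thesis by (simp add: D_def)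
        qed
        moreover have "measure lebesgue (?k i) = \<bar>y - x\<bar>"
          by (simp add: i cb content_real min_def max_def)
        ultimately show "measure lebesgue (?k i) \<le> (real n + 1) * norm (measure lborel (?k i) *\<^sub>R f (fst i) - integral (?k i) f)"
          using xy by simp
      qed
      also have "\<dots> = (real n + 1) * (\<Sum>(x,k)\<in>p. norm (measure lborel k *\<^sub>R f x - integral k f))"
        unfolding p_def by (subst sum.reindex[OF inj]) (simp add: sum_distrib_left)
      also have "\<dots> \<le> (real n + 1) * e1"
        using Hen[OF tp fine] by (intro mult_left_mono) auto
      finally show ?thesis using e1 by simp
    qed
    let ?T = "(\<Union>i\<in>C. cball (c i) (r i))"
    have T: "?T \<in> lmeasurable" "measure lebesgue ?T \<le> e"
      by (rule fmeasurable_UN_bound[OF C(1) _ bound]; simp) (rule measure_UN_bound[OF C(1) _ bound]; simp)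
    have N0: "E n - ?T \<in> null_sets lebesgue"
      using C(4) negligible_iff_null_sets by blast
    have "?T \<union> (E n - ?T) \<in> lmeasurable"
      by (rule fmeasurable.Un[OF T(1) negligible_imp_measurable[OF C(4)]])
    moreover have "measure lebesgue (?T \<union> (E n - ?T)) \<le> e"
      using measure_Un_null_set[OF fmeasurableD[OF T(1)] N0] T by simp
    ultimately show "\<exists>T. E n \<subseteq> T \<and> T \<in> lmeasurable \<and> measure lebesgue T \<le> e"
      by (intro exI[of _ "?T \<union> (E n - ?T)"]) blast
  qed
  then have "negligible (\<Union>n. E n)" by (intro negligible_countable_Union) auto
  moreover have "(F has_vector_derivative f x) (at x within {a..b})" if x: "x \<in> {a..b}" "x \<notin> (\<Union>n. E n)" for x
    unfolding has_vector_derivative_def has_derivative_within_alt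
  proof (intro conjI allI impI)
    show "bounded_linear (\<lambda>h. h *\<^sub>R f x)" by (rule bounded_linear_scaleR_left)
    fix e :: real assume "e > 0"
    obtain n where n: "1 / e < real n" using reals_Archimedean2 by blast
    then have n1: "1 / (real n + 1) < e" using \<open>e > 0\<close>
      by (simp add: field_simps)
    from x obtain d where d: "d > 0" "\<And>y. \<lbrakk>y \<in> {a..b}; y \<noteq> x; \<bar>y - x\<bar> < d\<rbrakk> \<Longrightarrow> \<bar>y - x\<bar> \<ge> (real n + 1) * D x y"
    proof -
      from x have "x \<notin> E n" by blast
      then have "\<exists>d>0. \<forall>y\<in>{a..b}. \<not> (y \<noteq> x \<and> \<bar>y - x\<bar> < d \<and> \<bar>y - x\<bar> < (real n + 1) * D x y)"
        using x(1) unfolding E_def by blast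
      then show ?thesis using that by (metis not_le)
    qed
    have "norm (F y - F x - (y - x) *\<^sub>R f x) \<le> e * norm (y - x)" if "y \<in> {a..b}" "norm (y - x) < d" for y
    proof (cases "y = x")
      case False
      then have "D x y \<le> (1 / (real n + 1)) * \<bar>y - x\<bar>"
        using d(2)[of y] that by (simp add: field_simps)
      also have "\<dots> \<le> e * \<bar>y - x\<bar>" using n1 by (intro mult_right_mono) auto
      finally show ?thesis by (simp add: D_def)
    qed simp
    then show "\<exists>d>0. \<forall>y\<in>{a..b}. norm (y - x) < d \<longrightarrow> norm (F y - F x - (y - x) *\<^sub>R f x) \<le> e * norm (y - x)"
      using d(1) by blast
  qed
  ultimately show ?thesis unfolding F_def by (intro exI[of _ "\<Union>n. E n"]) auto
qed

text \<open>Endpoints do not affect the integrals, and the open intervals are disjoint, so their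
  indicators add up to at most 1.\<close>

lemma sum_integral_nonoverlapping_le:
  fixes d :: "real \<Rightarrow> real"
  assumes "nonoverlapping a b S" and d: "d integrable_on {a..b}" "\<And>x. x \<in> {a..b} \<Longrightarrow> 0 \<le> d x"
  shows "(\<Sum>(u,v)\<in>S. integral {u..v} d) \<le> integral {a..b} d"
proof -
  have S: "finite S" "\<And>u v. (u,v) \<in> S \<Longrightarrow> a \<le> u \<and> u \<le> v \<and> v \<le> b"
    and disj: "\<forall>(u,v)\<in>S. \<forall>(u',v')\<in>S. (u,v) \<noteq> (u',v') \<longrightarrow> {u<..<v} \<inter> {u'<..<v'} = {}"
    using assms(1) unfolding nonoverlapping_def by auto
  let ?I = "\<lambda>w::real \<times> real. {fst w<..<snd w}"
  let ?g = "\<lambda>w x. indicator (?I w) x * d x"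
  have g: "(?g w has_integral integral {fst w..snd w} d) {a..b}" if w: "w \<in> S" for w
  proof -
    have sub: "?I w \<subseteq> {a..b}" "a \<le> fst w" "fst w \<le> snd w" "snd w \<le> b"
      using S(2)[of "fst w" "snd w"] w by auto
    have "d integrable_on {fst w..snd w}"
      by (rule integrable_subinterval_real[OF d(1)]) (use sub in auto)
    then have "(d has_integral integral {fst w..snd w} d) (?I w)"
      using has_integral_open_interval[of d "integral {fst w..snd w} d" "fst w" "snd w"]
      by (simp add: box_real integrable_integral)
    then have "((\<lambda>x. if x \<in> ?I w then d x else 0) has_integral integral {fst w..snd w} d) {a..b}"
      using has_integral_restrict[OF sub(1)] by blast
    then show ?thesis
      by (rule has_integral_eq[rotated]) (auto simp: indicator_def)
  qed
  have dis: "disjoint_family_on ?I S"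
    unfolding disjoint_family_on_def
  proof (intro ballI impI)
    fix m n assume "m \<in> S" "n \<in> S" "m \<noteq> n"
    then have "(fst m, snd m) \<in> S" "(fst n, snd n) \<in> S" "(fst m, snd m) \<noteq> (fst n, snd n)"
      by simp_all
    then show "?I m \<inter> ?I n = {}" using disj by blast
  qed
  have "(\<Sum>(u,v)\<in>S. integral {u..v} d) = (\<Sum>w\<in>S. integral {fst w..snd w} d)"
    by (simp add: case_prod_beta)
  moreover have "((\<lambda>x. \<Sum>w\<in>S. ?g w x) has_integral (\<Sum>w\<in>S. integral {fst w..snd w} d)) {a..b}"
    by (rule has_integral_sum[OF S(1)]) (use g in auto)
  moreover have "(\<Sum>w\<in>S. ?g w x) \<le> d x" if "x \<in> {a..b}" for x
  proof -
    have "(\<Sum>w\<in>S. ?g w x) = (\<Sum>w\<in>S. indicator (?I w) x) * d x"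
      by (simp add: sum_distrib_right)
    also have "(\<Sum>w\<in>S. indicator (?I w) x) = (indicator (\<Union>w\<in>S. ?I w) x :: real)"
      by (rule indicator_UN_disjoint[OF S(1) dis, symmetric])
    also have "\<dots> * d x \<le> d x" using d(2)[OF that] by (auto simp: indicator_def)
    finally show ?thesis .
  qed
  ultimately show ?thesis
    using has_integral_le[OF _ integrable_integral[OF d(1)]] by simp
qed

section \<open>Primitives: the integrated form of \<open>F' = f\<close>\<close>

definition prim :: "(real \<Rightarrow> complex) \<Rightarrow> (real \<Rightarrow> complex) \<Rightarrow> bool" where
  "prim F f \<longleftrightarrow> L1 f \<and> (\<forall>x\<in>{0..1}. (f has_integral F x - F 0) {0..x})"

lemma primD:
  assumes "prim F f"
  shows "L1 f" "f integrable_on {0..1}"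
    "\<And>x. x \<in> {0..1} \<Longrightarrow> (f has_integral F x - F 0) {0..x}"
    "\<And>x. x \<in> {0..1} \<Longrightarrow> F x = F 0 + integral {0..x} f"
proof -
  show *: "L1 f" "\<And>x. x \<in> {0..1} \<Longrightarrow> (f has_integral F x - F 0) {0..x}"
    using assms by (auto simp: prim_def)
  show "f integrable_on {0..1}" using *(1) by (simp add: absolutely_integrable_on_def)
  show "\<And>x. x \<in> {0..1} \<Longrightarrow> F x = F 0 + integral {0..x} f"
    using *(2) by (auto simp: has_integral_iff)
qed

lemma prim_integral:
  assumes "L1 f"
  shows "prim (\<lambda>x. c + integral {0..x} f) f"
  unfolding prim_def
proof (intro conjI ballI)
  fix x :: real assume x: "x \<in> {0..1}"
  have "f integrable_on {0..x}"
    by (rule integrable_subinterval_real[of f 0 1]) (use assms x in \<open>auto simp: absolutely_integrable_on_def\<close>)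
  then show "(f has_integral (c + integral {0..x} f) - (c + integral {0..0} f)) {0..x}"
    by (simp add: integrable_integral)
qed fact

lemma prim_diff_integral:
  assumes "prim F f" "0 \<le> u" "u \<le> v" "v \<le> 1"
  shows "(f has_integral F v - F u) {u..v}"
proof -
  have i: "f integrable_on {0..v}" "f integrable_on {u..v}"
    by (rule integrable_subinterval_real[OF primD(2)[OF assms(1)]]; use assms in auto)+
  have "integral {0..u} f + integral {u..v} f = integral {0..v} f"
    by (rule Henstock_Kurzweil_Integration.integral_combine) (use assms i in auto)
  then have "integral {u..v} f = F v - F u"
    using primD(4)[OF assms(1), of u] primD(4)[OF assms(1), of v] assms by (simp add: algebra_simps)
  then show ?thesis using i(2) by (metis integrable_integral)
qed

lemma prim_continuous: "prim F f \<Longrightarrow> continuous_on {0..1} F"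
proof -
  assume p: "prim F f"
  have "continuous_on {0..1} (\<lambda>x. F 0 + integral {0..x} f)"
    by (intro continuous_intros indefinite_integral_continuous_1 primD(2)[OF p])
  then show ?thesis
    by (rule continuous_on_eq) (rule primD(4)[OF p, symmetric])
qed

lemma abs_int_min:
  fixes f :: "real \<Rightarrow> complex"
  assumes "f absolutely_integrable_on {a..b}"
  shows "(\<lambda>x. min (norm (f x)) k) integrable_on {a..b}"
proof -
  have "(\<lambda>x. norm (f x)) absolutely_integrable_on {a..b}"
    using absolutely_integrable_norm[OF assms] by (simp add: o_def)
  moreover have "(\<lambda>x. k) absolutely_integrable_on {a..b}" by simp
  ultimately show ?thesis
    using absolutely_integrable_min_1 absolutely_integrable_on_def by blast
qed

text \<open>Truncation: \<open>min (norm f) k\<close> contributes at most \<open>k\<close> times the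
  total length, and the remainder has a small integral for large \<open>k\<close> by dominated
  convergence.\<close>

lemma prim_abs_cont:
  assumes p: "prim F f"
  shows "abs_cont_on 0 1 F"
  unfolding abs_cont_on_iff
proof (intro allI impI)
  fix e :: real assume "e > 0"
  define h where "h = (\<lambda>x. norm (f x))"
  define g where "g = (\<lambda>(k::nat) x. min (h x) (real k))"
  have hi: "h integrable_on {0..1}"
    using primD(1)[OF p] by (simp add: absolutely_integrable_on_def h_def)
  have gi: "g k integrable_on {0..1}" for k
    unfolding g_def h_def by (rule abs_int_min) (rule primD(1)[OF p])
  have "(\<lambda>k. integral {0..1} (g k)) \<longlonglongrightarrow> integral {0..1} h"
  proof (rule dominated_convergence(2)[OF gi hi])
    show "norm (g k x) \<le> h x" for k x by (simp add: g_def h_def)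
    show "(\<lambda>k. g k x) \<longlonglongrightarrow> h x" for x
    proof (rule tendsto_eventually)
      obtain n where n: "h x \<le> real n" using real_arch_simple by blast
      have "eventually (\<lambda>k. k \<ge> n) sequentially" by (rule eventually_ge_at_top)
      then show "eventually (\<lambda>k. g k x = h x) sequentially"
        by eventually_elim (use n in \<open>auto simp: g_def\<close>)
    qed
  qed
  then have "eventually (\<lambda>k. dist (integral {0..1} (g k)) (integral {0..1} h) < e/2) sequentially"
    using \<open>e > 0\<close> by (intro tendstoD) auto
  then obtain k where k: "dist (integral {0..1} (g k)) (integral {0..1} h) < e/2"
    by (auto simp: eventually_sequentially)
  define d where "d = (\<lambda>x. h x - g k x)"
  have di: "d integrable_on {0..1}" unfolding d_def by (intro integrable_diff hi gi)
  have d0: "0 \<le> d x" for x by (simp add: d_def g_def)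
  have dsmall: "integral {0..1} d < e/2"
    using k integral_diff[OF hi gi, of k] by (auto simp: d_def dist_real_def abs_if split: if_splits)
  define \<delta> where "\<delta> = e / (2 * (real k + 1))"
  have \<delta>: "\<delta> > 0" "real k * \<delta> \<le> e/2"
    using \<open>e > 0\<close> by (auto simp: \<delta>_def field_simps)
  show "\<exists>\<delta>>0. \<forall>S. nonoverlapping 0 1 S \<longrightarrow> (\<Sum>(u,v)\<in>S. v - u) < \<delta> \<longrightarrow> (\<Sum>(u,v)\<in>S. norm (F v - F u)) < e"
  proof (intro exI[of _ \<delta>] conjI allI impI)
    fix S :: "(real \<times> real) set"
    assume S: "nonoverlapping 0 1 S" and small: "(\<Sum>(u,v)\<in>S. v - u) < \<delta>"
    have S2: "0 \<le> u \<and> u \<le> v \<and> v \<le> 1" if "(u,v) \<in> S" for u v using S that by (auto simp: nonoverlapping_def)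
    have "(\<Sum>(u,v)\<in>S. norm (F v - F u)) \<le> (\<Sum>(u,v)\<in>S. real k * (v - u) + integral {u..v} d)"
    proof (rule sum_mono, clarify)
      fix u v assume "(u,v) \<in> S"
      then have uv: "0 \<le> u" "u \<le> v" "v \<le> 1" using S2 by auto
      have i: "d integrable_on {u..v}" "f integrable_on {u..v}"
        using integrable_subinterval_real[OF di] integrable_subinterval_real[OF primD(2)[OF p]] uv by auto
      have ci: "((\<lambda>x. real k) has_integral real k * (v - u)) {u..v}"
        using has_integral_const_real[of "real k" u v] uv by (simp add: mult.commute)
      have "norm (integral {u..v} f) \<le> integral {u..v} (\<lambda>x. real k + d x)"
      proof (rule integral_norm_bound_integral)
        show "(\<lambda>x. real k + d x) integrable_on {u..v}"
          by (intro integrable_add i) auto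
        show "norm (f x) \<le> real k + d x" for x by (auto simp: d_def g_def h_def)
      qed fact
      moreover have "F v - F u = integral {u..v} f"
        using prim_diff_integral[OF p uv] by (simp add: has_integral_iff)
      moreover have "integral {u..v} (\<lambda>x. real k + d x) = real k * (v - u) + integral {u..v} d"
        using has_integral_add[OF ci integrable_integral[OF i(1)]] by (rule integral_unique)
      ultimately show "norm (F v - F u) \<le> real k * (v - u) + integral {u..v} d" by simp
    qed
    also have "\<dots> = real k * (\<Sum>(u,v)\<in>S. v - u) + (\<Sum>(u,v)\<in>S. integral {u..v} d)"
      by (simp add: case_prod_beta sum.distrib sum_distrib_left)
    also have "(\<Sum>(u,v)\<in>S. integral {u..v} d) \<le> integral {0..1} d"
      by (rule sum_integral_nonoverlapping_le[OF S di d0])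
    also have "real k * (\<Sum>(u,v)\<in>S. v - u) \<le> real k * \<delta>"
      using small by (intro mult_left_mono) auto
    finally show "(\<Sum>(u,v)\<in>S. norm (F v - F u)) < e" using \<delta> dsmall by linarith
  qed (use \<delta> in auto)
qed

lemma prim_has_derivative_AE:
  assumes p: "prim F f"
  shows "\<exists>N. negligible N \<and> (\<forall>x\<in>{0..1} - N. (F has_vector_derivative f x) (at x within {0..1}))"
proof -
  obtain N where N: "negligible N"
    "\<And>x. x \<in> {0..1} - N \<Longrightarrow> ((\<lambda>y. integral {0..y} f) has_vector_derivative f x) (at x within {0..1})"
    using lebesgue_differentiation[OF primD(2)[OF p]] by blast
  have "(F has_vector_derivative f x) (at x within {0..1})" if x: "x \<in> {0..1} - N" for x
  proof -
    have "((\<lambda>y. F 0 + integral {0..y} f) has_vector_derivative 0 + f x) (at x within {0..1})"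
      by (intro has_vector_derivative_add has_vector_derivative_const N(2)[OF x])
    then show ?thesis
      using has_vector_derivative_transform[of x "{0..1}" F, OF _ primD(4)[OF p]] x by simp
  qed
  with N(1) show ?thesis by blast
qed

lemma abs_cont_on_mono:
  assumes "abs_cont_on a b F" "a \<le> a'" "b' \<le> b"
  shows "abs_cont_on a' b' F"
proof -
  have "nonoverlapping a b S" if "nonoverlapping a' b' S" for S
    using that assms(2,3) unfolding nonoverlapping_def by fastforce
  with assms(1) show ?thesis unfolding abs_cont_on_iff by meson
qed

text \<open>With \<open>prim_abs_cont\<close> and \<open>prim_has_derivative_AE\<close> this
  identifies \<open>prim\<close> with absolute continuity plus an integrable derivative almost
  everywhere.\<close>

lemma primI_AE:
  assumes AC: "abs_cont_on 0 1 F" and N: "negligible N" and f: "L1 f"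
    and der: "\<And>x. x \<in> {0..1} - N \<Longrightarrow> (F has_vector_derivative f x) (at x within {0..1})"
  shows "prim F f"
  unfolding prim_def
proof (intro conjI ballI)
  fix x :: real assume x: "x \<in> {0..1}"
  show "(f has_integral F x - F 0) {0..x}"
  proof (rule abs_cont_has_integral[OF _ _ N])
    show "0 \<le> x" "abs_cont_on 0 x F" using x abs_cont_on_mono[OF AC] by auto
    fix t assume "t \<in> {0..x} - N"
    then show "(F has_vector_derivative f t) (at t within {0..x})"
      by (intro has_vector_derivative_within_subset[OF der[of t]]) (use x in auto)
  qed
qed fact

lemma abs_int_mult_continuous:
  fixes f g :: "real \<Rightarrow> complex"
  assumes f: "f absolutely_integrable_on {a..b}" and g: "continuous_on {a..b} g"
  shows "(\<lambda>x. f x * g x) absolutely_integrable_on {a..b}"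
proof -
  have "(\<lambda>x. g x * f x) absolutely_integrable_on {a..b}"
  proof (rule absolutely_integrable_bounded_measurable_product[where h = "(*)"])
    show "bilinear ((*) :: complex \<Rightarrow> _)" by (rule bilinear_times)
    show "g \<in> borel_measurable (lebesgue_on {a..b})"
      by (rule continuous_imp_measurable_on_sets_lebesgue[OF g]) auto
    show "bounded (g ` {a..b})"
      using compact_continuous_image[OF g] compact_imp_bounded by blast
  qed (use f in auto)
  then show ?thesis by (simp add: mult.commute)
qed

lemma abs_cont_on_mult:
  assumes F: "abs_cont_on a b F" "\<And>x. x \<in> {a..b} \<Longrightarrow> norm (F x) \<le> B"
    and G: "abs_cont_on a b G" "\<And>x. x \<in> {a..b} \<Longrightarrow> norm (G x) \<le> B"
  shows "abs_cont_on a b (\<lambda>x. F x * G x)"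
  unfolding abs_cont_on_iff
proof (intro allI impI)
  fix e :: real assume "e > 0"
  define e1 where "e1 = e / (2 * (\<bar>B\<bar> + 1))"
  have e1: "e1 > 0" "\<bar>B\<bar> * e1 < e/2" using \<open>e > 0\<close> by (auto simp: e1_def field_simps)
  obtain d1 where d1: "d1 > 0" and F1: "\<And>S. \<lbrakk>nonoverlapping a b S; (\<Sum>(u,v)\<in>S. v - u) < d1\<rbrakk>
      \<Longrightarrow> (\<Sum>(u,v)\<in>S. norm (F v - F u)) < e1"
    using F(1) e1(1) unfolding abs_cont_on_iff by blast
  obtain d2 where d2: "d2 > 0" and G1: "\<And>S. \<lbrakk>nonoverlapping a b S; (\<Sum>(u,v)\<in>S. v - u) < d2\<rbrakk>
      \<Longrightarrow> (\<Sum>(u,v)\<in>S. norm (G v - G u)) < e1"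
    using G(1) e1(1) unfolding abs_cont_on_iff by blast
  show "\<exists>\<delta>>0. \<forall>S. nonoverlapping a b S \<longrightarrow> (\<Sum>(u,v)\<in>S. v - u) < \<delta> \<longrightarrow> (\<Sum>(u,v)\<in>S. norm (F v * G v - F u * G u)) < e"
  proof (intro exI[of _ "min d1 d2"] conjI allI impI)
    fix S :: "(real \<times> real) set"
    assume S: "nonoverlapping a b S" and small: "(\<Sum>(u,v)\<in>S. v - u) < min d1 d2"
    have "(\<Sum>(u,v)\<in>S. norm (F v * G v - F u * G u)) \<le>
          (\<Sum>(u,v)\<in>S. \<bar>B\<bar> * norm (F v - F u) + \<bar>B\<bar> * norm (G v - G u))"
    proof (rule sum_mono, clarify)
      fix u v assume "(u,v) \<in> S"
      then have uv: "u \<in> {a..b}" "v \<in> {a..b}" using S by (auto simp: nonoverlapping_def)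
      have "F v * G v - F u * G u = (F v - F u) * G v + F u * (G v - G u)" by (simp add: algebra_simps)
      then have "norm (F v * G v - F u * G u) \<le> norm (F v - F u) * norm (G v) + norm (F u) * norm (G v - G u)"
        by (metis norm_mult norm_triangle_ineq)
      also have "norm (F v - F u) * norm (G v) \<le> norm (F v - F u) * \<bar>B\<bar>"
        using G(2)[OF uv(2)] by (intro mult_left_mono) auto
      also have "norm (F u) * norm (G v - G u) \<le> \<bar>B\<bar> * norm (G v - G u)"
        using F(2)[OF uv(1)] by (intro mult_right_mono) auto
      finally show "norm (F v * G v - F u * G u) \<le> \<bar>B\<bar> * norm (F v - F u) + \<bar>B\<bar> * norm (G v - G u)"
        by (simp add: mult.commute)
    qed
    also have "\<dots> = \<bar>B\<bar> * (\<Sum>(u,v)\<in>S. norm (F v - F u)) + \<bar>B\<bar> * (\<Sum>(u,v)\<in>S. norm (G v - G u))"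
      by (simp add: case_prod_beta sum.distrib sum_distrib_left)
    also have "\<dots> \<le> \<bar>B\<bar> * e1 + \<bar>B\<bar> * e1"
      using F1[OF S] G1[OF S] small by (intro add_mono mult_left_mono) auto
    also have "\<dots> < e" using e1 by (simp add: mult.commute)
    finally show "(\<Sum>(u,v)\<in>S. norm (F v * G v - F u * G u)) < e" .
  qed (use d1 d2 in auto)
qed

text \<open>Integration by parts. It is obtained through derivatives: the product is absolutely
  continuous, and the product rule holds off the union of the two exceptional sets.\<close>

lemma prim_mult:
  assumes F: "prim F f" and G: "prim G g"
  shows "prim (\<lambda>x. F x * G x) (\<lambda>x. F x * g x + f x * G x)"
proof -
  obtain N where N: "negligible N" "\<And>x. x \<in> {0..1} - N \<Longrightarrow> (F has_vector_derivative f x) (at x within {0..1})"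
    using prim_has_derivative_AE[OF F] by blast
  obtain M where M: "negligible M" "\<And>x. x \<in> {0..1} - M \<Longrightarrow> (G has_vector_derivative g x) (at x within {0..1})"
    using prim_has_derivative_AE[OF G] by blast
  have "bounded (F ` {0..1})" "bounded (G ` {0..1})"
    using prim_continuous[OF F] prim_continuous[OF G] compact_continuous_image compact_imp_bounded
    by blast+
  then obtain B1 B2 where B: "\<And>x. x \<in> {0..1} \<Longrightarrow> norm (F x) \<le> B1" "\<And>x. x \<in> {0..1} \<Longrightarrow> norm (G x) \<le> B2"
    unfolding bounded_iff by (metis image_eqI)
  show ?thesis
  proof (rule primI_AE)
    show "abs_cont_on 0 1 (\<lambda>x. F x * G x)"
      by (rule abs_cont_on_mult[where B = "max B1 B2"]) (use prim_abs_cont F G B in \<open>auto intro: max.coboundedI1 max.coboundedI2\<close>)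
    show "negligible (N \<union> M)" using N M by (simp add: negligible_Un)
    have "(\<lambda>x. g x * F x + f x * G x) absolutely_integrable_on {0..1}"
      by (intro set_integral_add abs_int_mult_continuous primD(1)[OF F] primD(1)[OF G] prim_continuous[OF F] prim_continuous[OF G])
    then show "(\<lambda>x. F x * g x + f x * G x) absolutely_integrable_on {0..1}"
      by (simp add: mult.commute)
    show "((\<lambda>x. F x * G x) has_vector_derivative F x * g x + f x * G x) (at x within {0..1})"
      if "x \<in> {0..1} - (N \<union> M)" for x
      using that N M by (intro has_vector_derivative_mult) auto
  qed
qed

lemma prim_C1:
  assumes "\<And>x. x \<in> {0..1} \<Longrightarrow> (F has_vector_derivative f x) (at x within {0..1})" "continuous_on {0..1} f"
  shows "prim F f"
  unfolding prim_def
proof (intro conjI ballI)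
  show "L1 f" by (rule absolutely_integrable_continuous_real) fact
  fix x :: real assume x: "x \<in> {0..1}"
  show "(f has_integral F x - F 0) {0..x}"
  proof (rule fundamental_theorem_of_calculus)
    show "0 \<le> x" using x by simp
    fix t assume "t \<in> {0..x}"
    then show "(F has_vector_derivative f t) (at t within {0..x})"
      by (intro has_vector_derivative_within_subset[OF assms(1)[of t]]) (use x in auto)
  qed
qed

lemma prim_has_vector_derivative:
  assumes p: "prim F f" and c: "continuous_on {0..1} f" and x: "x \<in> {0..1}"
  shows "(F has_vector_derivative f x) (at x within {0..1})"
proof -
  have "((\<lambda>y. F 0 + integral {0..y} f) has_vector_derivative 0 + f x) (at x within {0..1})"
    by (intro has_vector_derivative_add has_vector_derivative_const integral_has_vector_derivative c x)
  then show ?thesis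
    using has_vector_derivative_transform[of x "{0..1}" F, OF _ primD(4)[OF p]] x by simp
qed

lemma prim_add: "prim F f \<Longrightarrow> prim G g \<Longrightarrow> prim (\<lambda>x. F x + G x) (\<lambda>x. f x + g x)"
  unfolding prim_def
  by (auto simp: add_diff_add intro!: set_integral_add has_integral_add)

lemma prim_cmult: "prim F f \<Longrightarrow> prim (\<lambda>x. c * F x) (\<lambda>x. c * f x)"
  unfolding prim_def
  by (auto simp: right_diff_distrib[symmetric] intro: has_integral_mult_right)

lemma prim_cong:
  assumes "prim F f" "\<And>x. x \<in> {0..1} \<Longrightarrow> F x = G x" "\<And>x. x \<in> {0..1} \<Longrightarrow> f x = g x"
  shows "prim G g"
  unfolding prim_def
proof (intro conjI ballI)
  show "L1 g"
    using primD(1)[OF assms(1)] assms(3) by (subst set_integrable_cong) auto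
  fix x :: real assume x: "x \<in> {0..1}"
  have "(f has_integral G x - G 0) {0..x}"
    using primD(3)[OF assms(1) x] assms(2)[of x] assms(2)[of 0] x by simp
  then show "(g has_integral G x - G 0) {0..x}"
    by (rule has_integral_eq[rotated]) (use assms(3) x in auto)
qed

lemma prim_norm_diff_le:
  assumes "prim F f" "x \<in> {0..1}" "g integrable_on {0..x}" "\<And>t. t \<in> {0..x} \<Longrightarrow> norm (f t) \<le> g t"
  shows "norm (F x - F 0) \<le> integral {0..x} g"
  using primD(3)[OF assms(1,2)] integral_norm_bound_integral[OF _ assms(3,4)]
  by (auto simp: has_integral_iff)

lemma prim_constant_AE_zero:
  assumes p: "prim F f" and c: "\<And>x. x \<in> {0..1} \<Longrightarrow> F x = c"
  shows "\<exists>N. negligible N \<and> (\<forall>x\<in>{0..1} - N. f x = 0)"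
proof -
  obtain N where N: "negligible N" "\<And>x. x \<in> {0..1} - N \<Longrightarrow> (F has_vector_derivative f x) (at x within {0..1})"
    using prim_has_derivative_AE[OF p] by blast
  have "f x = 0" if x: "x \<in> {0..1} - N" for x
  proof -
    have "((\<lambda>_. c) has_vector_derivative f x) (at x within {0..1})"
      by (rule has_vector_derivative_transform[OF _ _ N(2)[OF x]]) (use c x in auto)
    then show ?thesis
      using vector_derivative_unique_within_closed_interval[of 0 1 x "\<lambda>_. c" "f x" 0] x
        has_vector_derivative_const by auto
  qed
  with N(1) show ?thesis by blast
qed

section \<open>The initial value problem on one edge\<close>

text \<open>The equation as a first-order system for \<open>y\<close> and \<open>z = y'\<close>, in
  integrated form.\<close>

definition edge_sol :: "(real \<Rightarrow> complex) \<Rightarrow> complex \<Rightarrow> (real \<Rightarrow> complex) \<Rightarrow> (real \<Rightarrow> complex) \<Rightarrow> bool" where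
  "edge_sol q l y z \<longleftrightarrow> prim y z \<and> prim z (\<lambda>x. (q x - l) * y x)"

lemma edge_solD:
  assumes "edge_sol q l y z"
  shows "prim y z" "prim z (\<lambda>x. (q x - l) * y x)" "continuous_on {0..1} y" "continuous_on {0..1} z"
  using assms prim_continuous unfolding edge_sol_def by blast+

lemma prim_eq_const: "prim F (\<lambda>x. 0) \<Longrightarrow> x \<in> {0..1} \<Longrightarrow> F x = F 0"
  using primD(4)[of F "\<lambda>x. 0" x] by simp

text \<open>The coefficient \<open>q - l\<close> enters both products in the same way and cancels in
  the derivative.\<close>

lemma wronskian_const:
  assumes s: "edge_sol q l y z" "edge_sol q l u v" and x: "x \<in> {0..1}"
  shows "y x * v x - z x * u x = y 0 * v 0 - z 0 * u 0"
proof -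
  have "prim (\<lambda>x. y x * v x + (-1) * (z x * u x))
     (\<lambda>x. (y x * ((q x - l) * u x) + z x * v x) + (-1) * (z x * v x + (q x - l) * y x * u x))"
    using s by (intro prim_add prim_cmult prim_mult) (auto simp: edge_sol_def)
  then have "prim (\<lambda>x. y x * v x - z x * u x) (\<lambda>x. 0)"
    by (rule prim_cong) (auto simp: algebra_simps)
  from prim_eq_const[OF this x] show ?thesis .
qed

lemma sol_add: "edge_sol q l y z \<Longrightarrow> edge_sol q l u v \<Longrightarrow> edge_sol q l (\<lambda>x. y x + u x) (\<lambda>x. z x + v x)"
  unfolding edge_sol_def using prim_add[of z _ v] by (auto intro: prim_add simp: distrib_left)

lemma sol_cmult: "edge_sol q l y z \<Longrightarrow> edge_sol q l (\<lambda>x. c * y x) (\<lambda>x. c * z x)"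
  unfolding edge_sol_def using prim_cmult[of z _ c] by (auto intro: prim_cmult simp: mult.left_commute)

lemma sol_lincomb:
  assumes "edge_sol q l y z" "edge_sol q l u v"
  shows "edge_sol q l (\<lambda>x. c * y x + d * u x) (\<lambda>x. c * z x + d * v x)"
  using sol_add[OF sol_cmult[OF assms(1)] sol_cmult[OF assms(2)]] .

lemma prim_power:
  assumes "prim F f"
  shows "prim (\<lambda>x. F x ^ Suc n) (\<lambda>x. of_nat (Suc n) * F x ^ n * f x)"
proof (induction n)
  case 0
  then show ?case using assms by simp
next
  case (Suc n)
  show ?case by (rule prim_cong[OF prim_mult[OF assms Suc]]) (auto simp: algebra_simps)
qed

text \<open>The iterated integrals behind the \<open>1 / fact n\<close> decay of Picard iteration.
  The detour through complex values gives access to the chain rule for \<open>prim\<close>.\<close>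

lemma has_integral_power_primitive:
  fixes g :: "real \<Rightarrow> real"
  assumes g: "g integrable_on {0..1}" "\<And>x. x \<in> {0..1} \<Longrightarrow> 0 \<le> g x" and x: "x \<in> {0..1}"
  shows "((\<lambda>t. g t * integral {0..t} g ^ n / fact n) has_integral integral {0..x} g ^ Suc n / fact (Suc n)) {0..x}"
proof -
  let ?G = "\<lambda>x. integral {0..x} g"
  have "g absolutely_integrable_on {0..1}"
    by (rule nonnegative_absolutely_integrable_1[OF g])
  then have ac: "(\<lambda>x. complex_of_real (g x)) absolutely_integrable_on {0..1}"
    using absolutely_integrable_linear[OF _ bounded_linear_of_real] by (fastforce simp: o_def)
  have gi: "g integrable_on {0..t}" if "t \<in> {0..1}" for t
    by (rule integrable_subinterval_real[OF g(1)]) (use that in auto)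
  have "prim (\<lambda>x. of_real (?G x)) (\<lambda>x. of_real (g x))"
  proof (rule prim_cong[OF prim_integral[OF ac, of 0]])
    fix t :: real assume "t \<in> {0..1}"
    then have "((\<lambda>x. complex_of_real (g x)) has_integral of_real (?G t)) {0..t}"
      using has_integral_linear[OF integrable_integral[OF gi] bounded_linear_of_real, of t] by (simp add: o_def)
    then show "0 + integral {0..t} (\<lambda>x. complex_of_real (g x)) = of_real (?G t)"
      by (simp add: integral_unique)
  qed auto
  from prim_cmult[OF prim_power[OF this, of n], of "1 / of_real (fact (Suc n))"]
  have "prim (\<lambda>x. of_real (?G x ^ Suc n / fact (Suc n))) (\<lambda>x. of_real (g x * ?G x ^ n / fact n))"
    by (rule prim_cong) (auto simp: field_simps simp del: of_nat_Suc)
  from primD(3)[OF this x]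
  have "((\<lambda>t. complex_of_real (g t * ?G t ^ n / fact n)) has_integral of_real (?G x ^ Suc n / fact (Suc n))) {0..x}"
    by (simp only: of_real_diff[symmetric] integral_refl) simp
  from has_integral_linear[OF this bounded_linear_Re] show ?thesis by (simp only: o_def Re_complex_of_real)
qed

lemma summable_power_fact: "summable (\<lambda>n. c ^ n / fact n :: real)"
  using summable_exp[of c] by (simp add: divide_inverse mult.commute)

text \<open>The weight \<open>g\<close> dominates both coefficients of the system, 1 and
  \<open>norm (q - l)\<close>, so the sum of the two norms obeys one scalar recursion. Keeping the
  old and new pairs separate lets it serve uniqueness (same pair) and existence (successive
  terms).\<close>

lemma picard_step_bound:
  fixes q :: "real \<Rightarrow> complex" and g :: "real \<Rightarrow> real"
  assumes g: "g integrable_on {0..1}" "\<And>x. x \<in> {0..1} \<Longrightarrow> 1 \<le> g x" "\<And>x. x \<in> {0..1} \<Longrightarrow> norm (q x - l) \<le> g x"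
    and y1: "prim y1 z0" "y1 0 = 0" and z1: "prim z1 (\<lambda>x. (q x - l) * y0 x)" "z1 0 = 0"
    and b: "\<And>t. t \<in> {0..1} \<Longrightarrow> norm (y0 t) + norm (z0 t) \<le> K * integral {0..t} g ^ n / fact n"
    and x: "x \<in> {0..1}"
  shows "norm (y1 x) + norm (z1 x) \<le> K * integral {0..x} g ^ Suc n / fact (Suc n)"
proof -
  have g0: "0 \<le> g t" if "t \<in> {0..1}" for t using g(2)[OF that] by linarith
  have sub: "{0..x} \<subseteq> {0..1}" using x by auto
  have zi: "(\<lambda>t. norm (z0 t)) integrable_on {0..x}" and wi: "(\<lambda>t. norm ((q t - l) * y0 t)) integrable_on {0..x}"
    using integrable_subinterval_real[OF _ sub] primD(1)[OF y1(1)] primD(1)[OF z1(1)]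
    unfolding absolutely_integrable_on_def by blast+
  have "norm (y1 x) \<le> integral {0..x} (\<lambda>t. norm (z0 t))"
    using prim_norm_diff_le[OF y1(1) x zi] y1(2) by simp
  moreover have "norm (z1 x) \<le> integral {0..x} (\<lambda>t. norm ((q t - l) * y0 t))"
    using prim_norm_diff_le[OF z1(1) x wi] z1(2) by simp
  moreover have "integral {0..x} (\<lambda>t. norm (z0 t)) + integral {0..x} (\<lambda>t. norm ((q t - l) * y0 t))
      = integral {0..x} (\<lambda>t. norm (z0 t) + norm ((q t - l) * y0 t))"
    by (rule integral_add[OF zi wi, symmetric])
  moreover have "\<dots> \<le> K * (integral {0..x} g ^ Suc n / fact (Suc n))"
  proof (rule has_integral_le)
    show "((\<lambda>t. norm (z0 t) + norm ((q t - l) * y0 t)) has_integral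
        integral {0..x} (\<lambda>t. norm (z0 t) + norm ((q t - l) * y0 t))) {0..x}"
      by (intro integrable_integral integrable_add zi wi)
    show "((\<lambda>t. K * (g t * integral {0..t} g ^ n / fact n)) has_integral
        K * (integral {0..x} g ^ Suc n / fact (Suc n))) {0..x}"
      by (intro has_integral_mult_right has_integral_power_primitive g(1) g0 x)
    fix t assume "t \<in> {0..x}"
    then have t: "t \<in> {0..1}" using sub by auto
    have "norm (z0 t) + norm ((q t - l) * y0 t) \<le> g t * norm (z0 t) + g t * norm (y0 t)"
      using g(2,3)[OF t] mult_right_mono[of 1 "g t" "norm (z0 t)"]
      by (intro add_mono) (auto simp: norm_mult intro: mult_right_mono)
    also have "\<dots> = g t * (norm (y0 t) + norm (z0 t))" by (simp add: algebra_simps)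
    also have "\<dots> \<le> g t * (K * integral {0..t} g ^ n / fact n)"
      by (rule mult_left_mono[OF b[OF t] g0[OF t]])
    finally show "norm (z0 t) + norm ((q t - l) * y0 t) \<le> K * (g t * integral {0..t} g ^ n / fact n)"
      by (simp add: mult.left_commute)
  qed
  ultimately show ?thesis by simp
qed

text \<open>Using \<open>R\<close> instead of \<open>norm l\<close> makes the later bounds uniform
  on discs in \<open>l\<close>.\<close>

lemma picard_weight:
  fixes q :: "real \<Rightarrow> complex"
  assumes q: "L1 q" and R: "norm l \<le> R"
  defines "g \<equiv> \<lambda>x. 1 + norm (q x) + R"
  shows "g integrable_on {0..1}" "\<And>x. 1 \<le> g x" "\<And>x. norm (q x - l) \<le> g x"
    "\<And>x. x \<in> {0..1} \<Longrightarrow> 0 \<le> integral {0..x} g"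
    "\<And>x. x \<in> {0..1} \<Longrightarrow> integral {0..x} g \<le> integral {0..1} g"
proof -
  have R0: "0 \<le> R" using R norm_ge_zero order_trans by blast
  show i: "g integrable_on {0..1}"
    unfolding g_def using q by (intro integrable_add) (auto simp: absolutely_integrable_on_def)
  show g1: "1 \<le> g x" for x using R0 by (simp add: g_def)
  show "norm (q x - l) \<le> g x" for x
    using norm_triangle_ineq4[of "q x" l] R by (simp add: g_def)
  have g0: "0 \<le> g x" for x using g1[of x] by linarith
  show "0 \<le> integral {0..x} g" if "x \<in> {0..1}" for x
    by (rule integral_nonneg[OF integrable_subinterval_real[OF i]]) (use that g0 in auto)
  show "integral {0..x} g \<le> integral {0..1} g" if "x \<in> {0..1}" for x
    by (rule integral_subset_le[OF _ integrable_subinterval_real[OF i] i]) (use that g0 in auto)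
qed

text \<open>A solution with zero initial data reproduces itself under a Picard step, so it is
  bounded by \<open>K * integral {0..x} g ^ n / fact n\<close> for every \<open>n\<close>.\<close>

lemma sol_zero:
  assumes q: "L1 q" and s: "edge_sol q l y z" "y 0 = 0" "z 0 = 0" and x: "x \<in> {0..1}"
  shows "y x = 0 \<and> z x = 0"
proof -
  define g where "g = (\<lambda>x. 1 + norm (q x) + norm l)"
  note g = picard_weight[OF q order_refl[of "norm l"], folded g_def, folded fun_cong[OF g_def]]
  have "continuous_on {0..1} (\<lambda>x. norm (y x) + norm (z x))"
    using edge_solD[OF s(1)] by (intro continuous_intros)
  then have "bounded ((\<lambda>x. norm (y x) + norm (z x)) ` {0..1})"
    using compact_continuous_image compact_imp_bounded compact_Icc by blast
  then obtain K where "\<forall>w\<in>(\<lambda>x. norm (y x) + norm (z x)) ` {0..1}. norm w \<le> K"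
    unfolding bounded_iff by blast
  then have K: "norm (y t) + norm (z t) \<le> K" if "t \<in> {0..1}" for t using that by force
  have b: "norm (y t) + norm (z t) \<le> K * integral {0..t} g ^ n / fact n" if "t \<in> {0..1}" for n t
    using that
  proof (induction n arbitrary: t)
    case 0
    then show ?case using K by simp
  next
    case (Suc n)
    show ?case
      by (rule picard_step_bound[OF g(1,2,3) edge_solD(1)[OF s(1)] s(2) edge_solD(2)[OF s(1)] s(3) Suc.IH Suc.prems])
  qed
  have "(\<lambda>n. K * (integral {0..x} g ^ n / fact n)) \<longlonglongrightarrow> K * 0"
    by (intro tendsto_mult tendsto_const summable_LIMSEQ_zero summable_power_fact)
  then have "norm (y x) + norm (z x) \<le> 0"
    using b[OF x] by (intro LIMSEQ_le_const[of "\<lambda>n. K * (integral {0..x} g ^ n / fact n)"]) auto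
  then have "norm (y x) = 0" "norm (z x) = 0"
    using norm_ge_zero[of "y x"] norm_ge_zero[of "z x"] by linarith+
  then show ?thesis by simp
qed

lemma sol_unique:
  assumes q: "L1 q" and s: "edge_sol q l y z" "edge_sol q l u v"
    and i: "y 0 = u 0" "z 0 = v 0" and x: "x \<in> {0..1}"
  shows "y x = u x \<and> z x = v x"
  using sol_zero[OF q sol_lincomb[OF s, of 1 "-1"], of x] i x by simp

lemma sol_cong_AE:
  assumes N: "negligible N" "\<And>x. x \<in> {0..1} - N \<Longrightarrow> q x = q' x" and s: "edge_sol q l y z"
    and q': "L1 q'"
  shows "edge_sol q' l y z"
proof -
  have "(\<lambda>x. (q' x - l) * y x) absolutely_integrable_on {0..1}"
    using edge_solD[OF s] q' by (intro abs_int_mult_continuous set_integral_diff) auto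
  moreover have "((\<lambda>x. (q' x - l) * y x) has_integral z x - z 0) {0..x}" if x: "x \<in> {0..1}" for x
    by (rule has_integral_spike[OF N(1) _ primD(3)[OF edge_solD(2)[OF s] x]]) (use N(2) x in auto)
  ultimately show ?thesis using s by (auto simp: edge_sol_def prim_def)
qed

section \<open>The Picard series\<close>

primrec picard :: "(real \<Rightarrow> complex) \<Rightarrow> complex \<Rightarrow> complex \<Rightarrow> complex \<Rightarrow> nat \<Rightarrow> (real \<Rightarrow> complex) \<times> (real \<Rightarrow> complex)" where
  "picard q A B l 0 = ((\<lambda>x. A), (\<lambda>x. B))"
| "picard q A B l (Suc n) = ((\<lambda>x. integral {0..x} (snd (picard q A B l n))),
     (\<lambda>x. integral {0..x} (\<lambda>t. (q t - l) * fst (picard q A B l n) t)))"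

text \<open>\<open>picard\<close> yields the terms of the series, not its partial sums, so the
  solution with initial values \<open>A\<close> and \<open>B\<close> is the sum over all
  \<open>n\<close>.\<close>

definition ivp_val where "ivp_val q A B l x = (\<Sum>n. fst (picard q A B l n) x)"
definition ivp_der where "ivp_der q A B l x = (\<Sum>n. snd (picard q A B l n) x)"

lemma picard_prim_aux:
  assumes q: "L1 q"
    and c: "continuous_on {0..1} (fst (picard q A B l n))" "continuous_on {0..1} (snd (picard q A B l n))"
  shows "prim (fst (picard q A B l (Suc n))) (snd (picard q A B l n))"
    "prim (snd (picard q A B l (Suc n))) (\<lambda>t. (q t - l) * fst (picard q A B l n) t)"
proof -
  have "(\<lambda>t. (q t - l) * fst (picard q A B l n) t) absolutely_integrable_on {0..1}"
    using c q by (intro abs_int_mult_continuous set_integral_diff) auto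
  then show "prim (fst (picard q A B l (Suc n))) (snd (picard q A B l n))"
    "prim (snd (picard q A B l (Suc n))) (\<lambda>t. (q t - l) * fst (picard q A B l n) t)"
    using prim_integral[OF absolutely_integrable_continuous_real[OF c(2)], of 0] prim_integral[of _ 0] by auto
qed

lemma picard_continuous:
  assumes q: "L1 q"
  shows "continuous_on {0..1} (fst (picard q A B l n)) \<and> continuous_on {0..1} (snd (picard q A B l n))"
proof (induction n)
  case (Suc n)
  then show ?case using picard_prim_aux[OF q, THEN prim_continuous] by blast
qed simp

lemmas picard_prim = picard_prim_aux[OF _ picard_continuous[THEN conjunct1] picard_continuous[THEN conjunct2]]

lemma picard_bound:
  assumes q: "L1 q" and R: "norm l \<le> R" and x: "x \<in> {0..1}"
  defines "c \<equiv> integral {0..1} (\<lambda>x. 1 + norm (q x) + R)"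
  shows "norm (fst (picard q A B l n) x) + norm (snd (picard q A B l n) x) \<le> (norm A + norm B) * (c ^ n / fact n)"
proof -
  define g where "g = (\<lambda>x. 1 + norm (q x) + R)"
  note g = picard_weight[OF q R, folded g_def, folded fun_cong[OF g_def]]
  have "norm (fst (picard q A B l n) t) + norm (snd (picard q A B l n) t) \<le> (norm A + norm B) * integral {0..t} g ^ n / fact n"
    if "t \<in> {0..1}" for t
    using that
  proof (induction n arbitrary: t)
    case (Suc n)
    show ?case
      by (rule picard_step_bound[OF g(1,2,3) picard_prim(1)[OF q q q, of A B l n] _ picard_prim(2)[OF q q q, of A B l n] _ Suc.IH Suc.prems]) auto
  qed simp
  from this[OF x] have "norm (fst (picard q A B l n) x) + norm (snd (picard q A B l n) x)
      \<le> (norm A + norm B) * (integral {0..x} g ^ n / fact n)" by simp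
  also have "\<dots> \<le> (norm A + norm B) * (c ^ n / fact n)"
    unfolding c_def g_def[symmetric] using g(4,5)[OF x]
    by (intro mult_left_mono divide_right_mono power_mono) auto
  finally show ?thesis .
qed

lemma picard_summable:
  assumes q: "L1 q" and x: "x \<in> {0..1}"
  shows "summable (\<lambda>n. fst (picard q A B l n) x)" "summable (\<lambda>n. snd (picard q A B l n) x)"
proof -
  define c where "c = integral {0..1} (\<lambda>x. 1 + norm (q x) + norm l)"
  have s: "summable (\<lambda>n. (norm A + norm B) * (c ^ n / fact n))"
    by (intro summable_mult summable_power_fact)
  note b = picard_bound[OF q order_refl[of "norm l"] x, of A B, folded c_def]
  show "summable (\<lambda>n. fst (picard q A B l n) x)" "summable (\<lambda>n. snd (picard q A B l n) x)"
    by (rule summable_comparison_test'[OF s, of 0]; use b norm_ge_zero order_trans in \<open>smt (verit)\<close>)+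
qed

text \<open>Dominated convergence with majorant \<open>norm (k t) * suminf b\<close>. The case
  \<open>k = 1\<close> serves \<open>y' = z\<close> and \<open>k = q - l\<close> serves the equation
  for \<open>z\<close>.\<close>

lemma prim_series:
  fixes u w :: "nat \<Rightarrow> real \<Rightarrow> complex"
  assumes p: "\<And>n. prim (u (Suc n)) (\<lambda>t. k t * w n t)" "\<And>n. u (Suc n) 0 = 0" "\<And>t. u 0 t = A"
    and k: "L1 k"
    and b: "\<And>n t. t \<in> {0..1} \<Longrightarrow> norm (w n t) \<le> b n" "summable b"
    and s: "\<And>t. t \<in> {0..1} \<Longrightarrow> summable (\<lambda>n. u n t)"
  shows "prim (\<lambda>t. \<Sum>n. u n t) (\<lambda>t. k t * (\<Sum>n. w n t))" "(\<Sum>n. u n 0) = A"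
proof -
  have b0: "0 \<le> b n" for n by (rule order_trans[OF norm_ge_zero b(1)[of 0]]) simp
  have ws: "summable (\<lambda>n. w n t)" if "t \<in> {0..1}" for t
    by (rule summable_comparison_test'[OF b(2), of 0]) (use b(1) that in auto)
  have kn: "(\<lambda>t. norm (k t) * suminf b) integrable_on {0..1}"
    using k by (intro integrable_on_mult_left) (auto simp: absolutely_integrable_on_def)
  have bd: "norm (k t * (\<Sum>n<m. w n t)) \<le> norm (k t) * suminf b" if "t \<in> {0..1}" for t m
  proof -
    have "norm (\<Sum>n<m. w n t) \<le> (\<Sum>n<m. b n)" using b(1) that by (intro sum_norm_le) auto
    also have "\<dots> \<le> suminf b" using b(2) b0 by (intro sum_le_suminf) auto
    finally show ?thesis by (simp add: norm_mult mult_left_mono)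
  qed
  have cv: "(\<lambda>m. k t * (\<Sum>n<m. w n t)) \<longlonglongrightarrow> k t * (\<Sum>n. w n t)" if "t \<in> {0..1}" for t
    by (intro tendsto_mult tendsto_const summable_LIMSEQ ws that)
  have pi: "((\<lambda>t. k t * (\<Sum>n<m. w n t)) has_integral (\<Sum>n<m. u (Suc n) x)) {0..x}" if x: "x \<in> {0..1}" for m x
  proof -
    have "((\<lambda>t. \<Sum>n<m. k t * w n t) has_integral (\<Sum>n<m. u (Suc n) x)) {0..x}"
      using primD(3)[OF p(1) x] p(2) by (intro has_integral_sum) auto
    then show ?thesis by (simp add: sum_distrib_left)
  qed
  show init: "(\<Sum>n. u n 0) = A"
    using suminf_split_head[OF s[of 0]] p(2,3) by simp
  have main: "(\<lambda>t. k t * (\<Sum>n. w n t)) integrable_on {0..x}"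
    "integral {0..x} (\<lambda>t. k t * (\<Sum>n. w n t)) = (\<Sum>n. u n x) - A" if x: "x \<in> {0..1}" for x
  proof -
    have sub: "{0..x} \<subseteq> {0..1}" using x by auto
    have kx: "(\<lambda>t. norm (k t) * suminf b) integrable_on {0..x}"
      by (rule integrable_subinterval_real[OF kn sub])
    have pix: "(\<lambda>t. k t * (\<Sum>n<m. w n t)) integrable_on {0..x}" for m using pi[OF x] by blast
    have D: "(\<lambda>t. k t * (\<Sum>n. w n t)) integrable_on {0..x}"
      "(\<lambda>m. integral {0..x} (\<lambda>t. k t * (\<Sum>n<m. w n t))) \<longlonglongrightarrow> integral {0..x} (\<lambda>t. k t * (\<Sum>n. w n t))"
    proof -
      have 1: "norm (k t * (\<Sum>n<m. w n t)) \<le> norm (k t) * suminf b" if "t \<in> {0..x}" for t m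
        using bd that sub by blast
      have 2: "(\<lambda>m. k t * (\<Sum>n<m. w n t)) \<longlonglongrightarrow> k t * (\<Sum>n. w n t)" if "t \<in> {0..x}" for t
        using cv that sub by blast
      show "(\<lambda>t. k t * (\<Sum>n. w n t)) integrable_on {0..x}"
        by (rule dominated_convergence(1)[OF pix kx 1 2])
      show "(\<lambda>m. integral {0..x} (\<lambda>t. k t * (\<Sum>n<m. w n t))) \<longlonglongrightarrow> integral {0..x} (\<lambda>t. k t * (\<Sum>n. w n t))"
        by (rule dominated_convergence(2)[OF pix kx 1 2])
    qed
    show "(\<lambda>t. k t * (\<Sum>n. w n t)) integrable_on {0..x}" by fact
    have l1: "(\<lambda>m. \<Sum>n<m. u (Suc n) x) \<longlonglongrightarrow> integral {0..x} (\<lambda>t. k t * (\<Sum>n. w n t))"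
      using D(2) integral_unique[OF pi[OF x]] by simp
    have l2: "(\<lambda>m. \<Sum>n<m. u (Suc n) x) \<longlonglongrightarrow> (\<Sum>n. u (Suc n) x)"
      using s[OF x] summable_Suc_iff[of "\<lambda>n. u n x"] by (intro summable_LIMSEQ) blast
    have "(\<Sum>n. u (Suc n) x) = (\<Sum>n. u n x) - A"
      using suminf_split_head[OF s[OF x]] p(3) by simp
    with LIMSEQ_unique[OF l1 l2]
    show "integral {0..x} (\<lambda>t. k t * (\<Sum>n. w n t)) = (\<Sum>n. u n x) - A" by simp
  qed
  show "prim (\<lambda>t. \<Sum>n. u n t) (\<lambda>t. k t * (\<Sum>n. w n t))"
    unfolding prim_def
  proof (intro conjI ballI)
    show "(\<lambda>t. k t * (\<Sum>n. w n t)) absolutely_integrable_on {0..1}"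
    proof (rule absolutely_integrable_integrable_bound[OF _ main(1) kn])
      fix t :: real assume t: "t \<in> {0..1}"
      show "norm (k t * (\<Sum>n. w n t)) \<le> norm (k t) * suminf b"
        by (rule LIMSEQ_le_const2[OF tendsto_norm[OF cv[OF t]]]) (use bd[OF t] in auto)
    qed simp
    fix x :: real assume x: "x \<in> {0..1}"
    show "((\<lambda>t. k t * (\<Sum>n. w n t)) has_integral (\<Sum>n. u n x) - (\<Sum>n. u n 0)) {0..x}"
      unfolding init using integrable_integral[OF main(1)[OF x]] main(2)[OF x] by simp
  qed
qed

lemma sol_exists:
  assumes q: "L1 q"
  shows "edge_sol q l (ivp_val q A B l) (ivp_der q A B l)" "ivp_val q A B l 0 = A" "ivp_der q A B l 0 = B"
proof -
  define c where "c = integral {0..1} (\<lambda>x. 1 + norm (q x) + norm l)"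
  define b where "b = (\<lambda>n. (norm A + norm B) * (c ^ n / fact n))"
  have sb: "summable b"
    unfolding b_def by (intro summable_mult summable_power_fact)
  have bd: "norm (fst (picard q A B l n) t) \<le> b n" "norm (snd (picard q A B l n) t) \<le> b n" if "t \<in> {0..1}" for n t
    using picard_bound[OF q order_refl[of "norm l"] that, of A B n, folded c_def]
      norm_ge_zero[of "fst (picard q A B l n) t"] norm_ge_zero[of "snd (picard q A B l n) t"]
    unfolding b_def by linarith+
  have Y: "prim (\<lambda>t. \<Sum>n. fst (picard q A B l n) t) (\<lambda>t. 1 * (\<Sum>n. snd (picard q A B l n) t))"
    "(\<Sum>n. fst (picard q A B l n) 0) = A"
    by (rule prim_series[where b = b and A = A and k = "\<lambda>_. 1"];
        use picard_prim(1)[OF q q q] bd sb picard_summable[OF q] in simp)+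
  have Z: "prim (\<lambda>t. \<Sum>n. snd (picard q A B l n) t) (\<lambda>t. (q t - l) * (\<Sum>n. fst (picard q A B l n) t))"
    "(\<Sum>n. snd (picard q A B l n) 0) = B"
    by (rule prim_series[where b = b and A = B and k = "\<lambda>t. q t - l"];
        use picard_prim(2)[OF q q q] bd sb picard_summable[OF q] q in \<open>simp add: set_integral_diff\<close>)+
  show "edge_sol q l (ivp_val q A B l) (ivp_der q A B l)" "ivp_val q A B l 0 = A" "ivp_der q A B l 0 = B"
    using Y Z unfolding edge_sol_def ivp_val_def[abs_def] ivp_der_def[abs_def] by simp_all
qed

section \<open>Entire dependence on the spectral parameter\<close>

definition polyparam :: "(complex \<Rightarrow> real \<Rightarrow> complex) \<Rightarrow> bool" where
  "polyparam f \<longleftrightarrow> (\<exists>n b. (\<forall>i. continuous_on {0..1} (b i)) \<and>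
     (\<forall>l. \<forall>x\<in>{0..1}. f l x = (\<Sum>i<n. l ^ i * b i x)))"

lemma polyparam_integral:
  fixes w :: "real \<Rightarrow> complex"
  assumes f: "polyparam f" and w: "L1 w"
  shows "polyparam (\<lambda>l x. integral {0..x} (\<lambda>t. w t * f l t))"
proof -
  obtain n :: nat and b where b: "\<And>i. continuous_on {0..1} (b i)"
    "\<And>l x. x \<in> {0..1} \<Longrightarrow> f l x = (\<Sum>i<n. l ^ i * b i x)"
    using f unfolding polyparam_def by blast
  have p: "prim (\<lambda>x. 0 + integral {0..x} (\<lambda>t. w t * b i t)) (\<lambda>t. w t * b i t)" for i
    by (intro prim_integral abs_int_mult_continuous w b)
  have "integral {0..x} (\<lambda>t. w t * f l t) = (\<Sum>i<n. l ^ i * integral {0..x} (\<lambda>t. w t * b i t))"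
    if x: "x \<in> {0..1}" for l x
  proof (rule integral_unique)
    have "((\<lambda>t. \<Sum>i<n. l ^ i * (w t * b i t)) has_integral (\<Sum>i<n. l ^ i * integral {0..x} (\<lambda>t. w t * b i t))) {0..x}"
      using primD(3)[OF p x] by (intro has_integral_sum has_integral_mult_right) auto
    then show "((\<lambda>t. w t * f l t) has_integral (\<Sum>i<n. l ^ i * integral {0..x} (\<lambda>t. w t * b i t))) {0..x}"
      by (rule has_integral_eq[rotated]) (use x b(2) in \<open>auto simp: sum_distrib_left mult_ac\<close>)
  qed
  then show ?thesis
    unfolding polyparam_def using prim_continuous[OF p]
    by (intro exI[of _ n] exI[of _ "\<lambda>i x. integral {0..x} (\<lambda>t. w t * b i t)"]) simp
qed

lemma polyparam_lam_mult:
  assumes "polyparam f"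
  shows "polyparam (\<lambda>l x. l * f l x)"
proof -
  obtain n :: nat and b where b: "\<And>i. continuous_on {0..1} (b i)"
    "\<And>l x. x \<in> {0..1} \<Longrightarrow> f l x = (\<Sum>i<n. l ^ i * b i x)"
    using assms unfolding polyparam_def by blast
  define b' where "b' = (\<lambda>i. case i of 0 \<Rightarrow> (\<lambda>x. 0) | Suc j \<Rightarrow> b j)"
  have "continuous_on {0..1} (b' i)" for i using b(1) by (auto simp: b'_def split: nat.split)
  moreover have "l * f l x = (\<Sum>i<Suc n. l ^ i * b' i x)" if "x \<in> {0..1}" for l x
    unfolding sum.lessThan_Suc_shift b(2)[OF that] by (simp add: b'_def sum_distrib_left mult_ac)
  ultimately show ?thesis unfolding polyparam_def by blast
qed

lemma polyparam_diff:
  assumes "polyparam f" "polyparam g"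
  shows "polyparam (\<lambda>l x. f l x - g l x)"
proof -
  obtain n :: nat and b where b: "\<And>i. continuous_on {0..1} (b i)"
    "\<And>l x. x \<in> {0..1} \<Longrightarrow> f l x = (\<Sum>i<n. l ^ i * b i x)"
    using assms(1) unfolding polyparam_def by blast
  obtain m :: nat and d where d: "\<And>i. continuous_on {0..1} (d i)"
    "\<And>l x. x \<in> {0..1} \<Longrightarrow> g l x = (\<Sum>i<m. l ^ i * d i x)"
    using assms(2) unfolding polyparam_def by blast
  define e where "e = (\<lambda>i x. (if i < n then b i x else 0) - (if i < m then d i x else 0))"
  have "continuous_on {0..1} (e i)" for i
    unfolding e_def using b(1) d(1) by (cases "i < n"; cases "i < m"; auto intro!: continuous_intros)
  moreover have "f l x - g l x = (\<Sum>i<max n m. l ^ i * e i x)" if x: "x \<in> {0..1}" for l x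
  proof -
    have "(\<Sum>i<n. l ^ i * b i x) = (\<Sum>i<max n m. l ^ i * (if i < n then b i x else 0))"
      by (rule sum.mono_neutral_cong_left) auto
    moreover have "(\<Sum>i<m. l ^ i * d i x) = (\<Sum>i<max n m. l ^ i * (if i < m then d i x else 0))"
      by (rule sum.mono_neutral_cong_left) auto
    ultimately show ?thesis
      by (simp only: b(2)[OF x] d(2)[OF x] e_def right_diff_distrib sum_subtractf)
  qed
  ultimately show ?thesis unfolding polyparam_def by blast
qed

lemma polyparam_cong:
  "polyparam f \<Longrightarrow> (\<And>l x. x \<in> {0..1} \<Longrightarrow> f l x = g l x) \<Longrightarrow> polyparam g"
  unfolding polyparam_def by auto

lemma picard_polyparam:
  assumes q: "L1 q"
  shows "polyparam (\<lambda>l. fst (picard q A B l n)) \<and> polyparam (\<lambda>l. snd (picard q A B l n))"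
proof (induction n)
  case 0
  have "polyparam (\<lambda>l x. c)" for c
    unfolding polyparam_def by (intro exI[of _ 1] exI[of _ "\<lambda>i x. c"]) auto
  then show ?case by simp
next
  case (Suc n)
  have "polyparam (\<lambda>l x. integral {0..x} (\<lambda>t. 1 * snd (picard q A B l n) t))"
    by (rule polyparam_integral) (use Suc in auto)
  moreover have "polyparam (\<lambda>l x. integral {0..x} (\<lambda>t. q t * fst (picard q A B l n) t) -
      l * integral {0..x} (\<lambda>t. 1 * fst (picard q A B l n) t))"
    by (intro polyparam_diff polyparam_lam_mult polyparam_integral q) (use Suc in auto)
  then have "polyparam (\<lambda>l x. integral {0..x} (\<lambda>t. (q t - l) * fst (picard q A B l n) t))"
  proof (rule polyparam_cong)
    fix l :: complex and x :: real assume x: "x \<in> {0..1}"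
    let ?f = "fst (picard q A B l n)"
    have c: "continuous_on {0..1} ?f" using picard_continuous[OF q] by blast
    have "prim (\<lambda>x. 0 + integral {0..x} (\<lambda>t. q t * ?f t)) (\<lambda>t. q t * ?f t)"
      "prim (\<lambda>x. 0 + integral {0..x} (\<lambda>t. 1 * ?f t)) (\<lambda>t. 1 * ?f t)"
      by (intro prim_integral abs_int_mult_continuous q c; simp)+
    from has_integral_diff[OF primD(3)[OF this(1) x] has_integral_mult_right[OF primD(3)[OF this(2) x], of l]]
    show "integral {0..x} (\<lambda>t. q t * ?f t) - l * integral {0..x} (\<lambda>t. 1 * ?f t) = integral {0..x} (\<lambda>t. (q t - l) * ?f t)"
      by (simp add: left_diff_distrib has_integral_iff)
  qed
  ultimately show ?case by simp
qed

text \<open>Each Picard term is a polynomial in \<open>l\<close> with continuous coefficients, which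
  integration in \<open>x\<close> preserves. The Weierstrass test on discs then gives a locally
  uniform limit of polynomials.\<close>

lemma sol_entire:
  assumes q: "L1 q" and x: "x \<in> {0..1}"
  shows "(\<lambda>l. ivp_val q A B l x) holomorphic_on UNIV" "(\<lambda>l. ivp_der q A B l x) holomorphic_on UNIV"
proof -
  have *: "(\<lambda>l. \<Sum>n. f l n) holomorphic_on UNIV"
    if f: "\<And>n. polyparam (\<lambda>l x. F l n x)" "\<And>l n. f l n = F l n x"
      and b: "\<And>l R n. norm l \<le> R \<Longrightarrow> norm (f l n) \<le> b R n" "\<And>R. summable (b R)"
    for f :: "complex \<Rightarrow> nat \<Rightarrow> complex" and F and b :: "real \<Rightarrow> nat \<Rightarrow> real"
  proof (rule holomorphic_uniform_sequence[OF open_UNIV])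
    show "(\<lambda>l. \<Sum>n<m. f l n) holomorphic_on UNIV" for m
    proof (intro holomorphic_intros)
      fix n
      obtain k :: nat and c where "\<And>l. f l n = (\<Sum>i<k. l ^ i * c i x)"
        using f x unfolding polyparam_def by metis
      then show "(\<lambda>l. f l n) holomorphic_on UNIV" by (auto intro!: holomorphic_intros)
    qed
    fix z :: complex
    have "uniform_limit (cball z 1) (\<lambda>m l. \<Sum>n<m. f l n) (\<lambda>l. \<Sum>n. f l n) sequentially"
    proof (rule Weierstrass_m_test[OF b(1) b(2)])
      fix n l assume "l \<in> cball z 1"
      then show "norm l \<le> norm z + 1"
        using norm_triangle_ineq2[of l z] by (simp add: dist_norm norm_minus_commute)
    qed
    then show "\<exists>d>0. cball z d \<subseteq> UNIV \<and> uniform_limit (cball z d) (\<lambda>m l. \<Sum>n<m. f l n) (\<lambda>l. \<Sum>n. f l n) sequentially"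
      by (intro exI[of _ 1]) auto
  qed
  define b where "b = (\<lambda>R n. (norm A + norm B) * (integral {0..1} (\<lambda>x. 1 + norm (q x) + R) ^ n / fact n))"
  have sb: "summable (b R)" for R
    unfolding b_def by (intro summable_mult summable_power_fact)
  have bd: "norm (fst (picard q A B l n) x) \<le> b R n" "norm (snd (picard q A B l n) x) \<le> b R n" if "norm l \<le> R" for n l R
    using picard_bound[OF q that x, of A B n]
      norm_ge_zero[of "fst (picard q A B l n) x"] norm_ge_zero[of "snd (picard q A B l n) x"]
    unfolding b_def by linarith+
  show "(\<lambda>l. ivp_val q A B l x) holomorphic_on UNIV"
    unfolding ivp_val_def
    by (rule *[where F = "\<lambda>l n. fst (picard q A B l n)" and b = b]) (use picard_polyparam[OF q] bd sb in auto)
  show "(\<lambda>l. ivp_der q A B l x) holomorphic_on UNIV"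
    unfolding ivp_der_def
    by (rule *[where F = "\<lambda>l n. snd (picard q A B l n)" and b = b]) (use picard_polyparam[OF q] bd sb in auto)
qed

section \<open>Reflection of an edge and exponential bounds\<close>

lemma has_integral_reflect01:
  fixes f :: "real \<Rightarrow> 'a::real_normed_vector"
  assumes "(f has_integral I) {a..b}"
  shows "((\<lambda>x. f (1 - x)) has_integral I) {1 - b..1 - a}"
proof -
  have "((\<lambda>x. f ((-1) *\<^sub>R x + 1)) has_integral I) ((\<lambda>x. (-1) *\<^sub>R x + 1) ` {a..b})"
    using has_integral_affinity[of f I a b "-1" 1] assms by simp
  moreover have "(\<lambda>x. (-1) *\<^sub>R x + 1) ` {a..b} = {1 - b..1 - a}"
  proof -
    have "x \<in> (\<lambda>x. (-1) *\<^sub>R x + 1) ` {a..b}" if "x \<in> {1 - b..1 - a}" for x :: real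
      using that by (intro image_eqI[of _ _ "1 - x"]) auto
    then show ?thesis by auto
  qed
  ultimately show ?thesis by simp
qed

lemma abs_int_reflect01:
  fixes f :: "real \<Rightarrow> complex"
  assumes "L1 f"
  shows "(\<lambda>x. f (1 - x)) absolutely_integrable_on {0..1}"
    "integral {0..1} (\<lambda>x. norm (f (1 - x))) = integral {0..1} (\<lambda>x. norm (f x))"
proof -
  have "(f has_integral integral {0..1} f) {0..1}" "((\<lambda>x. norm (f x)) has_integral integral {0..1} (\<lambda>x. norm (f x))) {0..1}"
    using assms by (auto simp: absolutely_integrable_on_def)
  note r = this[THEN has_integral_reflect01]
  show "(\<lambda>x. f (1 - x)) absolutely_integrable_on {0..1}"
    unfolding absolutely_integrable_on_def using r by auto
  show "integral {0..1} (\<lambda>x. norm (f (1 - x))) = integral {0..1} (\<lambda>x. norm (f x))"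
    using r(2) by (simp add: integral_unique)
qed

lemma prim_reflect:
  assumes p: "prim F f"
  shows "prim (\<lambda>x. F (1 - x)) (\<lambda>x. - f (1 - x))"
  unfolding prim_def
proof (intro conjI ballI)
  show "(\<lambda>x. - f (1 - x)) absolutely_integrable_on {0..1}"
    using abs_int_reflect01(1)[OF primD(1)[OF p]]
    by (simp add: absolutely_integrable_on_def integrable_neg_iff)
  fix x :: real assume x: "x \<in> {0..1}"
  have "(f has_integral F 1 - F (1 - x)) {1 - x..1}"
    by (rule prim_diff_integral[OF p]) (use x in auto)
  from has_integral_neg[OF has_integral_reflect01[OF this]]
  show "((\<lambda>x. - f (1 - x)) has_integral F (1 - x) - F (1 - 0)) {0..x}" by simp
qed

text \<open>Lets bounds that propagate from \<open>x = 0\<close> be started at \<open>x = 1\<close>;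
  the derivative changes sign.\<close>

lemma sol_reflect:
  assumes s: "edge_sol q l y z"
  shows "edge_sol (\<lambda>x. q (1 - x)) l (\<lambda>x. y (1 - x)) (\<lambda>x. - z (1 - x))"
  unfolding edge_sol_def
proof
  show "prim (\<lambda>x. y (1 - x)) (\<lambda>x. - z (1 - x))" by (rule prim_reflect[OF edge_solD(1)[OF s]])
  show "prim (\<lambda>x. - z (1 - x)) (\<lambda>x. (q (1 - x) - l) * y (1 - x))"
    by (rule prim_cong[OF prim_cmult[OF prim_reflect[OF edge_solD(2)[OF s]], of "-1"]]) auto
qed

lemma prim_exp: "prim (\<lambda>x. exp (c * of_real x)) (\<lambda>x. c * exp (c * of_real x))"
proof (rule prim_C1)
  show "continuous_on {0..1} (\<lambda>x. c * exp (c * complex_of_real x))" by (intro continuous_intros)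
  fix x :: real
  have "((\<lambda>w. exp (c * w)) has_field_derivative exp (c * of_real x) * c) (at (of_real x))"
    by (auto intro!: derivative_eq_intros)
  from has_vector_derivative_real_field[OF this]
  show "((\<lambda>x. exp (c * complex_of_real x)) has_vector_derivative c * exp (c * of_real x)) (at x within {0..1})"
    by (simp add: o_def mult.commute)
qed

text \<open>Since \<open>y'' = (q + r^2) y\<close>, one has
  \<open>(z + r y)' = r (z + r y) + q y\<close>, and the integrating factor leaves only
  \<open>q y\<close>. Replacing \<open>r\<close> by \<open>-r\<close> gives the other
  component.\<close>

lemma sol_exp_components:
  assumes s: "edge_sol q (-(r^2)) y z"
  shows "prim (\<lambda>x. exp (- r * of_real x) * (z x + r * y x)) (\<lambda>x. exp (- r * of_real x) * (q x * y x))"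
proof -
  have "prim (\<lambda>x. z x + r * y x) (\<lambda>x. (q x - (-(r^2))) * y x + r * z x)"
    by (intro prim_add prim_cmult edge_solD[OF s])
  from prim_mult[OF prim_exp[of "-r"] this]
  show ?thesis by (rule prim_cong) (auto simp: algebra_simps power2_eq_square)
qed

text \<open>The components \<open>z \<plusminus> r y\<close> satisfy first-order equations; \<open>2 * Q \<le> norm r\<close> allows absorbing the
  integral term into the supremum of \<open>exp (- Re r x) * norm (y x)\<close>.\<close>

lemma sol_bounds:
  assumes q: "L1 q" and s: "edge_sol q (-(r^2)) y z"
    and r: "r \<noteq> 0" "Re r \<ge> 0" and Q: "integral {0..1} (\<lambda>x. norm (q x)) \<le> Q" "2 * Q \<le> norm r"
    and A: "norm (z 0 + r * y 0) + norm (z 0 - r * y 0) \<le> 2 * norm r * A"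
    and x: "x \<in> {0..1}"
  shows "norm (y x) \<le> 2 * A * exp (Re r * x)"
    and "norm (exp (- r * of_real x) * (z x + r * y x) - (z 0 + r * y 0)) \<le> 2 * A * Q"
    and "norm (exp (- r * of_real x) * (z x - r * y x) - exp (- 2 * r * of_real x) * (z 0 - r * y 0)) \<le> 2 * A * Q"
proof -
  define k where "k = Re r"
  have k0: "k \<ge> 0" using r by (simp add: k_def)
  have nr: "norm r > 0" using r by simp
  define f where "f = (\<lambda>x. exp (- (k * x)) * norm (y x))"
  have ne: "norm (exp (r * of_real x)) = exp (k * x)" "norm (exp (- r * of_real x)) = exp (- (k * x))"
    "norm (exp (- 2 * r * of_real x)) = exp (- 2 * (k * x))" for x
    by (simp_all add: k_def norm_exp_eq_Re)
  have "continuous_on {0..1} f"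
    unfolding f_def using edge_solD(3)[OF s] by (intro continuous_intros)
  then obtain m where m: "m \<in> {0..1}" "\<And>x. x \<in> {0..1} \<Longrightarrow> f x \<le> f m"
    using continuous_attains_sup[of "{0..1}" f] by auto
  define S where "S = f m"
  have S0: "S \<ge> 0" by (simp add: S_def f_def)
  have qi: "(\<lambda>t. norm (q t)) integrable_on {0..1}" using q by (simp add: absolutely_integrable_on_def)
  have Qx: "((\<lambda>t. norm (q t)) integrable_on {0..x})" "integral {0..x} (\<lambda>t. norm (q t)) \<le> Q" if x: "x \<in> {0..1}" for x
  proof -
    show *: "((\<lambda>t. norm (q t)) integrable_on {0..x})" by (rule integrable_subinterval_real[OF qi]) (use x in auto)
    show "integral {0..x} (\<lambda>t. norm (q t)) \<le> Q"
      by (rule order_trans[OF integral_subset_le[OF _ * qi] Q(1)]) (use x in auto)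
  qed
  have Q0: "0 \<le> Q" by (rule order_trans[OF _ Q(1)]) (intro integral_nonneg qi, simp)
  have p1: "prim (\<lambda>x. exp (- r * of_real x) * (z x + r * y x)) (\<lambda>x. exp (- r * of_real x) * (q x * y x))"
    by (rule sol_exp_components[OF s])
  have p2: "prim (\<lambda>x. exp (r * of_real x) * (z x - r * y x)) (\<lambda>x. exp (r * of_real x) * (q x * y x))"
    using sol_exp_components[of q "-r" y z] s by simp
  have d1: "norm (exp (- r * of_real x) * (z x + r * y x) - (z 0 + r * y 0)) \<le> S * Q" if x: "x \<in> {0..1}" for x
  proof -
    have "norm (exp (- r * of_real x) * (z x + r * y x) - exp (- r * of_real 0) * (z 0 + r * y 0)) \<le> integral {0..x} (\<lambda>t. S * norm (q t))"
    proof (rule prim_norm_diff_le[OF p1 x])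
      show "(\<lambda>t. S * norm (q t)) integrable_on {0..x}" by (intro integrable_on_mult_right Qx(1)[OF x])
      fix t assume "t \<in> {0..x}"
      then have t: "t \<in> {0..1}" using x by auto
      have "norm (exp (- r * of_real t) * (q t * y t)) = norm (q t) * f t"
        unfolding norm_mult ne f_def by simp
      also have "\<dots> \<le> norm (q t) * S" using m(2)[OF t] by (intro mult_left_mono) (auto simp: S_def)
      finally show "norm (exp (- r * of_real t) * (q t * y t)) \<le> S * norm (q t)" by (simp add: mult.commute)
    qed
    also have "\<dots> \<le> S * Q" using Qx(2)[OF x] S0 by (simp add: mult_left_mono)
    finally show ?thesis by simp
  qed
  have d2: "norm (exp (- r * of_real x) * (z x - r * y x) - exp (- 2 * r * of_real x) * (z 0 - r * y 0)) \<le> S * Q" if x: "x \<in> {0..1}" for x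
  proof -
    have "norm (exp (r * of_real x) * (z x - r * y x) - exp (r * of_real 0) * (z 0 - r * y 0)) \<le> integral {0..x} (\<lambda>t. (exp (2 * (k * x)) * S) * norm (q t))"
    proof (rule prim_norm_diff_le[OF p2 x])
      show "(\<lambda>t. (exp (2 * (k * x)) * S) * norm (q t)) integrable_on {0..x}" by (intro integrable_on_mult_right Qx(1)[OF x])
      fix t assume t': "t \<in> {0..x}"
      then have t: "t \<in> {0..1}" using x by auto
      have "norm (exp (r * of_real t) * (q t * y t)) = norm (q t) * (exp (2 * (k * t)) * f t)"
        unfolding norm_mult ne f_def by (simp add: mult_ac flip: exp_add)
      also have "\<dots> \<le> norm (q t) * (exp (2 * (k * x)) * S)"
        using m(2)[OF t] t' k0 by (intro mult_left_mono mult_mono) (auto simp: S_def f_def mult_left_mono)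
      finally show "norm (exp (r * of_real t) * (q t * y t)) \<le> (exp (2 * (k * x)) * S) * norm (q t)" by (simp add: mult.commute)
    qed
    also have "\<dots> \<le> exp (2 * (k * x)) * (S * Q)"
      using Qx(2)[OF x] S0 by (simp add: mult_left_mono mult.assoc)
    finally have *: "norm (exp (r * of_real x) * (z x - r * y x) - (z 0 - r * y 0)) \<le> exp (2 * (k * x)) * (S * Q)" by simp
    have "exp (- r * of_real x) * (z x - r * y x) - exp (- 2 * r * of_real x) * (z 0 - r * y 0)
       = exp (- 2 * r * of_real x) * (exp (r * of_real x) * (z x - r * y x) - (z 0 - r * y 0))"
      by (simp add: right_diff_distrib mult.assoc[symmetric] flip: exp_add)
    then have "norm (exp (- r * of_real x) * (z x - r * y x) - exp (- 2 * r * of_real x) * (z 0 - r * y 0))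
       = exp (- 2 * (k * x)) * norm (exp (r * of_real x) * (z x - r * y x) - (z 0 - r * y 0))"
      by (simp only: norm_mult ne)
    also have "\<dots> \<le> exp (- 2 * (k * x)) * (exp (2 * (k * x)) * (S * Q))"
      by (rule mult_left_mono[OF *]) simp
    also have "\<dots> = S * Q" by (simp add: mult.assoc[symmetric] flip: exp_add)
    finally show ?thesis .
  qed
  \<comment> \<open>At the maximising point the two components differ by \<open>2 * r * y\<close>,
    which turns the component estimates into an inequality for \<open>S\<close> itself.\<close>
  have "2 * norm r * S = norm (exp (- r * of_real m) * (z m + r * y m) - exp (- r * of_real m) * (z m - r * y m))"
  proof -
    have "exp (- r * of_real m) * (z m + r * y m) - exp (- r * of_real m) * (z m - r * y m) = exp (- r * of_real m) * (2 * r * y m)"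
      by (simp add: algebra_simps)
    then show ?thesis by (simp only: norm_mult ne) (simp add: S_def f_def)
  qed
  also have "\<dots> \<le> norm (z 0 + r * y 0) + norm (exp (- 2 * r * of_real m) * (z 0 - r * y 0)) + 2 * (S * Q)"
  proof -
    have "norm (P - M) \<le> norm P0 + norm M0 + (norm (P - P0) + norm (M - M0))" for P M P0 M0 :: complex by norm
    then show ?thesis using d1[OF m(1)] d2[OF m(1)] by (smt (verit, best))
  qed
  also have "norm (exp (- 2 * r * of_real m) * (z 0 - r * y 0)) \<le> norm (z 0 - r * y 0)"
    unfolding norm_mult ne using k0 m(1) by (intro mult_left_le_one_le) auto
  finally have "2 * norm r * S \<le> 2 * norm r * A + S * (2 * Q)" using A by simp
  also have "S * (2 * Q) \<le> S * norm r" using Q(2) S0 by (intro mult_left_mono)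
  finally have "norm r * S \<le> norm r * (2 * A)" by (simp add: algebra_simps)
  then have S2: "S \<le> 2 * A" using nr by simp
  show "norm (y x) \<le> 2 * A * exp (Re r * x)"
  proof -
    have "norm (y x) = f x * exp (k * x)" by (simp add: f_def mult_ac flip: exp_add)
    also have "\<dots> \<le> (2 * A) * exp (k * x)" using m(2)[OF x] S2 by (intro mult_right_mono) (auto simp: S_def)
    finally show ?thesis by (simp add: k_def)
  qed
  have SQ: "S * Q \<le> 2 * A * Q" using S2 Q0 by (rule mult_right_mono)
  show "norm (exp (- r * of_real x) * (z x + r * y x) - (z 0 + r * y 0)) \<le> 2 * A * Q"
    using d1[OF x] SQ by linarith
  show "norm (exp (- r * of_real x) * (z x - r * y x) - exp (- 2 * r * of_real x) * (z 0 - r * y 0)) \<le> 2 * A * Q"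
    using d2[OF x] SQ by linarith
qed

section \<open>A Phragmen-Lindelof argument\<close>

text \<open>The exponent \<open>3/4\<close> lies between the order \<open>1/2\<close> of the
  functions to be bounded and the critical order 1: arguments stay below
  \<open>3 * pi / 8 < pi / 2\<close>, so the real part is comparable to the modulus.\<close>

lemma Re_powr_three_quarters:
  assumes "Re z > 0"
  shows "cos (3 * pi / 8) * norm z powr (3/4) \<le> Re (z powr (3/4))"
proof -
  have z0: "z \<noteq> 0" using assms by auto
  have arg: "\<bar>Im (Ln z)\<bar> < pi / 2" using assms Re_Ln_pos_lt[OF z0] by simp
  have "z powr (3/4) = exp ((3/4) * Ln z)" using z0 by (simp add: powr_def)
  also have "Re \<dots> = exp ((3/4) * ln (norm z)) * cos ((3/4) * Im (Ln z))"
    using z0 by (simp add: Re_exp)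
  also have "exp ((3/4) * ln (norm z)) = norm z powr (3/4)" using z0 by (simp add: powr_def)
  finally have eq: "Re (z powr (3/4)) = norm z powr (3/4) * cos ((3/4) * Im (Ln z))" .
  have "cos (3 * pi / 8) \<le> cos \<bar>(3/4) * Im (Ln z)\<bar>"
    by (rule cos_monotone_0_pi_le) (use arg in auto)
  then have "cos (3 * pi / 8) \<le> cos ((3/4) * Im (Ln z))" by (simp only: cos_abs_real)
  then show ?thesis unfolding eq by (simp only: mult.commute mult_left_mono powr_ge_zero)
qed

text \<open>Damping by \<open>exp (- e * (z + 1) powr (3/4))\<close> beats the growth on large half
  circles; the maximum principle on half discs and \<open>e\<close> tending to 0 finish. The shift
  by 1 moves the branch point out of the closed half plane.\<close>

lemma phragmen_lindelof_half_plane: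
  assumes f: "f holomorphic_on UNIV" and M: "M > 0"
    and growth: "\<And>z. norm (f z) \<le> K * exp (B * sqrt (norm z))"
    and axis: "\<And>z. Re z = 0 \<Longrightarrow> norm (f z) \<le> M" and w: "Re w \<ge> 0"
  shows "norm (f w) \<le> M"
proof -
  have main: "norm (f w * exp (- of_real e * (w + 1) powr (3/4))) \<le> M" if e: "e > 0" for e
  proof -
    define g where "g = (\<lambda>z. f z * exp (- of_real e * (z + 1) powr (3/4)))"
    define c where "c = cos (3 * pi / 8)"
    have c: "c > 0" unfolding c_def by (rule cos_gt_zero) auto
    have ng: "norm (g z) \<le> norm (f z) * exp (- (e * c * norm (z + 1) powr (3/4)))" if "Re z \<ge> 0" for z
      using Re_powr_three_quarters[of "z + 1"] that e
      by (auto simp: g_def norm_mult norm_exp_eq_Re c_def mult.assoc intro!: mult_left_mono)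
    \<comment> \<open>A strictly positive rate replaces \<open>B\<close>, whose sign is unknown, for
      the asymptotic comparison of \<open>sqrt R\<close> with
      \<open>(R - 1) powr (3/4)\<close>.\<close>
    define B' where "B' = \<bar>B\<bar> + 1"
    define d where "d = e * c"
    have pos: "B' > 0" "d > 0" using e c by (auto simp: B'_def d_def)
    then have lim: "((\<lambda>R. exp (B' * sqrt R) * exp (- (d * (R - 1) powr (3/4)))) \<longlongrightarrow> 0) at_top"
      by real_asymp
    have "((\<lambda>R. exp (B * sqrt R) * exp (- (d * (R - 1) powr (3/4)))) \<longlongrightarrow> 0) at_top"
    proof (rule tendsto_sandwich[OF _ _ tendsto_const lim])
      show "\<forall>\<^sub>F R in at_top. exp (B * sqrt R) * exp (- (d * (R - 1) powr (3/4))) \<le> exp (B' * sqrt R) * exp (- (d * (R - 1) powr (3/4)))"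
        using eventually_ge_at_top[of 0]
      proof eventually_elim
        case (elim R)
        have "B * sqrt R \<le> B' * sqrt R" by (rule mult_right_mono) (use elim in \<open>auto simp: B'_def\<close>)
        then show ?case by (intro mult_right_mono) auto
      qed
    qed auto
    from tendsto_mult[OF tendsto_const[of "\<bar>K\<bar>"] this]
    have "((\<lambda>R. \<bar>K\<bar> * exp (B * sqrt R) * exp (- (e * c * (R - 1) powr (3/4)))) \<longlongrightarrow> 0) at_top"
      by (simp add: d_def mult.assoc)
    then have "eventually (\<lambda>R. \<bar>K\<bar> * exp (B * sqrt R) * exp (- (e * c * (R - 1) powr (3/4))) < M) at_top"
      using M by (intro order_tendstoD) auto
    then obtain R0 where R0: "\<And>R. R \<ge> R0 \<Longrightarrow> \<bar>K\<bar> * exp (B * sqrt R) * exp (- (e * c * (R - 1) powr (3/4))) < M"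
      unfolding eventually_at_top_linorder by blast
    define R where "R = max (norm w + 1) (max R0 2)"
    define S where "S = {z. Re z \<ge> 0} \<inter> cball 0 R"
    have cS: "closed S" unfolding S_def by (intro closed_Int closed_halfspace_Re_ge) auto
    have holg: "g holomorphic_on {z. Re z > -1}"
      unfolding g_def
      by (intro holomorphic_intros holomorphic_on_subset[OF f]) (auto simp: complex_nonpos_Reals_iff)
    have "norm (g w) \<le> M"
    proof (rule maximum_modulus_frontier[of g S M w])
      show "g holomorphic_on interior S"
        by (rule holomorphic_on_subset[OF holg]) (use interior_subset[of S] in \<open>auto simp: S_def\<close>)
      show "continuous_on (closure S) g"
        unfolding closure_closed[OF cS]
        by (rule continuous_on_subset[OF holomorphic_on_imp_continuous_on[OF holg]]) (auto simp: S_def)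
      show "bounded S" unfolding S_def by (intro bounded_Int) auto
      show "w \<in> S" using w by (auto simp: S_def R_def)
      fix z assume z: "z \<in> frontier S"
      have zS: "z \<in> S" using z cS frontier_subset_closed by blast
      then have Rez: "Re z \<ge> 0" "norm z \<le> R" by (auto simp: S_def)
      have "Re z = 0 \<or> norm z = R"
      proof (rule ccontr)
        assume "\<not> (Re z = 0 \<or> norm z = R)"
        then have "z \<in> {z. Re z > 0} \<inter> ball 0 R" using Rez by auto
        moreover have "open ({z. Re z > 0} \<inter> ball 0 R)" by (intro open_Int open_halfspace_Re_gt) auto
        moreover have "{z. Re z > 0} \<inter> ball 0 R \<subseteq> S" by (auto simp: S_def)
        ultimately have "z \<in> interior S" by (meson interiorI)
        then show False using z by (simp add: frontier_def)
      qed
      then show "norm (g z) \<le> M"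
      proof
        assume "Re z = 0"
        then have "norm (f z) \<le> M" by (rule axis)
        moreover have "norm (f z) * exp (- (e * c * norm (z + 1) powr (3/4))) \<le> norm (f z)"
          using e c by (intro mult_left_le) auto
        ultimately show ?thesis using ng[OF Rez(1)] by linarith
      next
        assume zR: "norm z = R"
        have R2: "R \<ge> 2" "R \<ge> R0" by (auto simp: R_def)
        have "R - 1 \<le> norm (z + 1)" using norm_triangle_ineq4[of "z + 1" 1] zR by simp
        then have "(R - 1) powr (3/4) \<le> norm (z + 1) powr (3/4)" using R2 by (intro powr_mono2) auto
        then have 1: "exp (- (e * c * norm (z + 1) powr (3/4))) \<le> exp (- (e * c * (R - 1) powr (3/4)))"
          using e c by simp
        have "norm (f z) \<le> K * exp (B * sqrt R)" using growth[of z] zR by simp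
        also have "\<dots> \<le> \<bar>K\<bar> * exp (B * sqrt R)" by (intro mult_right_mono) auto
        finally have "norm (f z) * exp (- (e * c * norm (z + 1) powr (3/4))) \<le> \<bar>K\<bar> * exp (B * sqrt R) * exp (- (e * c * (R - 1) powr (3/4)))"
          using 1 by (intro mult_mono) auto
        then show ?thesis using ng[OF Rez(1)] R0[OF R2(2)] by linarith
      qed
    qed
    then show ?thesis by (simp add: g_def)
  qed
  have "((\<lambda>e. norm (f w * exp (- of_real e * (w + 1) powr (3/4)))) \<longlongrightarrow> norm (f w * exp (- of_real 0 * (w + 1) powr (3/4)))) (at_right 0)"
    by (intro tendsto_intros)
  moreover have "eventually (\<lambda>e. norm (f w * exp (- of_real e * (w + 1) powr (3/4))) \<le> M) (at_right 0)"
    using eventually_at_right_less[of "0::real"] by eventually_elim (rule main)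
  ultimately show ?thesis
    using tendsto_upperbound by fastforce
qed

text \<open>Decay bounds \<open>f\<close> on the left half plane including the imaginary axis, so
  the growth bound makes it bounded on the right one too. The resulting constant is 0 by decay along
  the negative reals.\<close>

lemma entire_zero_of_decay:
  assumes f: "f holomorphic_on UNIV"
    and growth: "\<And>z. norm z \<ge> R0 \<Longrightarrow> norm (f z) \<le> K * exp (B * sqrt (norm z))"
    and decay: "\<And>z. Re z \<le> 0 \<Longrightarrow> norm z \<ge> R0 \<Longrightarrow> norm (f z) \<le> D / sqrt (norm z)"
  shows "f z = 0"
proof -
  define R where "R = max R0 1"
  have "continuous_on (cball 0 R) f" using f holomorphic_on_imp_continuous_on holomorphic_on_subset by blast
  then have "bounded (f ` cball 0 R)" using compact_continuous_image compact_imp_bounded compact_cball by blast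
  then obtain L where L: "\<And>z. norm z \<le> R \<Longrightarrow> norm (f z) \<le> L"
    unfolding bounded_iff by (metis image_eqI mem_cball_0)
  have L0: "0 \<le> L" by (rule order_trans[OF norm_ge_zero L[of 0]]) (simp add: R_def le_max_iff_disj)
  define M where "M = max L \<bar>D\<bar> + 1"
  have left: "norm (f z) \<le> M" if "Re z \<le> 0" for z
  proof (cases "norm z \<le> R")
    case True
    then show ?thesis using L[OF True] by (simp add: M_def)
  next
    case False
    then have z: "norm z \<ge> R0" "norm z \<ge> 1" by (auto simp: R_def)
    have "norm (f z) \<le> D / sqrt (norm z)" by (rule decay[OF that z(1)])
    also have "\<dots> \<le> \<bar>D\<bar> / sqrt (norm z)" by (intro divide_right_mono) auto
    also have "\<dots> \<le> \<bar>D\<bar> / 1" using z(2) by (intro divide_left_mono) auto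
    finally show ?thesis by (simp add: M_def)
  qed
  have g: "norm (f z) \<le> (\<bar>K\<bar> + L) * exp (\<bar>B\<bar> * sqrt (norm z))" for z
  proof (cases "norm z \<le> R")
    case True
    have "norm (f z) \<le> (\<bar>K\<bar> + L) * 1" using L[OF True] by simp
    also have "\<dots> \<le> (\<bar>K\<bar> + L) * exp (\<bar>B\<bar> * sqrt (norm z))" using L0 by (intro mult_left_mono) auto
    finally show ?thesis .
  next
    case False
    then have "norm (f z) \<le> K * exp (B * sqrt (norm z))" using growth[of z] by (simp add: R_def)
    also have "\<dots> \<le> (\<bar>K\<bar> + L) * exp (\<bar>B\<bar> * sqrt (norm z))"
      using L0 by (intro mult_mono) (auto intro: mult_right_mono)
    finally show ?thesis .
  qed
  have right: "norm (f z) \<le> M" if "Re z \<ge> 0" for z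
    by (rule phragmen_lindelof_half_plane[OF f _ g _ that]) (use left L0 in \<open>auto simp: M_def\<close>)
  have "bounded (range f)"
    unfolding bounded_iff using left right by (metis linear rangeE)
  then obtain c where c: "\<And>z. f z = c"
    using Liouville_theorem[OF f] by (auto simp: constant_on_def)
  have "((\<lambda>x. D / sqrt x) \<longlongrightarrow> 0) at_top" by real_asymp
  moreover have "eventually (\<lambda>x. norm c \<le> D / sqrt x) at_top"
    using eventually_ge_at_top[of "max R0 0"]
  proof eventually_elim
    case (elim x)
    then show ?case using decay[of "of_real (- x)"] c by simp
  qed
  ultimately have "norm c \<le> 0"
    by (intro tendsto_lowerbound[of "\<lambda>x. D / sqrt x" 0 at_top]) auto
  then show ?thesis using c by simp
qed

section \<open>The Borg-Marchenko theorem on one edge\<close>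

text \<open>For \<open>lam = - r\<^sup>2\<close> the sector is the half plane \<open>Re lam \<le> 0\<close>.\<close>

definition at_sector :: "complex filter" where
  "at_sector = inf at_infinity (principal {r. \<bar>Im r\<bar> \<le> Re r})"

lemma eventually_at_sector:
  "eventually P at_sector \<longleftrightarrow> (\<exists>b. \<forall>r. b \<le> norm r \<and> \<bar>Im r\<bar> \<le> Re r \<longrightarrow> P r)"
  unfolding at_sector_def eventually_inf_principal eventually_at_infinity by auto

lemma at_sector_neq_bot [simp]: "at_sector \<noteq> bot"
proof
  assume "at_sector = bot"
  then have "eventually (\<lambda>r. False) at_sector" by simp
  then obtain b where b: "\<And>r. b \<le> norm r \<and> \<bar>Im r\<bar> \<le> Re r \<longrightarrow> False"
    unfolding eventually_at_sector by blast
  from b[of "of_real \<bar>b\<bar>"] show False by simp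
qed

lemma filterlim_norm_sector: "filterlim norm at_top at_sector"
  unfolding filterlim_at_top eventually_at_sector by blast

lemma eventually_sector_large: "eventually (\<lambda>r. b \<le> norm r \<and> \<bar>Im r\<bar> \<le> Re r) at_sector"
  unfolding eventually_at_sector by blast

text \<open>Turns exponential decay in \<open>Re r\<close> into decay in
  \<open>norm r\<close>.\<close>

lemma sector_Re: "\<bar>Im r\<bar> \<le> Re r \<Longrightarrow> norm r \<le> 2 * Re r"
  using cmod_le[of r] by linarith

lemma tendsto_sector_norm_bound:
  assumes g: "(g \<longlongrightarrow> (0::real)) at_top" and le: "eventually (\<lambda>r. norm (f r - l) \<le> g (norm r)) at_sector"
  shows "(f \<longlongrightarrow> (l::complex)) at_sector"
proof -
  have "((\<lambda>r. g (norm r)) \<longlongrightarrow> 0) at_sector" by (rule filterlim_compose[OF g filterlim_norm_sector])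
  then have "((\<lambda>r. f r - l) \<longlongrightarrow> 0) at_sector" by (rule Lim_null_comparison[OF le])
  then show ?thesis by (simp add: LIM_zero_iff)
qed

text \<open>At the far end, after division by \<open>exp r\<close>, the component
  \<open>z - r y\<close> starts from \<open>exp (- 2 * r)\<close> times its initial value. Hence
  \<open>2 * r * y\<close> and \<open>2 * z\<close> share the leading term that comes from
  \<open>z + r y\<close>.\<close>

lemma sol_end_estimate:
  assumes q: "L1 q" and s: "edge_sol q (-(r^2)) y z"
    and r: "r \<noteq> 0" "\<bar>Im r\<bar> \<le> Re r" and Q: "integral {0..1} (\<lambda>x. norm (q x)) \<le> Q" "2 * Q \<le> norm r"
    and A: "norm (z 0 + r * y 0) + norm (z 0 - r * y 0) \<le> 2 * norm r * A"
  shows "norm (2 * r * exp (-r) * y 1 - (z 0 + r * y 0)) \<le> 4 * A * Q + exp (- norm r) * norm (z 0 - r * y 0)"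
    "norm (2 * exp (-r) * z 1 - (z 0 + r * y 0)) \<le> 4 * A * Q + exp (- norm r) * norm (z 0 - r * y 0)"
proof -
  have Re: "Re r \<ge> 0" using r(2) by linarith
  note b = sol_bounds(2,3)[OF q s r(1) Re Q A, of 1]
  define P where "P = exp (-r) * (z 1 + r * y 1)"
  define M where "M = exp (-r) * (z 1 - r * y 1)"
  define M0 where "M0 = exp (- 2 * r) * (z 0 - r * y 0)"
  have PM: "norm (P - (z 0 + r * y 0)) \<le> 2 * A * Q" "norm (M - M0) \<le> 2 * A * Q"
    using b by (simp_all add: P_def M_def M0_def)
  have "norm (exp (- 2 * r)) \<le> exp (- norm r)"
    using sector_Re[OF r(2)] by (simp add: norm_exp_eq_Re)
  then have M0: "norm M0 \<le> exp (- norm r) * norm (z 0 - r * y 0)"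
    unfolding M0_def norm_mult by (intro mult_right_mono) auto
  have tri: "norm (P - M - c) \<le> norm (P - c) + norm (M - M0) + norm M0"
    "norm (P + M - c) \<le> norm (P - c) + norm (M - M0) + norm M0" for c by norm+
  have "2 * r * exp (-r) * y 1 = P - M" "2 * exp (-r) * z 1 = P + M"
    by (simp_all add: P_def M_def algebra_simps)
  then show "norm (2 * r * exp (-r) * y 1 - (z 0 + r * y 0)) \<le> 4 * A * Q + exp (- norm r) * norm (z 0 - r * y 0)"
    "norm (2 * exp (-r) * z 1 - (z 0 + r * y 0)) \<le> 4 * A * Q + exp (- norm r) * norm (z 0 - r * y 0)"
    using tri[of "z 0 + r * y 0"] PM M0 by simp_all
qed

lemma phi_initial_bound:
  fixes r b :: complex
  assumes "norm r \<ge> 1"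
  shows "norm (b + r * 1) + norm (b - r * 1) \<le> 2 * norm r * (1 + norm b)"
proof -
  have "norm (b + r * 1) + norm (b - r * 1) \<le> 2 * norm b + 2 * norm r"
    using norm_triangle_ineq[of b r] norm_triangle_ineq4[of b r] by simp
  also have "\<dots> \<le> 2 * norm r * (1 + norm b)"
    using mult_right_mono[OF assms, of "norm b"] by (simp add: algebra_simps)
  finally show ?thesis .
qed

text \<open>For \<open>q = 0\<close> and \<open>b = 0\<close> the four end values are
  \<open>cosh r\<close>, \<open>r * sinh r\<close>, \<open>sinh r / r\<close> and
  \<open>cosh r\<close>; neither the potential nor \<open>b\<close> changes the leading
  order.\<close>

lemma tendsto_end:
  assumes q: "L1 q"
  shows "((\<lambda>r. 2 * exp (-r) * ivp_val q 1 b (-(r^2)) 1) \<longlongrightarrow> 1) at_sector"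
    "((\<lambda>r. 2 * exp (-r) * ivp_der q 1 b (-(r^2)) 1 / r) \<longlongrightarrow> 1) at_sector"
    "((\<lambda>r. 2 * r * exp (-r) * ivp_val q 0 1 (-(r^2)) 1) \<longlongrightarrow> 1) at_sector"
    "((\<lambda>r. 2 * exp (-r) * ivp_der q 0 1 (-(r^2)) 1) \<longlongrightarrow> 1) at_sector"
proof -
  define Q where "Q = integral {0..1} (\<lambda>x. norm (q x))"
  note ex = sol_exists[OF q]
  define g where "g = (\<lambda>x. (4 * (1 + norm b) * Q + exp (- x) * (norm b + x) + norm b) / x)"
  have g: "(g \<longlongrightarrow> 0) at_top" unfolding g_def by real_asymp
  \<comment> \<open>For initial values 0 and 1 the admissible \<open>A\<close> is
    \<open>1 / norm r\<close>, so the integral error vanishes without a further division by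
    \<open>r\<close>.\<close>
  define k where "k = (\<lambda>x. 4 * (1 / x) * Q + exp (- x))"
  have k: "(k \<longlongrightarrow> 0) at_top" unfolding k_def by real_asymp
  have ev: "eventually (\<lambda>r. norm r \<ge> 1 \<and> r \<noteq> 0 \<and> \<bar>Im r\<bar> \<le> Re r \<and> 2 * Q \<le> norm r) at_sector"
    using eventually_sector_large[of "max 1 (2 * Q)"] by eventually_elim auto
  have 1: "norm (2 * exp (-r) * ivp_val q 1 b (-(r^2)) 1 - 1) \<le> g (norm r) \<and>
     norm (2 * exp (-r) * ivp_der q 1 b (-(r^2)) 1 / r - 1) \<le> g (norm r)"
    if r: "norm r \<ge> 1 \<and> r \<noteq> 0 \<and> \<bar>Im r\<bar> \<le> Re r \<and> 2 * Q \<le> norm r" for r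
  proof -
    have A: "norm (ivp_der q 1 b (-(r^2)) 0 + r * ivp_val q 1 b (-(r^2)) 0) + norm (ivp_der q 1 b (-(r^2)) 0 - r * ivp_val q 1 b (-(r^2)) 0)
        \<le> 2 * norm r * (1 + norm b)"
      unfolding ex(2,3) by (rule phi_initial_bound) (use r in auto)
    define e where "e = 4 * (1 + norm b) * Q + exp (- norm r) * norm (b - r)"
    have E: "norm (2 * r * exp (-r) * ivp_val q 1 b (-(r^2)) 1 - (b + r)) \<le> e"
      "norm (2 * exp (-r) * ivp_der q 1 b (-(r^2)) 1 - (b + r)) \<le> e"
      using sol_end_estimate[OF q ex(1) _ _ eq_refl[OF Q_def[symmetric]] _ A] r unfolding ex(2,3) e_def by auto
    have "exp (- norm r) * norm (b - r) \<le> exp (- norm r) * (norm b + norm r)"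
      by (intro mult_left_mono norm_triangle_ineq4) auto
    then have eg: "(e + norm b) / norm r \<le> g (norm r)"
      unfolding e_def g_def by (intro divide_right_mono) auto
    have *: "norm (u - r) \<le> e + norm b" if "norm (u - (b + r)) \<le> e" for u
      using that norm_triangle_ineq[of "u - (b + r)" b] by simp
    have **: "norm (u / r - 1) \<le> g (norm r)" if "norm (u - (b + r)) \<le> e" for u
    proof -
      have "norm (u / r - 1) = norm (u - r) / norm r"
        using r by (simp add: divide_simps flip: norm_divide)
      also have "\<dots> \<le> (e + norm b) / norm r" using *[OF that] by (rule divide_right_mono) simp
      finally show ?thesis using eg by linarith
    qed
    have "2 * r * exp (-r) * ivp_val q 1 b (-(r^2)) 1 / r = 2 * exp (-r) * ivp_val q 1 b (-(r^2)) 1"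
      using r by simp
    with **[OF E(1)] **[OF E(2)] show ?thesis by simp
  qed
  show "((\<lambda>r. 2 * exp (-r) * ivp_val q 1 b (-(r^2)) 1) \<longlongrightarrow> 1) at_sector"
    "((\<lambda>r. 2 * exp (-r) * ivp_der q 1 b (-(r^2)) 1 / r) \<longlongrightarrow> 1) at_sector"
    by (rule tendsto_sector_norm_bound[OF g], rule eventually_mono[OF ev], use 1 in blast)+
  have 2: "norm (2 * r * exp (-r) * ivp_val q 0 1 (-(r^2)) 1 - 1) \<le> k (norm r) \<and>
     norm (2 * exp (-r) * ivp_der q 0 1 (-(r^2)) 1 - 1) \<le> k (norm r)"
    if r: "norm r \<ge> 1 \<and> r \<noteq> 0 \<and> \<bar>Im r\<bar> \<le> Re r \<and> 2 * Q \<le> norm r" for r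
  proof -
    have A: "norm (ivp_der q 0 1 (-(r^2)) 0 + r * ivp_val q 0 1 (-(r^2)) 0) + norm (ivp_der q 0 1 (-(r^2)) 0 - r * ivp_val q 0 1 (-(r^2)) 0)
        \<le> 2 * norm r * (1 / norm r)"
      unfolding ex(2,3) using r by simp
    show ?thesis
      using sol_end_estimate[OF q ex(1) _ _ eq_refl[OF Q_def[symmetric]] _ A] r unfolding ex(2,3) k_def by auto
  qed
  show "((\<lambda>r. 2 * r * exp (-r) * ivp_val q 0 1 (-(r^2)) 1) \<longlongrightarrow> 1) at_sector"
    "((\<lambda>r. 2 * exp (-r) * ivp_der q 0 1 (-(r^2)) 1) \<longlongrightarrow> 1) at_sector"
    by (rule tendsto_sector_norm_bound[OF k], rule eventually_mono[OF ev], use 2 in blast)+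
qed

text \<open>The Wronskian with the solution starting at \<open>(1, - h)\<close> equals -1 and
  expresses \<open>y 1\<close> through a denominator of size \<open>norm r * exp (Re r)\<close>,
  nondegenerate because \<open>\<omega> \<noteq> 1\<close>. So \<open>y 1\<close> is of order
  \<open>exp (- Re r) / norm r\<close>, and running back from \<open>x = 1\<close> gains at most
  \<open>exp (Re r * (1 - x))\<close>.\<close>

lemma weyl_decay:
  assumes q: "L1 q" and w: "((\<lambda>r. w r / r) \<longlongrightarrow> \<omega>) at_sector" "\<omega> \<noteq> 1"
  shows "\<exists>K. eventually (\<lambda>r. \<forall>y z. edge_sol q (-(r^2)) y z \<and> z 0 + h * y 0 = 1 \<and> z 1 = w r * y 1 \<longrightarrow>
     (\<forall>x\<in>{0..1}. norm (y x) \<le> K * exp (- (Re r * x)) / norm r)) at_sector"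
proof -
  define Q where "Q = integral {0..1} (\<lambda>x. norm (q x))"
  note ex = sol_exists[OF q]
  define D where "D = (\<lambda>r. 2 * exp (-r) * ivp_der q 1 (-h) (-(r^2)) 1 / r - (w r / r) * (2 * exp (-r) * ivp_val q 1 (-h) (-(r^2)) 1))"
  have D: "(D \<longlongrightarrow> 1 - \<omega> * 1) at_sector"
    unfolding D_def by (intro tendsto_intros tendsto_end q w)
  define d where "d = norm (1 - \<omega>) / 2"
  have d: "d > 0" using w by (simp add: d_def)
  have evD: "eventually (\<lambda>r. d < norm (D r)) at_sector"
    using order_tendstoD(1)[OF tendsto_norm[OF D], of d] w(2) by (simp add: d_def)
  have evw: "eventually (\<lambda>r. norm (w r / r) < norm \<omega> + 1) at_sector"
    using order_tendstoD(2)[OF tendsto_norm[OF w(1)], of "norm \<omega> + 1"] by simp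
  define K where "K = 2 * ((norm \<omega> + 2) * (2 / d))"
  show ?thesis
  proof (rule exI[of _ K], rule eventually_mono[OF eventually_conj[OF eventually_sector_large[of "max 1 (2 * Q)"] eventually_conj[OF evD evw]]], intro allI impI ballI)
    fix r y z and x :: real
    assume ev: "(max 1 (2 * Q) \<le> norm r \<and> \<bar>Im r\<bar> \<le> Re r) \<and> d < norm (D r) \<and> norm (w r / r) < norm \<omega> + 1"
      and s: "edge_sol q (-(r^2)) y z \<and> z 0 + h * y 0 = 1 \<and> z 1 = w r * y 1" and x: "x \<in> {0..1}"
    have r: "r \<noteq> 0" "norm r \<ge> 1" "2 * Q \<le> norm r" "Re r \<ge> 0" using ev by auto
    let ?f = "ivp_val q 1 (-h) (-(r^2))" and ?g = "ivp_der q 1 (-h) (-(r^2))"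
    have "y 1 * ?g 1 - z 1 * ?f 1 = y 0 * ?g 0 - z 0 * ?f 0"
      by (rule wronskian_const[OF _ ex(1)]) (use s in auto)
    also have "\<dots> = -1" unfolding ex(2,3) using s by (simp add: algebra_simps)
    finally have "y 1 * (?g 1 - w r * ?f 1) = -1" using s by (simp add: algebra_simps)
    moreover have "D r * r = 2 * exp (-r) * (?g 1 - w r * ?f 1)"
      unfolding D_def using r by (simp add: field_simps)
    moreover have "y 1 * (2 * exp (-r) * (?g 1 - w r * ?f 1)) = 2 * exp (-r) * (y 1 * (?g 1 - w r * ?f 1))"
      by (simp only: mult_ac)
    ultimately have "y 1 * (D r * r) = - (2 * exp (-r))" by simp
    then have "norm (y 1) * (norm (D r) * norm r) = 2 * exp (- Re r)"
      by (metis norm_mult norm_minus_cancel norm_numeral norm_exp_eq_Re uminus_complex.sel(1))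
    moreover have "norm (y 1) * (d * norm r) \<le> norm (y 1) * (norm (D r) * norm r)"
      using ev by (intro mult_left_mono mult_right_mono) auto
    ultimately have y1: "norm (y 1) \<le> (2 / d) * exp (- Re r) / norm r"
      using d r by (simp add: field_simps)
    \<comment> \<open>Bounds the components of the reflected solution at its initial point
      \<open>x = 1\<close>, using that \<open>norm (w r)\<close> is at most
      \<open>(norm \<omega> + 1) * norm r\<close>.\<close>
    define A where "A = (norm \<omega> + 2) * norm (y 1)"
    have nw: "norm (w r) \<le> (norm \<omega> + 1) * norm r"
      using ev r by (simp add: norm_divide field_simps)
    have A: "norm (- z (1 - 0) + r * y (1 - 0)) + norm (- z (1 - 0) - r * y (1 - 0)) \<le> 2 * norm r * A"
    proof -
      have "norm (- z 1 + r * y 1) + norm (- z 1 - r * y 1) \<le> 2 * (norm (z 1) + norm (r * y 1))" by norm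
      also have "\<dots> = 2 * (norm (w r) + norm r) * norm (y 1)" using s by (simp add: norm_mult algebra_simps)
      also have "\<dots> \<le> 2 * ((norm \<omega> + 1) * norm r + norm r) * norm (y 1)"
        using nw by (intro mult_right_mono) auto
      finally show ?thesis by (simp add: A_def algebra_simps)
    qed
    have "norm (y (1 - (1 - x))) \<le> 2 * A * exp (Re r * (1 - x))"
    proof (rule sol_bounds(1)[OF abs_int_reflect01(1)[OF q] sol_reflect[of q "-(r^2)" y z] r(1) r(4) _ r(3) A])
      show "edge_sol q (-(r^2)) y z" using s by blast
      show "integral {0..1} (\<lambda>x. norm (q (1 - x))) \<le> Q" using abs_int_reflect01(2)[OF q] by (simp add: Q_def)
      show "1 - x \<in> {0..1}" using x by auto
    qed
    also have "\<dots> \<le> 2 * ((norm \<omega> + 2) * ((2 / d) * exp (- Re r) / norm r)) * exp (Re r * (1 - x))"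
      unfolding A_def using y1 by (intro mult_right_mono mult_left_mono) auto
    also have "\<dots> = K / norm r * (exp (- Re r) * exp (Re r * (1 - x)))" by (simp add: K_def)
    also have "exp (- Re r) * exp (Re r * (1 - x)) = exp (- (Re r * x))"
      by (simp add: algebra_simps flip: exp_add)
    finally show "norm (y x) \<le> K * exp (- (Re r * x)) / norm r" by simp
  qed
qed

lemma phi_bound:
  assumes q: "L1 q" and r: "norm r \<ge> 1" "2 * integral {0..1} (\<lambda>x. norm (q x)) \<le> norm r" "Re r \<ge> 0"
    and x: "x \<in> {0..1}"
  shows "norm (ivp_val q 1 b (-(r^2)) x) \<le> 2 * (1 + norm b) * exp (Re r * x)"
    "norm (ivp_val q 0 1 (-(r^2)) x) \<le> 2 * exp (Re r * x)"
proof -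
  note ex = sol_exists[OF q]
  have r0: "r \<noteq> 0" using r by auto
  show "norm (ivp_val q 1 b (-(r^2)) x) \<le> 2 * (1 + norm b) * exp (Re r * x)"
    by (rule sol_bounds(1)[OF q ex(1) r0 r(3) order_refl r(2) _ x]) (unfold ex(2,3), rule phi_initial_bound[OF r(1)])
  have "norm (ivp_val q 0 1 (-(r^2)) x) \<le> 2 * 1 * exp (Re r * x)"
    by (rule sol_bounds(1)[OF q ex(1) r0 r(3) order_refl r(2) _ x]) (use r in \<open>simp add: ex(2,3)\<close>)
  then show "norm (ivp_val q 0 1 (-(r^2)) x) \<le> 2 * exp (Re r * x)" by simp
qed

text \<open>At a zero of \<open>y\<close> the components \<open>z + r y\<close> and
  \<open>z - r y\<close> coincide, whereas their leading terms differ by about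
  \<open>r * (1 + exp (- 2 * r * x))\<close>. \<open>R\<close> is the size of \<open>r\<close> at
  which this becomes contradictory.\<close>

lemma phi_nonzero:
  assumes q: "L1 q"
  shows "\<exists>R\<ge>1. \<forall>r\<ge>R. \<forall>x\<in>{0..1}. ivp_val q 1 b (-(of_real r^2)) x \<noteq> 0"
proof -
  define Q where "Q = integral {0..1} (\<lambda>x. norm (q x))"
  have Q0: "Q \<ge> 0" unfolding Q_def
    using q by (intro integral_nonneg) (auto simp: absolutely_integrable_on_def)
  note ex = sol_exists[OF q]
  define R where "R = 2 * norm b + 4 * (1 + norm b) * Q + 2 * Q + 1"
  have R1: "R \<ge> 1" using Q0 by (simp add: R_def)
  have "ivp_val q 1 b (-(of_real r^2)) x \<noteq> 0" if r: "r \<ge> R" and x: "x \<in> {0..1}" for r x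
  proof
    assume zero: "ivp_val q 1 b (-(of_real r^2)) x = 0"
    let ?r = "complex_of_real r"
    have r1: "r \<ge> 1" using r R1 by linarith
    have rQ: "2 * Q \<le> norm ?r" using r r1 Q0 by (simp add: R_def) (smt (verit) mult_nonneg_nonneg norm_ge_zero)
    define z where "z = ivp_der q 1 b (-(?r^2)) x"
    define c where "c = exp (- 2 * r * x)"
    have c: "c > 0" "c \<le> 1" using r1 x by (auto simp: c_def)
    have A: "norm (ivp_der q 1 b (-(?r^2)) 0 + ?r * ivp_val q 1 b (-(?r^2)) 0) + norm (ivp_der q 1 b (-(?r^2)) 0 - ?r * ivp_val q 1 b (-(?r^2)) 0)
        \<le> 2 * norm ?r * (1 + norm b)"
      unfolding ex(2,3) by (rule phi_initial_bound) (use r1 in auto)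
    have r0: "?r \<noteq> 0" "Re ?r \<ge> 0" using r1 by auto
    note B = sol_bounds(2,3)[OF q ex(1) r0 eq_refl[OF Q_def[symmetric]] rQ A x]
    have e: "exp (- 2 * ?r * of_real x) = of_real c" by (simp add: c_def exp_of_real[symmetric])
    define P where "P = exp (- ?r * of_real x) * z"
    have B': "norm (P - (b + ?r)) \<le> 2 * (1 + norm b) * Q" "norm (P - of_real c * (b - ?r)) \<le> 2 * (1 + norm b) * Q"
      using B unfolding zero e ex(2,3) by (simp_all add: P_def z_def)
    have "norm ((b + ?r) - of_real c * (b - ?r)) \<le> 4 * (1 + norm b) * Q"
      using B' norm_triangle_ineq4[of "P - of_real c * (b - ?r)" "P - (b + ?r)"] by (simp add: algebra_simps)
    then have "norm (of_real (r * (1 + c)) + of_real (1 - c) * b) \<le> 4 * (1 + norm b) * Q"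
      by (simp add: algebra_simps)
    moreover have "norm (of_real (r * (1 + c)) + of_real (1 - c) * b) \<ge> norm (complex_of_real (r * (1 + c))) - norm (of_real (1 - c) * b)"
      by norm
    moreover have "norm (complex_of_real (r * (1 + c))) = r * (1 + c)"
      unfolding norm_of_real using r1 c by (intro abs_of_nonneg mult_nonneg_nonneg) auto
    moreover have "r \<le> r * (1 + c)" using r1 c by (simp add: algebra_simps)
    moreover have "norm (of_real (1 - c) * b) \<le> norm b"
      unfolding norm_mult norm_of_real using c by (intro mult_left_le_one_le) auto
    moreover have "r \<ge> 2 * norm b + 4 * (1 + norm b) * Q + 2 * Q + 1" using r by (simp add: R_def)
    ultimately show False using Q0 norm_ge_zero[of b] by linarith
  qed
  then show ?thesis using R1 by blast
qed

lemma prim_constant_zero: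
  assumes p: "prim F f" "continuous_on {0..1} f" and c: "\<And>x. x \<in> {0..1} \<Longrightarrow> F x = c" and x: "x \<in> {0..1}"
  shows "f x = 0"
proof -
  have "((\<lambda>_. c) has_vector_derivative f x) (at x within {0..1})"
    by (rule has_vector_derivative_transform[OF x _ prim_has_vector_derivative[OF p x]]) (use c in auto)
  then show ?thesis
    using vector_derivative_unique_within_closed_interval[of 0 1 x "\<lambda>_. c" "f x" 0] x
      has_vector_derivative_const by auto
qed

text \<open>Primes mark the second problem, not derivatives. Under the normalisation at 0 the values
  \<open>y 0\<close> and \<open>y' 0\<close> are the two Weyl functions. The conditions at
  \<open>x = 1\<close> may differ between the problems; only decay of the solutions is drawn from
  them.\<close>

lemma borg_marchenko:
  assumes q: "L1 q" and q': "L1 q'"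
    and w: "((\<lambda>r. w r / r) \<longlongrightarrow> \<omega>) at_sector" "\<omega> \<noteq> 1" and w': "((\<lambda>r. w' r / r) \<longlongrightarrow> \<omega>') at_sector" "\<omega>' \<noteq> 1"
    and ev: "eventually (\<lambda>r. \<exists>y z y' z'. edge_sol q (-(r^2)) y z \<and> edge_sol q' (-(r^2)) y' z' \<and> y 0 = y' 0 \<and>
       z 0 + h * y 0 = 1 \<and> z' 0 + h' * y' 0 = 1 \<and> z 1 = w r * y 1 \<and> z' 1 = w' r * y' 1) at_sector"
  shows "h = h'" "\<exists>N. negligible N \<and> (\<forall>x\<in>{0..1} - N. q x = q' x)"
proof -
  note ex = sol_exists[OF q] and ex' = sol_exists[OF q']
  define E where "E = (\<lambda>x lam. ivp_val q 0 1 lam x * ivp_val q' 1 (-h') lam x - ivp_val q' 0 1 lam x * ivp_val q 1 (-h) lam x)"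
  obtain K where K: "eventually (\<lambda>r. \<forall>y z. edge_sol q (-(r^2)) y z \<and> z 0 + h * y 0 = 1 \<and> z 1 = w r * y 1 \<longrightarrow>
     (\<forall>x\<in>{0..1}. norm (y x) \<le> K * exp (- (Re r * x)) / norm r)) at_sector"
    using weyl_decay[OF q w] by blast
  obtain K' where K': "eventually (\<lambda>r. \<forall>y z. edge_sol q' (-(r^2)) y z \<and> z 0 + h' * y 0 = 1 \<and> z 1 = w' r * y 1 \<longrightarrow>
     (\<forall>x\<in>{0..1}. norm (y x) \<le> K' * exp (- (Re r * x)) / norm r)) at_sector"
    using weyl_decay[OF q' w'] by blast
  define Q where "Q = max (2 * integral {0..1} (\<lambda>x. norm (q x))) (2 * integral {0..1} (\<lambda>x. norm (q' x)))"
  have E0: "E x lam = 0" if x: "x \<in> {0..1}" for x lam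
  proof -
    obtain R1 where R1: "\<And>r. \<lbrakk>R1 \<le> norm r; \<bar>Im r\<bar> \<le> Re r\<rbrakk> \<Longrightarrow>
        norm (E x (-(r^2))) \<le> (K * (2 * (1 + norm h')) + K' * (2 * (1 + norm h))) / norm r"
    proof -
      have "eventually (\<lambda>r. norm (E x (-(r^2))) \<le> (K * (2 * (1 + norm h')) + K' * (2 * (1 + norm h))) / norm r) at_sector"
        using ev K K' eventually_sector_large[of "max 1 Q"]
      proof eventually_elim
        case (elim r)
        then obtain y z y' z' where s: "edge_sol q (-(r^2)) y z" "edge_sol q' (-(r^2)) y' z'" "y 0 = y' 0"
          "z 0 + h * y 0 = 1" "z' 0 + h' * y' 0 = 1" "z 1 = w r * y 1" "z' 1 = w' r * y' 1" by blast
        have r: "norm r \<ge> 1" "2 * integral {0..1} (\<lambda>x. norm (q x)) \<le> norm r" "2 * integral {0..1} (\<lambda>x. norm (q' x)) \<le> norm r" "Re r \<ge> 0"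
          using elim(4) by (auto simp: Q_def)
        have b: "norm (y x) \<le> K * exp (- (Re r * x)) / norm r" "norm (y' x) \<le> K' * exp (- (Re r * x)) / norm r"
          using elim(2,3) s x by blast+
        define M where "M = y 0"
        \<comment> \<open>Both Weyl solutions carry the same coefficient \<open>M\<close>, so in the
          cross product the terms with \<open>M\<close> cancel and \<open>E\<close> can be written
          with decaying factors.\<close>
        have "y x = M * ivp_val q 1 (-h) (-(r^2)) x + 1 * ivp_val q 0 1 (-(r^2)) x"
          using sol_unique[OF q s(1) sol_lincomb[OF ex(1)[of "-(r^2)" 1 "-h"] ex(1)[of "-(r^2)" 0 1], of M 1] _ _ x] s(4)
          by (simp add: ex(2,3) M_def algebra_simps)
        moreover have "y' x = M * ivp_val q' 1 (-h') (-(r^2)) x + 1 * ivp_val q' 0 1 (-(r^2)) x"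
          using sol_unique[OF q' s(2) sol_lincomb[OF ex'(1)[of "-(r^2)" 1 "-h'"] ex'(1)[of "-(r^2)" 0 1], of M 1] _ _ x] s(3,5)
          by (simp add: ex'(2,3) M_def algebra_simps)
        ultimately have "E x (-(r^2)) = y x * ivp_val q' 1 (-h') (-(r^2)) x - y' x * ivp_val q 1 (-h) (-(r^2)) x"
          by (simp add: E_def algebra_simps)
        then have "norm (E x (-(r^2))) \<le> norm (y x) * norm (ivp_val q' 1 (-h') (-(r^2)) x) + norm (y' x) * norm (ivp_val q 1 (-h) (-(r^2)) x)"
          by (metis norm_mult norm_triangle_ineq4)
        also have "\<dots> \<le> (K * exp (- (Re r * x)) / norm r) * (2 * (1 + norm h') * exp (Re r * x))
             + (K' * exp (- (Re r * x)) / norm r) * (2 * (1 + norm h) * exp (Re r * x))"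
          using phi_bound(1)[OF q r(1,2,4) x, of "-h"] phi_bound(1)[OF q' r(1,3,4) x, of "-h'"] b
            order_trans[OF norm_ge_zero b(1)] order_trans[OF norm_ge_zero b(2)]
          by (intro add_mono mult_mono) auto
        also have "\<dots> = (K * (2 * (1 + norm h')) + K' * (2 * (1 + norm h))) / norm r * (exp (- (Re r * x)) * exp (Re r * x))"
          by (simp add: algebra_simps add_divide_distrib)
        finally show ?case by (simp flip: exp_add)
      qed
      then show ?thesis using that unfolding eventually_at_sector by blast
    qed
    define B where "B = 2 * (2 * (1 + norm h')) + 2 * (2 * (1 + norm h))"
    define R0 where "R0 = (max R1 (max 1 Q))\<^sup>2"
    \<comment> \<open>The principal root supplies the representative with nonnegative real
      part.\<close>
    have root: "r = csqrt (- l) \<Longrightarrow> -(r^2) = l \<and> norm r = sqrt (norm l) \<and> Re r \<ge> 0" for r l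
      using Re_csqrt[of "- l"] by (simp add: norm_csqrt)
    have big: "max R1 (max 1 Q) \<le> sqrt (norm l)" if "norm l \<ge> R0" for l :: complex
      by (rule real_le_rsqrt) (use that in \<open>simp add: R0_def\<close>)
    show ?thesis
    proof (rule entire_zero_of_decay[of "E x" R0 B 2 "K * (2 * (1 + norm h')) + K' * (2 * (1 + norm h))"])
      show "E x holomorphic_on UNIV"
        unfolding E_def by (intro holomorphic_intros sol_entire q q' x)
      fix l :: complex assume l: "norm l \<ge> R0"
      define r where "r = csqrt (- l)"
      note rt = root[OF r_def]
      have r: "norm r \<ge> R1" "norm r \<ge> 1" "2 * integral {0..1} (\<lambda>x. norm (q x)) \<le> norm r" "2 * integral {0..1} (\<lambda>x. norm (q' x)) \<le> norm r" "Re r \<ge> 0"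
        using big[OF l] rt by (auto simp: Q_def)
      have ex': "exp (Re r * x) \<le> exp (norm r)"
      proof -
        have "Re r * x \<le> Re r * 1" using r x by (intro mult_left_mono) auto
        also have "\<dots> \<le> norm r" using complex_Re_le_cmod[of r] by simp
        finally show ?thesis by simp
      qed
      have "norm (E x (-(r^2))) \<le> norm (ivp_val q 0 1 (-(r^2)) x) * norm (ivp_val q' 1 (-h') (-(r^2)) x) + norm (ivp_val q' 0 1 (-(r^2)) x) * norm (ivp_val q 1 (-h) (-(r^2)) x)"
        unfolding E_def by (rule order_trans[OF norm_triangle_ineq4]) (simp add: norm_mult)
      also have "\<dots> \<le> (2 * exp (norm r)) * (2 * (1 + norm h') * exp (norm r)) + (2 * exp (norm r)) * (2 * (1 + norm h) * exp (norm r))"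
      proof -
        have le: "u \<le> c * exp (norm r)" if "u \<le> c * exp (Re r * x)" "c \<ge> 0" for u c
          using order_trans[OF that(1) mult_left_mono[OF ex' that(2)]] .
        have "norm (ivp_val q 0 1 (-(r^2)) x) \<le> 2 * exp (norm r)" "norm (ivp_val q' 0 1 (-(r^2)) x) \<le> 2 * exp (norm r)"
          using le[OF phi_bound(2)[OF q r(2,3,5) x]] le[OF phi_bound(2)[OF q' r(2,4,5) x]] by simp_all
        moreover have "norm (ivp_val q 1 (-h) (-(r^2)) x) \<le> 2 * (1 + norm h) * exp (norm r)"
          using le[OF phi_bound(1)[OF q r(2,3,5) x, of "-h"]] by simp
        moreover have "norm (ivp_val q' 1 (-h') (-(r^2)) x) \<le> 2 * (1 + norm h') * exp (norm r)"
          using le[OF phi_bound(1)[OF q' r(2,4,5) x, of "-h'"]] by simp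
        ultimately show ?thesis by (intro add_mono mult_mono) auto
      qed
      also have "\<dots> = B * exp (2 * norm r)"
      proof -
        have "exp (2 * norm r) = exp (norm r) * exp (norm r)" by (simp flip: exp_add)
        then show ?thesis by (simp add: B_def algebra_simps)
      qed
      finally show "norm (E x l) \<le> B * exp (2 * sqrt (norm l))" using rt by simp
      \<comment> \<open>\<open>Re l \<le> 0\<close> says that \<open>r^2\<close> has nonnegative
        real part, which puts \<open>r\<close> in the sector.\<close>
      assume "Re l \<le> 0"
      then have "(Re r)\<^sup>2 - (Im r)\<^sup>2 \<ge> 0"
        using rt by (metis Re_power2 minus_minus minus_complex.sel(1) neg_0_le_iff_le uminus_complex.sel(1))
      then have "\<bar>Im r\<bar> \<le> Re r" using r(5) by (simp add: abs_le_square_iff[symmetric])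
      from R1[OF r(1) this] show "norm (E x l) \<le> (K * (2 * (1 + norm h')) + K' * (2 * (1 + norm h))) / sqrt (norm l)"
        using rt by simp
    qed
  qed
  \<comment> \<open>One value of the spectral parameter suffices from here on; it is chosen so that
    division by the solution is possible on the whole edge.\<close>
  obtain R where R: "\<forall>r\<ge>R. \<forall>x\<in>{0..1}. ivp_val q 1 (-h) (-(of_real r^2)) x \<noteq> 0"
    using phi_nonzero[OF q] by blast
  define lam where "lam = -((complex_of_real R)^2)"
  define f g S T where "f = ivp_val q 1 (-h) lam" and "g = ivp_der q 1 (-h) lam" and "S = ivp_val q 0 1 lam" and "T = ivp_der q 0 1 lam"
  define f' g' S' T' where "f' = ivp_val q' 1 (-h') lam" and "g' = ivp_der q' 1 (-h') lam" and "S' = ivp_val q' 0 1 lam" and "T' = ivp_der q' 0 1 lam"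
  have fnz: "f x \<noteq> 0" if "x \<in> {0..1}" for x using R that by (simp add: f_def lam_def)
  have s: "edge_sol q lam f g" "edge_sol q lam S T" "edge_sol q' lam f' g'" "edge_sol q' lam S' T'"
    unfolding f_def g_def S_def T_def f'_def g'_def S'_def T'_def by (rule ex ex')+
  have init: "f 0 = 1" "g 0 = -h" "S 0 = 0" "T 0 = 1" "f' 0 = 1" "g' 0 = -h'" "S' 0 = 0" "T' 0 = 1"
    unfolding f_def g_def S_def T_def f'_def g'_def S'_def T'_def by (rule ex ex')+
  have cross: "S x * f' x = S' x * f x" if "x \<in> {0..1}" for x
    using E0[OF that, of lam] by (simp add: E_def f_def f'_def S_def S'_def)
  have cont: "continuous_on {0..1} f" "continuous_on {0..1} g" "continuous_on {0..1} S" "continuous_on {0..1} T"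
     "continuous_on {0..1} f'" "continuous_on {0..1} g'" "continuous_on {0..1} S'" "continuous_on {0..1} T'"
    using s edge_solD(3,4) by blast+
  have edge_wronskian: "f x * T x - g x * S x = 1" "f' x * T' x - g' x * S' x = 1" if "x \<in> {0..1}" for x
    using wronskian_const[OF s(1,2) that] wronskian_const[OF s(3,4) that] init by auto
  have der: "S x * g' x + T x * f' x + (-1) * (S' x * g x + T' x * f x) = 0" if "x \<in> {0..1}" for x
  proof (rule prim_constant_zero[of "\<lambda>x. S x * f' x + (-1) * (S' x * f x)", OF _ _ _ that])
    show "prim (\<lambda>x. S x * f' x + (-1) * (S' x * f x)) (\<lambda>x. S x * g' x + T x * f' x + (-1) * (S' x * g x + T' x * f x))"
      using s by (intro prim_add prim_mult prim_cmult) (auto simp: edge_sol_def)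
    show "continuous_on {0..1} (\<lambda>x. S x * g' x + T x * f' x + (-1) * (S' x * g x + T' x * f x))"
      by (intro continuous_intros cont)
  qed (use cross in simp)
  \<comment> \<open>Eliminates \<open>S\<close> and \<open>S'\<close> from the cross relation, its
    derivative and the two Wronskians, that is, compares the derivatives of \<open>S / f\<close> and
    \<open>S' / f'\<close>.\<close>
  have sq: "(f' x)\<^sup>2 = (f x)\<^sup>2" if x: "x \<in> {0..1}" for x
    using der[OF x] edge_wronskian[OF x] cross[OF x] by algebra
  have ff': "f' x = f x" if x: "x \<in> {0..1}" for x
  proof -
    define k where "k = (\<lambda>x. f' x / f x)"
    have kc: "continuous_on {0..1} k" unfolding k_def by (intro continuous_intros cont) (use fnz in auto)
    have k1: "k t = 1 \<or> k t = -1" if "t \<in> {0..1}" for t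
    proof -
      have "f' t = f t \<or> f' t = - f t" using sq[OF that] by (simp add: power2_eq_iff)
      then show ?thesis using fnz[OF that] by (auto simp: k_def)
    qed
    \<comment> \<open>A continuous function on an interval with values in \<open>{1, -1}\<close> is
      constant, and the initial values select the sign.\<close>
    have "finite (k ` {0..1})" by (rule finite_subset[of _ "{1,-1}"]) (use k1 in blast, simp)
    then have "k constant_on {0..1}"
      by (intro continuous_finite_range_constant[OF _ kc]) auto
    then have "k x = k 0" using x unfolding constant_on_def by force
    then show ?thesis using fnz[OF x] init by (simp add: k_def)
  qed
  have gg': "g' x + (-1) * g x = 0" if x: "x \<in> {0..1}" for x
  proof (rule prim_constant_zero[of "\<lambda>x. f' x + (-1) * f x", OF _ _ _ x])
    show "prim (\<lambda>x. f' x + (-1) * f x) (\<lambda>x. g' x + (-1) * g x)"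
      using s by (intro prim_add prim_cmult) (auto simp: edge_sol_def)
  qed (use ff' cont in \<open>auto intro!: continuous_intros\<close>)
  show "h = h'" using gg'[of 0] init by simp
  have "prim (\<lambda>x. g' x + (-1) * g x) (\<lambda>x. (q' x - lam) * f' x + (-1) * ((q x - lam) * f x))"
    using s by (intro prim_add prim_cmult) (auto simp: edge_sol_def)
  from prim_constant_AE_zero[OF this gg'] obtain N where N: "negligible N"
    "\<And>x. x \<in> {0..1} - N \<Longrightarrow> (q' x - lam) * f' x + (-1) * ((q x - lam) * f x) = 0" by blast
  have "q x = q' x" if x: "x \<in> {0..1} - N" for x
  proof -
    have "(q' x - q x) * f x = 0" using N(2)[OF x] ff'[of x] x by (simp add: algebra_simps)
    then show ?thesis using fnz[of x] x by simp
  qed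
  with N(1) show "\<exists>N. negligible N \<and> (\<forall>x\<in>{0..1} - N. q x = q' x)" by blast
qed

section \<open>Weyl solutions on the tree\<close>

lemma negligible_lborel: "N \<in> null_sets lborel \<Longrightarrow> negligible N"
  by (simp add: negligible_iff_null_sets null_sets_completionI)

lemma AE_lborel_negligible:
  assumes "negligible N" "\<And>x. x \<notin> N \<Longrightarrow> P x"
  shows "AE x in lborel. P x"
proof -
  have "AE x in lebesgue. x \<notin> N" using assms(1) by (intro AE_not_in) (simp add: negligible_iff_null_sets)
  then have "AE x in lebesgue. P x" by eventually_elim (rule assms(2))
  then show ?thesis by (simp add: AE_completion_iff)
qed

lemma abs_cont_on_continuous:
  assumes "abs_cont_on a b F"
  shows "continuous_on {a..b} F"
  unfolding continuous_on_iff
proof (intro ballI allI impI)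
  fix x e :: real assume x: "x \<in> {a..b}" and "e > 0"
  then obtain \<delta> where \<delta>: "\<delta> > 0" and AC\<delta>: "\<And>S. \<lbrakk>nonoverlapping a b S; (\<Sum>(u,v)\<in>S. v - u) < \<delta>\<rbrakk>
      \<Longrightarrow> (\<Sum>(u,v)\<in>S. norm (F v - F u)) < e"
    using assms unfolding abs_cont_on_iff by blast
  have "dist (F y) (F x) < e" if y: "y \<in> {a..b}" "dist y x < \<delta>" for y
  proof (cases "x \<le> y")
    case True
    then show ?thesis using AC\<delta>[of "{(x, y)}"] x y by (auto simp: dist_norm nonoverlapping_def)
  next
    case False
    then show ?thesis using AC\<delta>[of "{(y, x)}"] x y by (auto simp: dist_norm norm_minus_commute nonoverlapping_def)
  qed
  then show "\<exists>d>0. \<forall>y\<in>{a..b}. dist y x < d \<longrightarrow> dist (F y) (F x) < e" using \<delta> by blast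
qed

lemma set_integrable_lborel_abs_int:
  fixes f :: "real \<Rightarrow> complex"
  assumes "set_integrable lborel S f"
  shows "f absolutely_integrable_on S"
  using assms unfolding set_integrable_def
  by (subst integrable_completion) (auto dest: borel_measurable_integrable)

text \<open>The bridge from the given formulation to the integrated one: almost everywhere the
  second derivative \<open>d\<close> is forced to be \<open>(q x - lam) * y x\<close>, which is
  integrable.\<close>

lemma edge_solution_iff_sol:
  assumes q: "L1 q"
  shows "abs_cont_on 0 1 y \<and> abs_cont_on 0 1 z \<and>
        (AE x in lborel. x \<in> {0..1} \<longrightarrow>
           (y has_vector_derivative z x) (at x within {0..1}) \<and>
           (\<exists>d. (z has_vector_derivative d) (at x within {0..1}) \<and> - d + q x * y x = lam * y x))
     \<longleftrightarrow> edge_sol q lam y z" (is "?L \<longleftrightarrow> _")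
proof
  assume L: ?L
  then obtain N where N: "N \<in> null_sets lborel" and der: "\<And>x. x \<in> {0..1} - N \<Longrightarrow>
      (y has_vector_derivative z x) (at x within {0..1}) \<and>
      (\<exists>d. (z has_vector_derivative d) (at x within {0..1}) \<and> - d + q x * y x = lam * y x)"
    by (auto elim!: AE_E3)
  have c: "continuous_on {0..1} y" "continuous_on {0..1} z" using L abs_cont_on_continuous by blast+
  have der': "(z has_vector_derivative (q x - lam) * y x) (at x within {0..1})" if x: "x \<in> {0..1} - N" for x
  proof -
    obtain d where d: "(z has_vector_derivative d) (at x within {0..1})" "- d + q x * y x = lam * y x"
      using der[OF x] by blast
    have "d = (q x - lam) * y x" using d(2) by (simp add: algebra_simps)
    with d(1) show ?thesis by simp
  qed
  show "edge_sol q lam y z"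
    unfolding edge_sol_def
  proof
    show "prim y z"
      by (rule primI_AE[OF _ negligible_lborel[OF N] absolutely_integrable_continuous_real[OF c(2)]]) (use L der in blast)+
    have "(\<lambda>x. (q x - lam) * y x) absolutely_integrable_on {0..1}"
      using c q by (intro abs_int_mult_continuous set_integral_diff) auto
    then show "prim z (\<lambda>x. (q x - lam) * y x)"
      using primI_AE[OF _ negligible_lborel[OF N] _ der'] L by blast
  qed
next
  assume s: "edge_sol q lam y z"
  obtain N where N: "negligible N" "\<And>x. x \<in> {0..1} - N \<Longrightarrow> (z has_vector_derivative (q x - lam) * y x) (at x within {0..1})"
    using prim_has_derivative_AE[OF edge_solD(2)[OF s]] by blast
  show ?L
  proof (intro conjI)
    show "abs_cont_on 0 1 y" "abs_cont_on 0 1 z" using prim_abs_cont edge_solD[OF s] by blast+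
    show "AE x in lborel. x \<in> {0..1} \<longrightarrow>
           (y has_vector_derivative z x) (at x within {0..1}) \<and>
           (\<exists>d. (z has_vector_derivative d) (at x within {0..1}) \<and> - d + q x * y x = lam * y x)"
    proof (rule AE_lborel_negligible[OF N(1)], intro impI conjI)
      fix x assume x: "x \<notin> N" "x \<in> {0..1}"
      show "(y has_vector_derivative z x) (at x within {0..1})"
        by (rule prim_has_vector_derivative[OF edge_solD(1)[OF s] edge_solD(4)[OF s] x(2)])
      show "\<exists>d. (z has_vector_derivative d) (at x within {0..1}) \<and> - d + q x * y x = lam * y x"
        using N(2)[of x] x by (intro exI[of _ "(q x - lam) * y x"]) (auto simp: algebra_simps)
    qed
  qed
qed

lemma sl_solution_iff_sol:
  assumes q: "\<And>j. j \<in> {1..r} \<Longrightarrow> L1 (q j)"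
  shows "sl_solution r q lam Y Y' \<longleftrightarrow> (\<forall>j\<in>{1..r}. edge_sol (q j) lam (Y j) (Y' j))"
  unfolding sl_solution_def using edge_solution_iff_sol[OF q] by simp

lemma sol_end_values:
  assumes q: "L1 q" and s: "edge_sol q l y z"
  shows "y 1 = ivp_val q 1 0 l 1 * y 0 + ivp_val q 0 1 l 1 * z 0"
    "z 1 = ivp_der q 1 0 l 1 * y 0 + ivp_der q 0 1 l 1 * z 0"
  using sol_unique[OF q s sol_lincomb[OF sol_exists(1)[OF q, of l 1 0] sol_exists(1)[OF q, of l 0 1], of "y 0" "z 0"], of 1]
  by (simp_all add: sol_exists(2,3)[OF q] mult.commute)

lemma end_wronskian:
  assumes q: "L1 q"
  shows "ivp_val q 1 0 l 1 * ivp_der q 0 1 l 1 - ivp_der q 1 0 l 1 * ivp_val q 0 1 l 1 = 1"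
  using wronskian_const[OF sol_exists(1)[OF q, of l 1 0] sol_exists(1)[OF q, of l 0 1], of 1]
  by (simp add: sol_exists(2,3)[OF q])

text \<open>Once an edge is recovered almost everywhere, its transfer matrix is known for every
  \<open>l\<close>.\<close>

lemma end_values_cong_AE:
  assumes q: "L1 q" "L1 q'"
    and N: "negligible N" "\<And>x. x \<in> {0..1} - N \<Longrightarrow> q x = q' x"
  shows "ivp_val q A B l 1 = ivp_val q' A B l 1" "ivp_der q A B l 1 = ivp_der q' A B l 1"
  using sol_unique[OF q(2) sol_cong_AE[OF N sol_exists(1)[OF q(1), of l A B] q(2)] sol_exists(1)[OF q(2), of l A B], of 1]
  by (auto simp: sol_exists(2,3)[OF q(1)] sol_exists(2,3)[OF q(2)])

section \<open>Combinatorics of the tree\<close>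

locale sl_tree =
  fixes p r :: nat and init :: "nat \<Rightarrow> nat" and a a1 a0 :: "nat \<Rightarrow> nat \<Rightarrow> complex"
  assumes tree: "tree_ok p r init" and coeffs: "matching_coeffs_ok p r init a a1"
begin

abbreviation "R \<equiv> R_edges r init"

lemma init_internal: "j \<in> {1..r} \<Longrightarrow> j \<noteq> p + 1 \<Longrightarrow> init j \<in> {p+1..r}"
  using tree unfolding tree_ok_def by fastforce

lemma init_root: "init (p + 1) = 0" "p + 1 \<in> {1..r}"
  using tree unfolding tree_ok_def by auto

lemma init_less: "j \<in> {p+1..r} \<Longrightarrow> init j < j"
  using tree unfolding tree_ok_def by blast

lemma internal_child: "k \<in> {p+1..r} \<Longrightarrow> \<exists>j. j \<in> R k"
  using tree unfolding tree_ok_def R_edges_def by blast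

lemma RD:
  assumes "j \<in> R k"
  shows "j \<in> {1..r}" "init j = k"
  using assms by (auto simp: R_edges_def)

lemma R_internal:
  assumes "j \<in> R k" "k \<in> {p+1..r}"
  shows "j \<noteq> p + 1" "j \<le> p \<or> k < j" "a k j \<noteq> 0" "a1 k j \<noteq> 0"
proof -
  show "j \<noteq> p + 1" using RD[OF assms(1)] init_root assms(2) by auto
  show "j \<le> p \<or> k < j" using RD[OF assms(1)] init_less[of j] by fastforce
  show "a k j \<noteq> 0" "a1 k j \<noteq> 0" using coeffs assms unfolding matching_coeffs_ok_def by auto
qed

lemma R_parent: "j \<in> {1..r} \<Longrightarrow> j \<in> R (init j)"
  by (simp add: R_edges_def)

lemma finite_R [simp]: "finite (R k)" by (simp add: R_edges_def)

text \<open>Induction from the boundary edges towards the root. Boundary edges have the smallest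
  indices although they lie at the far ends; among the others indices increase away from the root,
  hence the case distinction in the measure.\<close>

lemma induct_up [consumes 1, case_names edge]:
  assumes k: "k \<in> {1..r}"
    and step: "\<And>k. k \<in> {1..r} \<Longrightarrow> (\<And>j. k \<in> {p+1..r} \<Longrightarrow> j \<in> R k \<Longrightarrow> P j) \<Longrightarrow> P k"
  shows "P k"
  using k
proof (induction k rule: measure_induct_rule[of "\<lambda>k. if k \<le> p then 0 else Suc r - k"])
  case (less k)
  show ?case
  proof (rule step[OF less.prems])
    fix j assume k: "k \<in> {p+1..r}" and j: "j \<in> R k"
    show "P j" by (rule less.IH) (use k R_internal[OF j k] RD[OF j] in auto)
  qed
qed

text \<open>Induction from the root edge outwards; boundary edges are ranked last.\<close>

lemma induct_down [consumes 1, case_names edge]: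
  assumes k: "k \<in> {1..r}"
    and step: "\<And>j. j \<in> {1..r} \<Longrightarrow> (j \<noteq> p + 1 \<Longrightarrow> P (init j)) \<Longrightarrow> P j"
  shows "P k"
  using k
proof (induction k rule: measure_induct_rule[of "\<lambda>k. if k \<le> p then Suc r else k"])
  case (less k)
  show ?case
  proof (rule step[OF less.prems])
    assume k: "k \<noteq> p + 1"
    note i = init_internal[OF less.prems k]
    show "P (init k)" by (rule less.IH) (use i init_less[of k] less.prems in auto)
  qed
qed

text \<open>Initial values \<open>(y, y')(0)\<close> are \<open>(1, 0)\<close> or \<open>(0, 1)\<close>; the four numbers are the entries of the
  transfer matrix of the edge \<open>j\<close>.

  \<open>lower0\<close> and \<open>lower1\<close> are the logarithmic derivatives \<open>Y' / Y\<close> on the edge \<open>j\<close> at \<open>x = 0\<close> and \<open>x = 1\<close>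
  of a solution satisfying all homogeneous conditions below \<open>j\<close>; \<open>upper0\<close> and \<open>upper1\<close> are the same
  quantities for a solution satisfying all homogeneous conditions in the rest of the tree. The guards in
  the recursions only serve termination and are vacuous on the tree.\<close>

abbreviation "val10 q l j \<equiv> ivp_val (q j) 1 0 l 1" for q :: "nat \<Rightarrow> real \<Rightarrow> complex"
abbreviation "val01 q l j \<equiv> ivp_val (q j) 0 1 l 1" for q :: "nat \<Rightarrow> real \<Rightarrow> complex"
abbreviation "der10 q l j \<equiv> ivp_der (q j) 1 0 l 1" for q :: "nat \<Rightarrow> real \<Rightarrow> complex"
abbreviation "der01 q l j \<equiv> ivp_der (q j) 0 1 l 1" for q :: "nat \<Rightarrow> real \<Rightarrow> complex"

function lower0 :: "(nat \<Rightarrow> real \<Rightarrow> complex) \<Rightarrow> (nat \<Rightarrow> complex) \<Rightarrow> complex \<Rightarrow> nat \<Rightarrow> complex" where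
  "lower0 q h l k = (if k \<le> p then - h k else
     (\<Sum>j\<in>{j \<in> R k. j \<le> p \<or> k < j}.
        (a1 k j * ((der10 q l j + lower0 q h l j * der01 q l j) / (val10 q l j + lower0 q h l j * val01 q l j)) + a0 k j) / a k j))"
  by pat_completeness auto
termination
  by (relation "Wellfounded.measure (\<lambda>(q,h,l,k). if k \<le> p then 0 else Suc (r - k))") (auto simp: R_edges_def)

declare lower0.simps [simp del]

definition lower1 :: "(nat \<Rightarrow> real \<Rightarrow> complex) \<Rightarrow> (nat \<Rightarrow> complex) \<Rightarrow> complex \<Rightarrow> nat \<Rightarrow> complex" where
  "lower1 q h l j = (der10 q l j + lower0 q h l j * der01 q l j) / (val10 q l j + lower0 q h l j * val01 q l j)"

lemma lower0_leaf: "k \<le> p \<Longrightarrow> lower0 q h l k = - h k"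
  by (simp add: lower0.simps)

lemma lower0_internal:
  assumes "k \<in> {p+1..r}"
  shows "lower0 q h l k = (\<Sum>j\<in>R k. (a1 k j * lower1 q h l j + a0 k j) / a k j)"
proof -
  have "{j \<in> R k. j \<le> p \<or> k < j} = R k" using R_internal(2)[OF _ assms] by blast
  then show ?thesis using assms by (subst lower0.simps) (simp add: lower1_def)
qed

function upper1 :: "(nat \<Rightarrow> real \<Rightarrow> complex) \<Rightarrow> (nat \<Rightarrow> complex) \<Rightarrow> complex \<Rightarrow> nat \<Rightarrow> complex" where
  "upper1 q h l j = (if j = p + 1 then - h 0 else if p < init j \<and> init j \<le> r \<and> (j \<le> p \<or> init j < j) then
     (a (init j) j / a1 (init j) j) *
       ((upper1 q h l (init j) * val10 q l (init j) - der10 q l (init j)) / (der01 q l (init j) - upper1 q h l (init j) * val01 q l (init j))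
         - lower0 q h l (init j)) + lower1 q h l j else 0)"
  by pat_completeness auto
termination
  by (relation "Wellfounded.measure (\<lambda>(q,h,l,k). if k \<le> p then Suc r else k)") auto

declare upper1.simps [simp del]

definition upper0 :: "(nat \<Rightarrow> real \<Rightarrow> complex) \<Rightarrow> (nat \<Rightarrow> complex) \<Rightarrow> complex \<Rightarrow> nat \<Rightarrow> complex" where
  "upper0 q h l j = (upper1 q h l j * val10 q l j - der10 q l j) / (der01 q l j - upper1 q h l j * val01 q l j)"

lemma upper1_root: "upper1 q h l (p + 1) = - h 0"
  by (simp add: upper1.simps)

text \<open>The matching sum at \<open>k\<close> with branch \<open>j\<close> upper and the one with
  all branches lower differ only in the term of \<open>j\<close>; continuity
  \<open>Y k 0 = a k j * Y j 1\<close> produces the factor.\<close>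

lemma upper1_child:
  assumes "j \<in> R k" "k \<in> {p+1..r}"
  shows "upper1 q h l j = (a k j / a1 k j) * (upper0 q h l k - lower0 q h l k) + lower1 q h l j"
  using R_internal[OF assms] RD[OF assms(1)] assms(2)
  by (subst upper1.simps) (auto simp: upper0_def)

inductive onpath :: "nat \<Rightarrow> nat \<Rightarrow> bool" for k where
  onpath_refl: "onpath k k"
| onpath_step: "onpath k j \<Longrightarrow> j \<in> {1..r} \<Longrightarrow> onpath k (init j)"

lemma onpath_front: "onpath i j \<Longrightarrow> i = j \<or> (i \<in> {1..r} \<and> onpath (init i) j)"
  by (induction rule: onpath.induct) (auto intro: onpath.intros)

lemma onpath_trans: "onpath j k \<Longrightarrow> onpath i j \<Longrightarrow> onpath i k"
  by (induction rule: onpath.induct) (auto intro: onpath.intros)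

lemma onpath_linear: "onpath k i \<Longrightarrow> onpath k j \<Longrightarrow> onpath i j \<or> onpath j i"
proof (induction rule: onpath.induct)
  case (onpath_step i)
  then show ?case using onpath_front[of i j] by (auto intro: onpath.intros)
qed auto

lemma onpath_le: "onpath x j \<Longrightarrow> x = 0 \<or> p < x \<Longrightarrow> (j = 0 \<or> p < j) \<and> j \<le> x"
proof (induction rule: onpath.induct)
  case (onpath_step j)
  then have j: "j \<in> {p+1..r}" "j \<le> x" by auto
  then show ?case using init_less[of j] init_internal[of j] init_root by (cases "j = p + 1") auto
qed auto

text \<open>Otherwise a vertex would have one of its own children as an ancestor, although indices
  decrease towards the root.\<close>

lemma onpath_unique_aux:
  assumes "onpath i j" "i \<in> {1..r}" "j \<in> {1..r}" "init i = init j"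
  shows "i = j"
proof (rule ccontr)
  assume "i \<noteq> j"
  then have "onpath (init j) j" using onpath_front[OF assms(1)] assms(4) by auto
  moreover have "init j = 0 \<or> p < init j" using init_internal[OF assms(3)] init_root by (cases "j = p + 1") auto
  ultimately have "(j = 0 \<or> p < j) \<and> j \<le> init j" by (rule onpath_le)
  then show False using init_less[of j] assms(3) by auto
qed

text \<open>The path from the source enters each vertex through a single child, so all other
  branches there are free of the source.\<close>

lemma onpath_unique:
  assumes "onpath k i" "onpath k j" "i \<in> {1..r}" "j \<in> {1..r}" "init i = init j"
  shows "i = j"
  using onpath_linear[OF assms(1,2)] onpath_unique_aux assms(3-5) by metis

lemma onpath_leaf: "onpath k j \<Longrightarrow> j \<in> {1..p} \<Longrightarrow> j = k"
proof (induction rule: onpath.cases)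
  case (onpath_step i)
  then show ?case using init_internal[of i] init_root by (cases "i = p + 1") auto
qed auto

lemma onpath_child:
  assumes "onpath k v" "v \<noteq> k"
  shows "\<exists>j\<in>R v. onpath k j"
  using assms(1)
proof cases
  case (onpath_step j)
  then show ?thesis by (auto simp: R_edges_def)
qed (use assms in auto)

lemma onpath_root: "j \<in> {1..r} \<Longrightarrow> onpath j (p + 1)"
proof (induction j rule: induct_down)
  case (edge j)
  then show ?case
    using onpath_step[OF onpath_refl, of j] onpath_trans[of "init j" "p + 1" j]
    by (cases "j = p + 1") (auto intro: onpath_refl)
qed

text \<open>Arbitrary boundary data \<open>g\<close> are allowed so that differences of Weyl
  solutions are covered by \<open>g = 0\<close>.\<close>

definition wsol :: "(nat \<Rightarrow> real \<Rightarrow> complex) \<Rightarrow> (nat \<Rightarrow> complex) \<Rightarrow> complex \<Rightarrow> (nat \<Rightarrow> complex) \<Rightarrow>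
    (nat \<Rightarrow> real \<Rightarrow> complex) \<Rightarrow> (nat \<Rightarrow> real \<Rightarrow> complex) \<Rightarrow> bool" where
  "wsol q h l g Y Y' \<longleftrightarrow> (\<forall>j\<in>{1..r}. edge_sol (q j) l (Y j) (Y' j)) \<and> matching p r init a a1 a0 Y Y' \<and>
     Y' (p+1) 1 + h 0 * Y (p+1) 1 = g 0 \<and> (\<forall>j\<in>{1..p}. Y' j 0 + h j * Y j 0 = g j)"

lemma matchingD:
  assumes "matching p r init a a1 a0 Y Y'" "k \<in> {p+1..r}"
  shows "\<And>j. j \<in> R k \<Longrightarrow> Y j 1 = Y k 0 / a k j" "\<And>j. j \<in> R k \<Longrightarrow> Y k 0 = a k j * Y j 1"
    "Y' k 0 = (\<Sum>j\<in>R k. a1 k j * Y' j 1 + a0 k j * Y j 1)"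
  using assms R_internal(3)[OF _ assms(2)] unfolding matching_def by (auto simp: field_simps)

end

section \<open>Asymptotics of the lower and upper solutions\<close>

locale sl_problem = sl_tree +
  fixes q :: "nat \<Rightarrow> real \<Rightarrow> complex" and h :: "nat \<Rightarrow> complex"
  assumes q: "\<And>j. j \<in> {1..r} \<Longrightarrow> L1 (q j)"
begin

text \<open>Nonvanishing of the denominators met when the tree is solved edge by edge: a sufficient
  condition for unique Weyl solutions that avoids the characteristic determinant.
  \<open>upper0 q h l j \<noteq> 0\<close> lets an internal edge be treated with boundary
  coefficient 0.\<close>

definition regular :: "complex \<Rightarrow> bool" where
  "regular l \<longleftrightarrow> (\<forall>j\<in>{1..r}. val10 q l j + lower0 q h l j * val01 q l j \<noteq> 0 \<and> der01 q l j - upper1 q h l j * val01 q l j \<noteq> 0 \<and> upper0 q h l j \<noteq> 0)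
     \<and> lower1 q h l (p + 1) + h 0 \<noteq> 0 \<and> (\<forall>k\<in>{1..p}. upper0 q h l k + h k \<noteq> 0)"

lemma end_values:
  assumes "j \<in> {1..r}" "edge_sol (q j) l y z"
  shows "y 1 = val10 q l j * y 0 + val01 q l j * z 0" "z 1 = der10 q l j * y 0 + der01 q l j * z 0"
  using sol_end_values[OF q assms(2)] assms(1) by auto

lemma edge_wronskian: "j \<in> {1..r} \<Longrightarrow> val10 q l j * der01 q l j - der10 q l j * val01 q l j = 1"
  using end_wronskian[OF q] by blast

text \<open>The limit of \<open>lower0 / s\<close>.\<close>

definition \<sigma> :: "nat \<Rightarrow> complex" where
  "\<sigma> k = (if k \<le> p then 0 else \<Sum>j\<in>R k. a1 k j / a k j)"

text \<open>The single place where the regularity condition on the matching coefficients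
  enters.\<close>

lemma \<sigma>_neq: "k \<in> {1..r} \<Longrightarrow> \<sigma> k \<noteq> -1"
  using coeffs unfolding \<sigma>_def matching_coeffs_ok_def by auto

lemma end_limits:
  assumes "j \<in> {1..r}"
  shows "((\<lambda>s. 2 * exp (-s) * val10 q (-(s^2)) j) \<longlongrightarrow> 1) at_sector"
    "((\<lambda>s. 2 * exp (-s) * der10 q (-(s^2)) j / s) \<longlongrightarrow> 1) at_sector"
    "((\<lambda>s. 2 * s * exp (-s) * val01 q (-(s^2)) j) \<longlongrightarrow> 1) at_sector"
    "((\<lambda>s. 2 * exp (-s) * der01 q (-(s^2)) j) \<longlongrightarrow> 1) at_sector"
  using tendsto_end[OF q[OF assms]] by blast+

lemma eventually_sector_nonzero: "eventually (\<lambda>s. s \<noteq> 0) at_sector"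
  using eventually_sector_large[of 1] by eventually_elim auto

lemma const_over: "((\<lambda>s. c / s) \<longlongrightarrow> 0) at_sector"
proof (rule tendsto_sector_norm_bound)
  show "((\<lambda>x. norm c / x) \<longlongrightarrow> 0) at_top" by real_asymp
qed (simp add: norm_divide)

text \<open>To leading order the bracket is \<open>cosh s + \<sigma> j * sinh s\<close>, so
  \<open>1 + \<sigma> j\<close> is the coefficient of the growing exponential.\<close>

lemma lower_den_limit:
  assumes j: "j \<in> {1..r}" and lolim: "((\<lambda>s. lower0 q h (-(s^2)) j / s) \<longlongrightarrow> \<sigma> j) at_sector"
  shows "((\<lambda>s. 2 * exp (-s) * (val10 q (-(s^2)) j + lower0 q h (-(s^2)) j * val01 q (-(s^2)) j)) \<longlongrightarrow> 1 + \<sigma> j) at_sector"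
proof -
  let ?f = "\<lambda>s. 2 * exp (-s) * val10 q (-(s^2)) j + (lower0 q h (-(s^2)) j / s) * (2 * s * exp (-s) * val01 q (-(s^2)) j)"
  have "(?f \<longlongrightarrow> 1 + \<sigma> j * 1) at_sector"
    by (intro tendsto_add tendsto_mult end_limits[OF j] lolim)
  then have "(?f \<longlongrightarrow> 1 + \<sigma> j) at_sector" by simp
  then show ?thesis
    by (rule Lim_transform_eventually) (use eventually_sector_nonzero in eventually_elim, simp add: field_simps)
qed

text \<open>Numerator and denominator have the same limit \<open>1 + \<sigma> j\<close>: after one
  edge the growing exponential dominates, whatever the slope at \<open>x = 0\<close>.\<close>

lemma lower1_limit:
  assumes j: "j \<in> {1..r}" and lolim: "((\<lambda>s. lower0 q h (-(s^2)) j / s) \<longlongrightarrow> \<sigma> j) at_sector"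
  shows "((\<lambda>s. lower1 q h (-(s^2)) j / s) \<longlongrightarrow> 1) at_sector"
proof -
  have s: "1 + \<sigma> j \<noteq> 0" using \<sigma>_neq[OF j] by (simp add: add_eq_0_iff)
  let ?f = "\<lambda>s. (2 * exp (-s) * der10 q (-(s^2)) j / s + (lower0 q h (-(s^2)) j / s) * (2 * exp (-s) * der01 q (-(s^2)) j)) /
     (2 * exp (-s) * (val10 q (-(s^2)) j + lower0 q h (-(s^2)) j * val01 q (-(s^2)) j))"
  have "(?f \<longlongrightarrow> (1 + \<sigma> j * 1) / (1 + \<sigma> j)) at_sector"
    by (intro tendsto_divide tendsto_add tendsto_mult end_limits[OF j] lolim lower_den_limit[OF j lolim] s)
  then have "(?f \<longlongrightarrow> 1) at_sector" using s by simp
  then show ?thesis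
  proof (rule Lim_transform_eventually)
    have eq: "(2 * exp (-s) * x / s + (m / s) * (2 * exp (-s) * y)) / (2 * exp (-s) * d) = (x + m * y) / d / s"
      if "s \<noteq> 0" for s x m y d :: complex
    proof -
      have "2 * exp (-s) * x / s + (m / s) * (2 * exp (-s) * y) = (2 * exp (-s)) * ((x + m * y) / s)"
        by (simp add: add_divide_distrib algebra_simps)
      then show ?thesis by (simp add: mult_divide_mult_cancel_left)
    qed
    show "\<forall>\<^sub>F s in at_sector. ?f s = lower1 q h (-(s^2)) j / s"
      using eventually_sector_nonzero
    proof eventually_elim
      case (elim s)
      show ?case unfolding lower1_def by (rule eq[OF elim])
    qed
  qed
qed

lemma lower0_limit: "k \<in> {1..r} \<Longrightarrow> ((\<lambda>s. lower0 q h (-(s^2)) k / s) \<longlongrightarrow> \<sigma> k) at_sector"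
proof (induction k rule: induct_up)
  case (edge k)
  show ?case
  proof (cases "k \<le> p")
    case True
    then show ?thesis using const_over[of "- h k"] by (simp add: lower0_leaf \<sigma>_def)
  next
    case False
    then have k: "k \<in> {p+1..r}" using edge.hyps by auto
    have "((\<lambda>s. \<Sum>j\<in>R k. (a1 k j * (lower1 q h (-(s^2)) j / s) + a0 k j / s) / a k j) \<longlongrightarrow> (\<Sum>j\<in>R k. (a1 k j * 1 + 0) / a k j)) at_sector"
      by (intro tendsto_sum tendsto_divide tendsto_add tendsto_mult tendsto_const const_over lower1_limit edge.IH[OF k] R_internal(3)[OF _ k] RD(1))
    moreover have "lower0 q h (-(s^2)) k / s = (\<Sum>j\<in>R k. (a1 k j * (lower1 q h (-(s^2)) j / s) + a0 k j / s) / a k j)" for s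
      unfolding lower0_internal[OF k] by (simp add: sum_divide_distrib add_divide_distrib mult.commute)
    ultimately show ?thesis using False by (simp add: \<sigma>_def)
  qed
qed

text \<open>Numerator and denominator have the opposite limits \<open>\<omega> - 1\<close> and
  \<open>1 - \<omega>\<close>, so the slope at \<open>x = 0\<close> is that of the decaying
  exponential unless the condition at \<open>x = 1\<close> selects the growing one,
  \<open>\<omega> = 1\<close>.\<close>

lemma upper0_limits:
  assumes j: "j \<in> {1..r}" and w: "((\<lambda>s. upper1 q h (-(s^2)) j / s) \<longlongrightarrow> \<omega>) at_sector" "\<omega> \<noteq> 1"
  shows "((\<lambda>s. upper0 q h (-(s^2)) j / s) \<longlongrightarrow> -1) at_sector"
    "eventually (\<lambda>s. der01 q (-(s^2)) j - upper1 q h (-(s^2)) j * val01 q (-(s^2)) j \<noteq> 0) at_sector"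
proof -
  define D where "D = (\<lambda>s. 2 * exp (-s) * der01 q (-(s^2)) j - (upper1 q h (-(s^2)) j / s) * (2 * s * exp (-s) * val01 q (-(s^2)) j))"
  define M where "M = (\<lambda>s. (upper1 q h (-(s^2)) j / s) * (2 * exp (-s) * val10 q (-(s^2)) j) - 2 * exp (-s) * der10 q (-(s^2)) j / s)"
  have D: "(D \<longlongrightarrow> 1 - \<omega> * 1) at_sector" unfolding D_def by (intro tendsto_diff tendsto_mult end_limits[OF j] w)
  have M: "(M \<longlongrightarrow> \<omega> * 1 - 1) at_sector" unfolding M_def by (intro tendsto_diff tendsto_mult end_limits[OF j] w)
  have Deq: "D s = 2 * exp (-s) * (der01 q (-(s^2)) j - upper1 q h (-(s^2)) j * val01 q (-(s^2)) j)" if "s \<noteq> 0" for s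
    using that by (simp add: D_def field_simps)
  have Meq: "M s = 2 * exp (-s) * ((upper1 q h (-(s^2)) j * val10 q (-(s^2)) j - der10 q (-(s^2)) j) / s)" if "s \<noteq> 0" for s
    using that by (simp add: M_def field_simps)
  have "eventually (\<lambda>s. D s \<noteq> 0) at_sector"
    using tendsto_imp_eventually_ne[OF D, of 0] w(2) by simp
  then show "eventually (\<lambda>s. der01 q (-(s^2)) j - upper1 q h (-(s^2)) j * val01 q (-(s^2)) j \<noteq> 0) at_sector"
    using eventually_sector_nonzero by eventually_elim (auto simp: Deq)
  have "((\<lambda>s. M s / D s) \<longlongrightarrow> (\<omega> * 1 - 1) / (1 - \<omega> * 1)) at_sector"
    by (intro tendsto_divide M D) (use w(2) in auto)
  moreover have "(\<omega> * 1 - 1) / (1 - \<omega> * 1) = -1" using w(2) by (simp add: field_simps)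
  ultimately have "((\<lambda>s. M s / D s) \<longlongrightarrow> -1) at_sector" by simp
  then show "((\<lambda>s. upper0 q h (-(s^2)) j / s) \<longlongrightarrow> -1) at_sector"
  proof (rule Lim_transform_eventually)
    show "\<forall>\<^sub>F s in at_sector. M s / D s = upper0 q h (-(s^2)) j / s"
      using eventually_sector_nonzero
    proof eventually_elim
      case (elim s)
      have "M s / D s = ((upper1 q h (-(s^2)) j * val10 q (-(s^2)) j - der10 q (-(s^2)) j) / s) / (der01 q (-(s^2)) j - upper1 q h (-(s^2)) j * val01 q (-(s^2)) j)"
        unfolding Deq[OF elim] Meq[OF elim] by (rule mult_divide_mult_cancel_left) simp
      then show ?case by (simp add: upper0_def mult.commute)
    qed
  qed
qed

text \<open>The root gives 0, and passing a vertex \<open>v\<close> gives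
  \<open>1 - (a v j / a1 v j) * (1 + \<sigma> v)\<close>, which differs from the forbidden value 1
  exactly because \<open>\<sigma> v \<noteq> -1\<close>.\<close>

lemma upper1_limit: "j \<in> {1..r} \<Longrightarrow> \<exists>\<omega>. \<omega> \<noteq> 1 \<and> ((\<lambda>s. upper1 q h (-(s^2)) j / s) \<longlongrightarrow> \<omega>) at_sector"
proof (induction j rule: induct_down)
  case (edge j)
  show ?case
  proof (cases "j = p + 1")
    case True
    then show ?thesis using const_over[of "- h 0"] by (intro exI[of _ 0]) (simp add: upper1_root[simplified])
  next
    case False
    define v where "v = init j"
    have v: "v \<in> {p+1..r}" "v \<in> {1..r}" and j: "j \<in> R v"
      using init_internal[OF edge.hyps False] R_parent[OF edge.hyps] by (auto simp: v_def)
    note nz = R_internal(3,4)[OF j v(1)]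
    obtain \<omega> where \<omega>: "\<omega> \<noteq> 1" "((\<lambda>s. upper1 q h (-(s^2)) v / s) \<longlongrightarrow> \<omega>) at_sector"
      using edge.IH[OF False] by (auto simp: v_def)
    have "((\<lambda>s. (a v j / a1 v j) * (upper0 q h (-(s^2)) v / s - lower0 q h (-(s^2)) v / s) + lower1 q h (-(s^2)) j / s)
        \<longlongrightarrow> (a v j / a1 v j) * (-1 - \<sigma> v) + 1) at_sector"
      by (intro tendsto_add tendsto_mult tendsto_diff tendsto_const upper0_limits(1)[OF v(2) \<omega>(2,1)] lower0_limit v lower1_limit edge.hyps)
    moreover have "upper1 q h (-(s^2)) j / s = (a v j / a1 v j) * (upper0 q h (-(s^2)) v / s - lower0 q h (-(s^2)) v / s) + lower1 q h (-(s^2)) j / s" for s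
      unfolding upper1_child[OF j v(1)] by (simp add: diff_divide_distrib[symmetric] add_divide_distrib)
    moreover have "(a v j / a1 v j) * (-1 - \<sigma> v) + 1 \<noteq> 1"
    proof -
      have "-1 - \<sigma> v \<noteq> 0" using \<sigma>_neq[OF v(2)] by auto
      then show ?thesis using nz by simp
    qed
    ultimately show ?thesis by (intro exI[of _ "(a v j / a1 v j) * (-1 - \<sigma> v) + 1"]) simp
  qed
qed

lemma eventually_regular: "eventually (\<lambda>s. regular (-(s^2))) at_sector"
proof -
  have nonzero: "eventually (\<lambda>s. f s \<noteq> 0) at_sector" if "((\<lambda>s. f s / s) \<longlongrightarrow> c) at_sector" "c \<noteq> 0" for f and c :: complex
    using tendsto_imp_eventually_ne[OF that] by eventually_elim auto
  have 1: "eventually (\<lambda>s. val10 q (-(s^2)) j + lower0 q h (-(s^2)) j * val01 q (-(s^2)) j \<noteq> 0) at_sector" if j: "j \<in> {1..r}" for j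
    using tendsto_imp_eventually_ne[OF lower_den_limit[OF j lower0_limit[OF j]], of 0] \<sigma>_neq[OF j]
    by (auto simp: add_eq_0_iff elim: eventually_mono)
  have 2: "eventually (\<lambda>s. der01 q (-(s^2)) j - upper1 q h (-(s^2)) j * val01 q (-(s^2)) j \<noteq> 0) at_sector" if j: "j \<in> {1..r}" for j
    using upper1_limit[OF j] upper0_limits(2)[OF j] by blast
  have u: "((\<lambda>s. upper0 q h (-(s^2)) j / s) \<longlongrightarrow> -1) at_sector" if j: "j \<in> {1..r}" for j
    using upper1_limit[OF j] upper0_limits(1)[OF j] by blast
  have 3: "eventually (\<lambda>s. upper0 q h (-(s^2)) j \<noteq> 0) at_sector" if j: "j \<in> {1..r}" for j
    by (rule nonzero[OF u[OF j]]) simp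
  have "((\<lambda>s. lower1 q h (-(s^2)) (p+1) / s + h 0 / s) \<longlongrightarrow> 1 + 0) at_sector"
    by (intro tendsto_add lower1_limit lower0_limit const_over init_root)
  then have 4: "eventually (\<lambda>s. lower1 q h (-(s^2)) (p+1) + h 0 \<noteq> 0) at_sector"
    by (intro nonzero[of _ 1]) (simp_all add: add_divide_distrib)
  have 5: "eventually (\<lambda>s. upper0 q h (-(s^2)) k + h k \<noteq> 0) at_sector" if k: "k \<in> {1..p}" for k
  proof -
    have "k \<in> {1..r}" using k init_root(2) by auto
    then have "((\<lambda>s. upper0 q h (-(s^2)) k / s + h k / s) \<longlongrightarrow> -1 + 0) at_sector"
      by (intro tendsto_add u const_over)
    then show ?thesis by (intro nonzero[of _ "-1"]) (simp_all add: add_divide_distrib)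
  qed
  show ?thesis
    unfolding regular_def
    by (intro eventually_conj eventually_ball_finite ballI 1 2 3 4 5) auto
qed

end

section \<open>Structure, uniqueness and existence of Weyl solutions\<close>

context sl_problem
begin

text \<open>Determinant 1 of the transfer matrix. The first identity shows that the upper solution
  with value 1 at \<open>x = 0\<close> does not vanish at \<open>x = 1\<close>.\<close>

lemma upper_transfer:
  assumes j: "j \<in> {1..r}" and nz: "der01 q l j - upper1 q h l j * val01 q l j \<noteq> 0"
  shows "val10 q l j + val01 q l j * upper0 q h l j = 1 / (der01 q l j - upper1 q h l j * val01 q l j)"
    "der10 q l j + der01 q l j * upper0 q h l j = upper1 q h l j * (val10 q l j + val01 q l j * upper0 q h l j)"
proof -
  have u: "upper0 q h l j * (der01 q l j - upper1 q h l j * val01 q l j) = upper1 q h l j * val10 q l j - der10 q l j"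
    using nz by (simp add: upper0_def)
  have "(val10 q l j + val01 q l j * upper0 q h l j) * (der01 q l j - upper1 q h l j * val01 q l j) = 1"
    using u edge_wronskian[OF j, of l] by algebra
  then show "val10 q l j + val01 q l j * upper0 q h l j = 1 / (der01 q l j - upper1 q h l j * val01 q l j)"
    using nz by (simp add: field_simps)
  show "der10 q l j + der01 q l j * upper0 q h l j = upper1 q h l j * (val10 q l j + val01 q l j * upper0 q h l j)"
    using u by algebra
qed

lemma regularD:
  assumes "regular l" "j \<in> {1..r}"
  shows "val10 q l j + lower0 q h l j * val01 q l j \<noteq> 0" "der01 q l j - upper1 q h l j * val01 q l j \<noteq> 0" "upper0 q h l j \<noteq> 0"
  using assms unfolding regular_def by auto

lemma lower1_mult: "regular l \<Longrightarrow> j \<in> {1..r} \<Longrightarrow>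
    lower1 q h l j * (val10 q l j + lower0 q h l j * val01 q l j) = der10 q l j + lower0 q h l j * der01 q l j"
  using regularD(1) by (simp add: lower1_def)

lemma wsolD:
  assumes "wsol q h l g Y Y'"
  shows "\<And>j. j \<in> {1..r} \<Longrightarrow> edge_sol (q j) l (Y j) (Y' j)" "matching p r init a a1 a0 Y Y'"
    "Y' (p+1) 1 + h 0 * Y (p+1) 1 = g 0" "\<And>j. j \<in> {1..p} \<Longrightarrow> Y' j 0 + h j * Y j 0 = g j"
  using assms unfolding wsol_def by blast+

text \<open>A solution without source in the subtree hanging at an edge is a multiple of the lower
  solution there, and above the source it is a multiple of the upper one.\<close>

lemma off_source:
  assumes reg: "regular l" and ws: "wsol q h l g Y Y'" and j: "j \<in> {1..r}"
    and off: "\<And>i. i \<in> {1..p} \<Longrightarrow> onpath i j \<Longrightarrow> g i = 0"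
  shows "Y' j 0 = lower0 q h l j * Y j 0 \<and> Y' j 1 = lower1 q h l j * Y j 1"
  using j off
proof (induction j rule: induct_up)
  case (edge j)
  have lower: "Y' j 0 = lower0 q h l j * Y j 0"
  proof (cases "j \<le> p")
    case True
    then have "g j = 0" using edge.prems[of j] edge.hyps onpath_refl by auto
    then show ?thesis using wsolD(4)[OF ws, of j] edge.hyps True by (simp add: lower0_leaf add_eq_0_iff2)
  next
    case False
    then have jj: "j \<in> {p+1..r}" using edge.hyps by auto
    note m = matchingD[OF wsolD(2)[OF ws] jj]
    have "Y' i 1 = lower1 q h l i * Y i 1" if i: "i \<in> R j" for i
      using edge.IH[OF jj i] edge.prems onpath_step[of _ i] RD[OF i] by blast
    then have "Y' j 0 = (\<Sum>i\<in>R j. (a1 j i * lower1 q h l i + a0 j i) / a j i * Y j 0)"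
      unfolding m(3) using m(1) by (intro sum.cong) (auto simp: field_simps add_divide_distrib)
    then show ?thesis by (simp add: lower0_internal[OF jj] sum_distrib_right)
  qed
  note e = end_values[OF edge.hyps wsolD(1)[OF ws edge.hyps]]
  have "Y' j 1 = lower1 q h l j * Y j 1"
    using e lower lower1_mult[OF reg edge.hyps] by algebra
  with lower show ?case by blast
qed

text \<open>Without a source every edge carries the lower solution. The root condition kills its
  value at the root, and vanishing spreads outwards, since a lower solution that vanishes at
  \<open>x = 1\<close> vanishes at \<open>x = 0\<close>.\<close>

lemma wsol_zero:
  assumes reg: "regular l" and ws: "wsol q h l (\<lambda>_. 0) Y Y'" and j: "j \<in> {1..r}" and x: "x \<in> {0..1}"
  shows "Y j x = 0"
proof -
  have "Y j 0 = 0 \<and> Y' j 0 = 0"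
    using j
  proof (induction j rule: induct_down)
    case (edge j)
    note o = off_source[OF reg ws edge.hyps]
    have end0: "Y j 1 = 0"
    proof (cases "j = p + 1")
      case True
      then have "(lower1 q h l (p+1) + h 0) * Y (p+1) 1 = 0"
        using o wsolD(3)[OF ws] by (simp add: distrib_right)
      then show ?thesis using reg True unfolding regular_def by auto
    next
      case False
      note v = init_internal[OF edge.hyps False]
      show ?thesis
        using matchingD(1)[OF wsolD(2)[OF ws] v R_parent[OF edge.hyps]] edge.IH[OF False] by simp
    qed
    have "(val10 q l j + lower0 q h l j * val01 q l j) * Y j 0 = 0"
      using end_values(1)[OF edge.hyps wsolD(1)[OF ws edge.hyps]] o end0 by (simp add: algebra_simps)
    then show ?case using regularD(1)[OF reg edge.hyps] o by simp
  qed
  then show ?thesis using sol_zero[OF q[OF j] wsolD(1)[OF ws j] _ _ x] by simp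
qed

lemma wsol_unique:
  assumes reg: "regular l" and ws: "wsol q h l g Y Y'" "wsol q h l g Z Z'" and j: "j \<in> {1..r}" and x: "x \<in> {0..1}"
  shows "Y j x = Z j x"
proof -
  let ?D = "\<lambda>j x. 1 * Y j x + (-1) * Z j x" and ?D' = "\<lambda>j x. 1 * Y' j x + (-1) * Z' j x"
  have "wsol q h l (\<lambda>_. 0) ?D ?D'"
    unfolding wsol_def
  proof (intro conjI ballI)
    show "edge_sol (q j) l (?D j) (?D' j)" if "j \<in> {1..r}" for j
      by (intro sol_lincomb wsolD(1)[OF ws(1)] wsolD(1)[OF ws(2)] that)
    show "matching p r init a a1 a0 ?D ?D'"
      using wsolD(2)[OF ws(1)] wsolD(2)[OF ws(2)] unfolding matching_def
      by (auto simp: algebra_simps sum.distrib sum_subtractf)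
    show "?D' (p+1) 1 + h 0 * ?D (p+1) 1 = 0"
      using wsolD(3)[OF ws(1)] wsolD(3)[OF ws(2)] by (simp add: algebra_simps)
    show "?D' j 0 + h j * ?D j 0 = 0" if "j \<in> {1..p}" for j
      using wsolD(4)[OF ws(1) that] wsolD(4)[OF ws(2) that] by (simp add: algebra_simps)
  qed
  from wsol_zero[OF reg this j x] show ?thesis by simp
qed

lemma on_source:
  assumes reg: "regular l" and k: "k \<in> {1..p}" and ws: "wsol q h l (\<lambda>j. if j = k then 1 else 0) Y Y'"
    and j: "j \<in> {1..r}" and on: "onpath k j"
  shows "Y' j 0 = upper0 q h l j * Y j 0 \<and> Y' j 1 = upper1 q h l j * Y j 1"
  using j on
proof (induction j rule: induct_down)
  case (edge j)
  have upper: "Y' j 1 = upper1 q h l j * Y j 1"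
  proof (cases "j = p + 1")
    case True
    then show ?thesis using wsolD(3)[OF ws] k upper1_root by (simp add: add_eq_0_iff2)
  next
    case False
    define v where "v = init j"
    have v: "v \<in> {p+1..r}" "v \<in> {1..r}" and jv: "j \<in> R v"
      using init_internal[OF edge.hyps False] R_parent[OF edge.hyps] by (auto simp: v_def)
    have vpath: "Y' v 0 = upper0 q h l v * Y v 0"
      using edge.IH[OF False] onpath_step[OF edge.prems edge.hyps] by (simp add: v_def)
    note m = matchingD[OF wsolD(2)[OF ws] v(1)]
    note nz = R_internal(3,4)[OF jv v(1)]
    have off: "Y' i 1 = lower1 q h l i * Y i 1" if i: "i \<in> R v" "i \<noteq> j" for i
    proof -
      have "\<not> onpath k i"
        using onpath_unique[OF edge.prems, of i] RD[OF i(1)] RD[OF jv] i(2) by auto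
      then have "(if x = k then 1 else 0 :: complex) = 0" if "onpath x i" for x using that by auto
      then show ?thesis using off_source[OF reg ws RD(1)[OF i(1)]] by blast
    qed
    have lov: "lower0 q h l v * Y v 0 = (\<Sum>i\<in>R v. a1 v i * (lower1 q h l i * Y i 1) + a0 v i * Y i 1)"
      unfolding lower0_internal[OF v(1)] sum_distrib_right
      using m(1) by (intro sum.cong) (auto simp: field_simps add_divide_distrib)
    \<comment> \<open>Subtracting the lower solution removes every branch but the one leading to the
      source.\<close>
    have "Y' v 0 - lower0 q h l v * Y v 0 = (\<Sum>i\<in>R v. a1 v i * (Y' i 1 - lower1 q h l i * Y i 1))"
      unfolding m(3) lov sum_subtractf[symmetric] by (intro sum.cong) (auto simp: algebra_simps)
    also have "\<dots> = (\<Sum>i\<in>{j}. a1 v i * (Y' i 1 - lower1 q h l i * Y i 1))"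
      by (rule sum.mono_neutral_right) (use off jv in auto)
    finally have "a1 v j * (Y' j 1 - lower1 q h l j * Y j 1) = (upper0 q h l v - lower0 q h l v) * (a v j * Y j 1)"
      using vpath m(2)[OF jv] by (simp add: algebra_simps)
    then have "Y' j 1 = ((a v j / a1 v j) * (upper0 q h l v - lower0 q h l v) + lower1 q h l j) * Y j 1"
      using nz by (simp add: field_simps)
    then show ?thesis using upper1_child[OF jv v(1)] by simp
  qed
  note e = end_values[OF edge.hyps wsolD(1)[OF ws edge.hyps]]
  have "(der01 q l j - upper1 q h l j * val01 q l j) * Y' j 0 = (upper1 q h l j * val10 q l j - der10 q l j) * Y j 0"
    using e upper by algebra
  then have "Y' j 0 = upper0 q h l j * Y j 0"
    using regularD(2)[OF reg edge.hyps] by (simp add: upper0_def field_simps)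
  with upper show ?case by blast
qed

end

context sl_tree
begin

text \<open>The values at \<open>x = 1\<close> of a solution normalised at the root, where \<open>f j\<close> is the ratio of
  its values at \<open>x = 0\<close> and \<open>x = 1\<close> on the edge \<open>j\<close>; the guards only serve termination.\<close>

function descend :: "(nat \<Rightarrow> complex) \<Rightarrow> nat \<Rightarrow> complex" where
  "descend f j = (if j = p + 1 then 1 else if p < init j \<and> init j \<le> r \<and> (j \<le> p \<or> init j < j) then
     f (init j) * descend f (init j) / a (init j) j else 0)"
  by pat_completeness auto
termination
  by (relation "Wellfounded.measure (\<lambda>(f,k). if k \<le> p then Suc r else k)") auto

declare descend.simps [simp del]

lemma descend_child:
  assumes "j \<in> R k" "k \<in> {p+1..r}"
  shows "descend f j = f k * descend f k / a k j"
  using R_internal[OF assms] RD[OF assms(1)] assms(2) by (subst descend.simps) auto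

end

context sl_problem
begin

text \<open>The slopes at \<open>x = 1\<close> are prescribed, upper on the path from
  \<open>k\<close> to the root and lower off it. The values there follow from continuity starting at
  the root, and one global factor adjusts the source.\<close>

lemma wsol_exists:
  assumes reg: "regular l" and k: "k \<in> {1..p}"
  shows "\<exists>Y Y'. wsol q h l (\<lambda>j. if j = k then 1 else 0) Y Y'"
proof -
  define d where "d = (\<lambda>j. if onpath k j then upper1 q h l j else lower1 q h l j)"
  \<comment> \<open>The inverse transfer matrix, of determinant 1, applied to the end values
    \<open>(1, d j)\<close>; its second component reappears in \<open>B\<close>.\<close>
  define f where "f = (\<lambda>j. der01 q l j - d j * val01 q l j)"
  define t where "t = descend f"
  have kr: "k \<in> {1..r}" using k init_root(2) by auto
  have t0: "t (p + 1) = 1" by (simp add: t_def descend.simps)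
  have fon: "f j \<noteq> 0" if "j \<in> {1..r}" "onpath k j" for j
    using regularD(2)[OF reg that(1)] that(2) by (simp add: f_def d_def)
  have ton: "t j \<noteq> 0" if "j \<in> {1..r}" "onpath k j" for j
    using that
  proof (induction j rule: induct_down)
    case (edge j)
    show ?case
    proof (cases "j = p + 1")
      case False
      note v = init_internal[OF edge.hyps False] and jR = R_parent[OF edge.hyps]
      have "onpath k (init j)" by (rule onpath_step[OF edge.prems edge.hyps])
      then have "t (init j) \<noteq> 0" "f (init j) \<noteq> 0" using edge.IH[OF False] fon[of "init j"] v by auto
      then show ?thesis using R_internal(3)[OF jR v] by (simp add: t_def descend_child[OF jR v])
    qed (use t0 in simp)
  qed
  \<comment> \<open>The boundary form at \<open>v_k\<close> of the solution before
    normalisation.\<close>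
  define N where "N = (upper0 q h l k + h k) * (f k * t k)"
  have N: "N \<noteq> 0" using fon[OF kr onpath_refl] ton[OF kr onpath_refl] reg k by (auto simp: N_def regular_def)
  define A where "A = (\<lambda>j. f j * t j / N)"
  define B where "B = (\<lambda>j. (val10 q l j * d j - der10 q l j) * t j / N)"
  define Y where "Y = (\<lambda>j. ivp_val (q j) (A j) (B j) l)"
  define Y' where "Y' = (\<lambda>j. ivp_der (q j) (A j) (B j) l)"
  have s: "edge_sol (q j) l (Y j) (Y' j)" "Y j 0 = A j" "Y' j 0 = B j" if "j \<in> {1..r}" for j
    unfolding Y_def Y'_def using sol_exists[OF q[OF that]] by blast+
  have e: "Y j 1 = t j / N" "Y' j 1 = d j * (t j / N)" if j: "j \<in> {1..r}" for j
  proof -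
    have "Y j 1 = (val10 q l j * der01 q l j - der10 q l j * val01 q l j) * (t j / N)"
      unfolding end_values(1)[OF j s(1)[OF j]] s(2,3)[OF j] A_def B_def f_def by (simp add: algebra_simps diff_divide_distrib)
    then show "Y j 1 = t j / N" using edge_wronskian[OF j] by simp
    have "Y' j 1 = (val10 q l j * der01 q l j - der10 q l j * val01 q l j) * (d j * (t j / N))"
      unfolding end_values(2)[OF j s(1)[OF j]] s(2,3)[OF j] A_def B_def f_def by (simp add: algebra_simps diff_divide_distrib)
    then show "Y' j 1 = d j * (t j / N)" using edge_wronskian[OF j] by simp
  qed
  have Bon: "B j = upper0 q h l j * A j" if "j \<in> {1..r}" "onpath k j" for j
  proof -
    have "upper0 q h l j * f j = val10 q l j * d j - der10 q l j"
      using fon[OF that] that(2) by (simp add: f_def d_def upper0_def mult.commute)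
    then show ?thesis by (simp add: A_def B_def)
  qed
  have Boff: "B j = lower0 q h l j * A j" if j: "j \<in> {1..r}" "\<not> onpath k j" for j
  proof -
    let ?D = "val10 q l j + lower0 q h l j * val01 q l j"
    \<comment> \<open>Carrying the slope \<open>lower1\<close> back across the edge must return
      \<open>lower0\<close>; multiplying by the denominator of \<open>lower1\<close> makes this
      polynomial.\<close>
    have "?D * (val10 q l j * lower1 q h l j - der10 q l j) = ?D * (lower0 q h l j * (der01 q l j - lower1 q h l j * val01 q l j))"
      using lower1_mult[OF reg j(1)] edge_wronskian[OF j(1), of l] by algebra
    then have "val10 q l j * lower1 q h l j - der10 q l j = lower0 q h l j * (der01 q l j - lower1 q h l j * val01 q l j)"
      using regularD(1)[OF reg j(1)] by (metis mult_left_cancel)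
    then show ?thesis using j(2) by (simp add: A_def B_def f_def d_def)
  qed
  have "wsol q h l (\<lambda>j. if j = k then 1 else 0) Y Y'"
    unfolding wsol_def
  proof (intro conjI ballI)
    show "edge_sol (q j) l (Y j) (Y' j)" if "j \<in> {1..r}" for j by (rule s(1)[OF that])
    show "matching p r init a a1 a0 Y Y'"
      unfolding matching_def
    proof (intro ballI conjI)
      fix v assume v: "v \<in> {p+1..r}"
      then have v1: "v \<in> {1..r}" by auto
      have child: "Y j 1 = Y v 0 / a v j" if j: "j \<in> R v" for j
        unfolding e(1)[OF RD(1)[OF j]] s(2)[OF v1] A_def t_def descend_child[OF j v] by simp
      show "Y v 0 = a v j * Y j 1" if j: "j \<in> R v" for j
        using child[OF j] R_internal(3)[OF j v] by simp
      have "(\<Sum>j\<in>R v. a1 v j * Y' j 1 + a0 v j * Y j 1) = (\<Sum>j\<in>R v. (a1 v j * d j + a0 v j) / a v j) * Y v 0"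
        unfolding sum_distrib_right
      proof (rule sum.cong[OF refl])
        fix j assume j: "j \<in> R v"
        have "Y' j 1 = d j * Y j 1" using e[OF RD(1)[OF j]] by simp
        then show "a1 v j * Y' j 1 + a0 v j * Y j 1 = (a1 v j * d j + a0 v j) / a v j * Y v 0"
          unfolding child[OF j] by (simp add: algebra_simps add_divide_distrib)
      qed
      also have "\<dots> = Y' v 0"
      proof (cases "onpath k v")
        case True
        have "v \<noteq> k" using v k by auto
        then obtain j where j: "j \<in> R v" "onpath k j" using onpath_child[OF True] by blast
        note nz = R_internal(3,4)[OF j(1) v]
        have dj: "d i = lower1 q h l i" if i: "i \<in> R v" "i \<noteq> j" for i
          using onpath_unique[OF j(2), of i] RD[OF i(1)] RD[OF j(1)] i(2) by (auto simp: d_def)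
        have "(\<Sum>i\<in>R v. (a1 v i * d i + a0 v i) / a v i) - lower0 q h l v
            = (\<Sum>i\<in>R v. a1 v i * (d i - lower1 q h l i) / a v i)"
          unfolding lower0_internal[OF v] sum_subtractf[symmetric]
          by (intro sum.cong) (auto simp: diff_divide_distrib add_divide_distrib algebra_simps)
        also have "\<dots> = (\<Sum>i\<in>{j}. a1 v i * (d i - lower1 q h l i) / a v i)"
          by (rule sum.mono_neutral_right) (use dj j in auto)
        also have "\<dots> = upper0 q h l v - lower0 q h l v"
          using nz j(2) upper1_child[OF j(1) v, of q h l] by (simp add: d_def)
        finally have "(\<Sum>i\<in>R v. (a1 v i * d i + a0 v i) / a v i) = upper0 q h l v" by simp
        then show ?thesis using Bon[OF v1 True] s[OF v1] by simp
      next
        case False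
        have "d j = lower1 q h l j" if j: "j \<in> R v" for j
          using onpath_step[of k j] RD[OF j] False by (auto simp: d_def)
        then have "(\<Sum>i\<in>R v. (a1 v i * d i + a0 v i) / a v i) = lower0 q h l v"
          unfolding lower0_internal[OF v] by (intro sum.cong) auto
        then show ?thesis using Boff[OF v1 False] s[OF v1] by simp
      qed
      finally show "Y' v 0 = (\<Sum>j\<in>R v. a1 v j * Y' j 1 + a0 v j * Y j 1)" by simp
    qed
    show "Y' (p+1) 1 + h 0 * Y (p+1) 1 = (if 0 = k then 1 else 0)"
      using e[OF init_root(2)] onpath_root[OF kr] k upper1_root[of q h l] by (simp add: d_def)
    fix j assume j: "j \<in> {1..p}"
    then have jr: "j \<in> {1..r}" using init_root(2) by auto
    show "Y' j 0 + h j * Y j 0 = (if j = k then 1 else 0)"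
    proof (cases "j = k")
      case True
      have "Y' k 0 + h k * Y k 0 = (upper0 q h l k + h k) * (f k * t k / N)"
        using Bon[OF kr onpath_refl] s[OF kr] by (simp add: A_def algebra_simps)
      also have "\<dots> = 1" using N by (simp add: N_def)
      finally show ?thesis using True by simp
    next
      case False
      then have "\<not> onpath k j" using onpath_leaf[of k j] j by auto
      then show ?thesis using Boff[OF jr] s[OF jr] False j by (simp add: lower0_leaf)
    qed
  qed
  then show ?thesis by blast
qed

lemma weyl_solution_iff_wsol:
  assumes "k \<in> {1..p}"
  shows "weyl_solution p r init a a1 a0 q h k l Y Y' \<longleftrightarrow> wsol q h l (\<lambda>j. if j = k then 1 else 0) Y Y'"
proof -
  have "sl_solution r q l Y Y' \<longleftrightarrow> (\<forall>j\<in>{1..r}. edge_sol (q j) l (Y j) (Y' j))"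
    by (rule sl_solution_iff_sol) (rule q)
  then show ?thesis using assms unfolding weyl_solution_def wsol_def by auto
qed

lemma regular_imp_weyl_regular:
  assumes reg: "regular l" and k: "k \<in> {1..p}"
  shows "weyl_regular p r init a a1 a0 q h k l"
  unfolding weyl_regular_def weyl_solution_iff_wsol[OF k]
  using wsol_exists[OF reg k] wsol_unique[OF reg] by blast

text \<open>On its own boundary edge the Weyl solution is an upper solution, and its normalisation
  there reads \<open>(upper0 q h l k + h k) * Y k 0 = 1\<close>.\<close>

lemma weyl_fun_eq:
  assumes reg: "regular l" and k: "k \<in> {1..p}"
  shows "weyl_fun p r init a a1 a0 q h k l = 1 / (upper0 q h l k + h k)"
proof -
  have kr: "k \<in> {1..r}" using k init_root(2) by auto
  have nz: "upper0 q h l k + h k \<noteq> 0" using reg k by (simp add: regular_def)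
  have v: "Y k 0 = 1 / (upper0 q h l k + h k)" if ws: "wsol q h l (\<lambda>j. if j = k then 1 else 0) Y Y'" for Y Y'
  proof -
    have "(upper0 q h l k + h k) * Y k 0 = 1"
      using on_source[OF reg k ws kr onpath_refl] wsolD(4)[OF ws k] by (simp add: algebra_simps)
    then show ?thesis using nz by (simp add: field_simps)
  qed
  obtain Y Y' where ws: "wsol q h l (\<lambda>j. if j = k then 1 else 0) Y Y'" using wsol_exists[OF reg k] by blast
  show ?thesis
    unfolding weyl_fun_def weyl_solution_iff_wsol[OF k]
  proof (rule the_equality)
    show "\<exists>Y Y'. wsol q h l (\<lambda>j. if j = k then 1 else 0) Y Y' \<and> Y k 0 = 1 / (upper0 q h l k + h k)"
      using ws v[OF ws] by blast
  qed (use v in blast)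
qed

end

section \<open>Recovery of the potentials and boundary coefficients\<close>

lemma (in sl_problem) edge_recovery:
  assumes P': "sl_problem p r init a a1 q'" and j: "j \<in> {1..r}"
    and ev: "eventually (\<lambda>s. upper0 q h (-(s^2)) j + b = upper0 q' h' (-(s^2)) j + b' \<and> upper0 q h (-(s^2)) j + b \<noteq> 0) at_sector"
  shows "b = b'" "\<exists>N. negligible N \<and> (\<forall>x\<in>{0..1} - N. q j x = q' j x)"
proof -
  interpret P': sl_problem p r init a a1 a0 q' h' by (rule P')
  obtain \<omega> where \<omega>: "\<omega> \<noteq> 1" "((\<lambda>s. upper1 q h (-(s^2)) j / s) \<longlongrightarrow> \<omega>) at_sector" using upper1_limit[OF j] by blast
  obtain \<omega>' where \<omega>': "\<omega>' \<noteq> 1" "((\<lambda>s. upper1 q' h' (-(s^2)) j / s) \<longlongrightarrow> \<omega>') at_sector" using P'.upper1_limit[OF j] by blast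
  \<comment> \<open>Weyl solutions of the single edge: \<open>M\<close> is the common Weyl function
    for the boundary coefficients \<open>b\<close> and \<open>b'\<close>, and the rest of the tree
    enters through the slopes \<open>upper1\<close> at \<open>x = 1\<close>, so far unrelated in the
    two problems.\<close>
  have "eventually (\<lambda>s. \<exists>y z y' z'. edge_sol (q j) (-(s^2)) y z \<and> edge_sol (q' j) (-(s^2)) y' z' \<and> y 0 = y' 0 \<and>
       z 0 + b * y 0 = 1 \<and> z' 0 + b' * y' 0 = 1 \<and> z 1 = upper1 q h (-(s^2)) j * y 1 \<and> z' 1 = upper1 q' h' (-(s^2)) j * y' 1) at_sector"
    using ev eventually_regular P'.eventually_regular
  proof eventually_elim
    case (elim s)
    let ?l = "-(s^2)"
    define M where "M = 1 / (upper0 q h ?l j + b)"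
    define y where "y = ivp_val (q j) M (upper0 q h ?l j * M) ?l"
    define z where "z = ivp_der (q j) M (upper0 q h ?l j * M) ?l"
    define y' where "y' = ivp_val (q' j) M (upper0 q' h' ?l j * M) ?l"
    define z' where "z' = ivp_der (q' j) M (upper0 q' h' ?l j * M) ?l"
    have s: "edge_sol (q j) ?l y z" "y 0 = M" "z 0 = upper0 q h ?l j * M"
      unfolding y_def z_def using sol_exists[OF q[OF j]] by blast+
    have s': "edge_sol (q' j) ?l y' z'" "y' 0 = M" "z' 0 = upper0 q' h' ?l j * M"
      unfolding y'_def z'_def using sol_exists[OF P'.q[OF j]] by blast+
    have M: "(upper0 q h ?l j + b) * M = 1" using elim(1)[THEN conjunct2] by (simp add: M_def)
    have "z 0 + b * y 0 = (upper0 q h ?l j + b) * M" unfolding s by (simp add: algebra_simps)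
    with M have "z 0 + b * y 0 = 1" by simp
    moreover have "z' 0 + b' * y' 0 = 1"
    proof -
      have "z' 0 + b' * y' 0 = (upper0 q' h' ?l j + b') * M" unfolding s' by (simp add: algebra_simps)
      also have "\<dots> = (upper0 q h ?l j + b) * M" using elim(1)[THEN conjunct1] by simp
      finally show ?thesis using M by simp
    qed
    moreover have "z 1 = upper1 q h ?l j * y 1"
      unfolding end_values[OF j s(1)] s using upper_transfer(2)[OF j regularD(2)[OF elim(2) j]] by algebra
    moreover have "z' 1 = upper1 q' h' ?l j * y' 1"
      unfolding P'.end_values[OF j s'(1)] s' using P'.upper_transfer(2)[OF j P'.regularD(2)[OF elim(3) j]] by algebra
    ultimately show ?case using s(1) s'(1) s(2) s'(2) by metis
  qed
  from borg_marchenko[OF q[OF j] P'.q[OF j] \<omega>(2,1) \<omega>'(2,1) this]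
  show "b = b'" "\<exists>N. negligible N \<and> (\<forall>x\<in>{0..1} - N. q j x = q' j x)" by blast+
qed

text \<open>The common transfer matrix carries the slope from \<open>x = 0\<close> to
  \<open>x = 1\<close>; the value divided by is nonzero by the Wronskian identity.\<close>

lemma (in sl_problem) upper1_determined:
  assumes P': "sl_problem p r init a a1 q'" and j: "j \<in> {1..r}"
    and reg: "regular l" "sl_problem.regular p r init a a1 a0 q' h' l"
    and same: "val10 q l j = val10 q' l j" "val01 q l j = val01 q' l j" "der10 q l j = der10 q' l j" "der01 q l j = der01 q' l j"
    and u: "upper0 q h l j = upper0 q' h' l j"
  shows "upper1 q h l j = upper1 q' h' l j"
proof -
  interpret P': sl_problem p r init a a1 a0 q' h' by (rule P')
  have "val10 q l j + val01 q l j * upper0 q h l j \<noteq> 0"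
    using upper_transfer(1)[OF j regularD(2)[OF reg(1) j]] regularD(2)[OF reg(1) j] by simp
  moreover have "upper1 q h l j * (val10 q l j + val01 q l j * upper0 q h l j) = upper1 q' h' l j * (val10 q l j + val01 q l j * upper0 q h l j)"
    using upper_transfer(2)[OF j regularD(2)[OF reg(1) j]] P'.upper_transfer(2)[OF j P'.regularD(2)[OF reg(2) j]] same u by metis
  ultimately show ?thesis by simp
qed

text \<open>The induction carries \<open>lower0\<close> for every \<open>l\<close>, as it is built
  from recovered data below the edge, but \<open>upper0\<close> only for large \<open>s\<close> in
  the sector, as it comes from Weyl functions at regular points.\<close>

lemma (in sl_problem) tree_recovery:
  assumes P': "sl_problem p r init a a1 q'"
    and weyl: "\<And>k l. k \<in> {1..p} \<Longrightarrow> weyl_regular p r init a a1 a0 q h k l \<Longrightarrow> weyl_regular p r init a a1 a0 q' h' k l \<Longrightarrow>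
        weyl_fun p r init a a1 a0 q h k l = weyl_fun p r init a a1 a0 q' h' k l"
  shows "\<And>j. j \<in> {1..r} \<Longrightarrow> \<exists>N. negligible N \<and> (\<forall>x\<in>{0..1} - N. q j x = q' j x)"
    "\<And>i. i \<in> {0..p} \<Longrightarrow> h i = h' i"
proof -
  interpret P': sl_problem p r init a a1 a0 q' h' by (rule P')
  have both: "eventually (\<lambda>s. regular (-(s^2)) \<and> P'.regular (-(s^2))) at_sector"
    by (intro eventually_conj eventually_regular P'.eventually_regular)
  have same: "val10 q l j = val10 q' l j" "val01 q l j = val01 q' l j" "der10 q l j = der10 q' l j" "der01 q l j = der01 q' l j"
    if "\<exists>N. negligible N \<and> (\<forall>x\<in>{0..1} - N. q j x = q' j x)" "j \<in> {1..r}" for j l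
    using that(1) end_values_cong_AE[OF q[OF that(2)] P'.q[OF that(2)]] by blast+
  have main: "(\<exists>N. negligible N \<and> (\<forall>x\<in>{0..1} - N. q j x = q' j x)) \<and> (\<forall>l. lower0 q h l j = lower0 q' h' l j) \<and>
     eventually (\<lambda>s. upper0 q h (-(s^2)) j = upper0 q' h' (-(s^2)) j) at_sector \<and> (j \<le> p \<longrightarrow> h j = h' j)"
    if "j \<in> {1..r}" for j
    using that
  proof (induction j rule: induct_up)
    case (edge j)
    show ?case
    proof (cases "j \<le> p")
      case True
      then have jp: "j \<in> {1..p}" using edge.hyps by auto
      have ev: "eventually (\<lambda>s. upper0 q h (-(s^2)) j + h j = upper0 q' h' (-(s^2)) j + h' j \<and> upper0 q h (-(s^2)) j + h j \<noteq> 0) at_sector"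
        using both
      proof eventually_elim
        case (elim s)
        have "1 / (upper0 q h (-(s^2)) j + h j) = 1 / (upper0 q' h' (-(s^2)) j + h' j)"
          using weyl[OF jp] regular_imp_weyl_regular[OF _ jp] P'.regular_imp_weyl_regular[OF _ jp]
            weyl_fun_eq[OF _ jp] P'.weyl_fun_eq[OF _ jp] elim by metis
        then show ?case using elim jp unfolding regular_def P'.regular_def by simp
      qed
      note E = edge_recovery[OF P' edge.hyps ev]
      have "eventually (\<lambda>s. upper0 q h (-(s^2)) j = upper0 q' h' (-(s^2)) j) at_sector"
        using ev by eventually_elim (simp add: E(1))
      then show ?thesis using E True by (simp add: lower0_leaf)
    next
      case False
      then have j: "j \<in> {p+1..r}" using edge.hyps by auto
      have IH: "\<exists>N. negligible N \<and> (\<forall>x\<in>{0..1} - N. q i x = q' i x)" "\<And>l. lower0 q h l i = lower0 q' h' l i"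
        "eventually (\<lambda>s. upper0 q h (-(s^2)) i = upper0 q' h' (-(s^2)) i) at_sector" if "i \<in> R j" for i
        using edge.IH[OF j that] by blast+
      have same1: "lower1 q h l i = lower1 q' h' l i" if "i \<in> R j" for i l
        unfolding lower1_def using same[OF IH(1)[OF that] RD(1)[OF that]] IH(2)[OF that] by simp
      have same0: "lower0 q h l j = lower0 q' h' l j" for l
        unfolding lower0_internal[OF j] by (intro sum.cong) (auto simp: same1)
      \<comment> \<open>Any one child suffices: its \<open>upper1\<close> and all lower quantities
        at the vertex are known, and \<open>upper1_child\<close> can be solved for
        \<open>upper0\<close> of \<open>j\<close>.\<close>
      obtain i where i: "i \<in> R j" using internal_child[OF j] by blast
      note nz = R_internal(3,4)[OF i j]
      have ev: "eventually (\<lambda>s. upper0 q h (-(s^2)) j = upper0 q' h' (-(s^2)) j) at_sector"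
        using IH(3)[OF i] both
      proof eventually_elim
        case (elim s)
        have "upper1 q h (-(s^2)) i = upper1 q' h' (-(s^2)) i"
          using upper1_determined[OF P' RD(1)[OF i] _ _ same[OF IH(1)[OF i] RD(1)[OF i]] elim(1)] elim(2) by blast
        then show ?case
          unfolding upper1_child[OF i j] using nz same1[OF i] same0 by simp
      qed
      have "eventually (\<lambda>s. upper0 q h (-(s^2)) j + 0 = upper0 q' h' (-(s^2)) j + 0 \<and> upper0 q h (-(s^2)) j + 0 \<noteq> 0) at_sector"
        using ev both by eventually_elim (use regularD(3) edge.hyps in auto)
      from edge_recovery(2)[OF P' edge.hyps this] show ?thesis using same0 ev False by blast
    qed
  qed
  show "\<And>j. j \<in> {1..r} \<Longrightarrow> \<exists>N. negligible N \<and> (\<forall>x\<in>{0..1} - N. q j x = q' j x)"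
    using main by blast
  \<comment> \<open>At the root \<open>upper1\<close> is the constant \<open>- h 0\<close>, so one
    regular \<open>s\<close> decides.\<close>
  have "h 0 = h' 0"
  proof -
    note m = main[OF init_root(2)]
    have "eventually (\<lambda>s. upper0 q h (-(s^2)) (p+1) = upper0 q' h' (-(s^2)) (p+1) \<and> regular (-(s^2)) \<and> P'.regular (-(s^2))) at_sector"
    proof -
      have "eventually (\<lambda>s. upper0 q h (-(s^2)) (p+1) = upper0 q' h' (-(s^2)) (p+1)) at_sector" using m by blast
      then show ?thesis using both by eventually_elim blast
    qed
    then obtain s where "upper0 q h (-(s^2)) (p+1) = upper0 q' h' (-(s^2)) (p+1)" "regular (-(s^2))" "P'.regular (-(s^2))"
      using eventually_happens'[OF at_sector_neq_bot] by blast
    then have "upper1 q h (-(s^2)) (p+1) = upper1 q' h' (-(s^2)) (p+1)"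
      using upper1_determined[OF P' init_root(2) _ _ same[OF _ init_root(2)]] m by blast
    then show ?thesis by (simp only: upper1_root neg_equal_iff_equal)
  qed
  then show "h i = h' i" if "i \<in> {0..p}" for i
    using main[of i] that init_root(2) by (cases "i = 0") auto
qed

theorem theorem2p6:
  fixes p r :: nat and init :: "nat \<Rightarrow> nat"
    and a a1 a0 :: "nat \<Rightarrow> nat \<Rightarrow> complex"
    and q q' :: "nat \<Rightarrow> real \<Rightarrow> complex"
    and h h' :: "nat \<Rightarrow> complex"
  assumes tree: "tree_ok p r init"
    and coeffs: "matching_coeffs_ok p r init a a1"
    and q_L1: "\<forall>j\<in>{1..r}. set_integrable lborel {0..1::real} (q j)"
    and q'_L1: "\<forall>j\<in>{1..r}. set_integrable lborel {0..1::real} (q' j)"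
    and weyl_eq: "\<forall>k\<in>{1..p}. \<forall>lam.
        weyl_regular p r init a a1 a0 q h k lam \<and> weyl_regular p r init a a1 a0 q' h' k lam \<longrightarrow>
        weyl_fun p r init a a1 a0 q h k lam = weyl_fun p r init a a1 a0 q' h' k lam"
  shows "(\<forall>j\<in>{1..r}. AE x in lborel. x \<in> {0..1} \<longrightarrow> q j x = q' j x) \<and>
         (\<forall>i\<in>{0..p}. h i = h' i)"
proof -
  interpret P: sl_problem p r init a a1 a0 q h
    by unfold_locales (use tree coeffs q_L1 set_integrable_lborel_abs_int in auto)
  have P': "sl_problem p r init a a1 q'"
    by unfold_locales (use tree coeffs q'_L1 set_integrable_lborel_abs_int in auto)
  have "weyl_fun p r init a a1 a0 q h k l = weyl_fun p r init a a1 a0 q' h' k l"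
    if "k \<in> {1..p}" "weyl_regular p r init a a1 a0 q h k l" "weyl_regular p r init a a1 a0 q' h' k l" for k l
    using weyl_eq that by simp
  note rec = P.tree_recovery[OF P' this]
  show ?thesis
  proof (intro conjI ballI)
    fix j assume "j \<in> {1..r}"
    then obtain N where "negligible N" "\<forall>x\<in>{0..1} - N. q j x = q' j x"
      using rec(1) by blast
    then show "AE x in lborel. x \<in> {0..1} \<longrightarrow> q j x = q' j x"
      by (intro AE_lborel_negligible[of N]) auto
  qed (rule rec(2))
qed

end
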